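(* Let $k\ge 80$ be an even integer, $w=k-2$, and let $f(z)=\sum_{n\ge1}a(n)e^{2\pi i n z}$ be a Hecke eigenform in the space of holomorphic cusp forms of weight $k$ for $\mathrm{SL}(2,\mathbb Z)$, with $L$-function $L_f(s)=\sum_{n\ge1}a(n)n^{-s}$. Let $$r_f^-(X)=\sum_{\substack{n=1\\ n\ \mathrm{odd}}}^{w-1}(-1)^{\frac{n-1}{2}}\binom{w}{n}\,n!\,(2\pi)^{-n-1}L_f(n+1)\,X^{w-n}$$ be its odd period polynomial, of degree $w-1$. Then all but $5$ of the zeros of $r_f^-$ (counted with multiplicity) lie on the unit circle; the $5$ zeros off the unit circle are simple zeros at $z=0,2,-2,\tfrac12,-\tfrac12$. Moreover $r_f^-$ has double zeros at $z=1$ and $z=-1$.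
   Context: $L_f(s)$ is defined by the Dirichlet series for $\Re s$ large and by analytic continuation elsewhere. (The paper phrases the result for the normalized polynomial $p_f^-(X)=2\pi r_f^-(X)/\big((-1)^{w/2}(2\pi)^{-w}(w-1)!\big)$, which has the same zeros as $r_f^-$.) *)

theory Defs
  imports
    "HOL-Complex_Analysis.Complex_Analysis"
    "HOL-Computational_Algebra.Computational_Algebra"
begin

definition upper_half_plane :: "complex set" where
  "upper_half_plane = {z. Im z > 0}"

definition has_q_expansion :: "(complex \<Rightarrow> complex) \<Rightarrow> (nat \<Rightarrow> complex) \<Rightarrow> bool" where
  "has_q_expansion f a \<longleftrightarrow>
     (\<forall>z\<in>upper_half_plane.
        (\<lambda>n. a n * exp (2 * of_real pi * \<i> * of_nat n * z)) sums f z)"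

definition cusp_form :: "nat \<Rightarrow> (complex \<Rightarrow> complex) \<Rightarrow> bool" where
  "cusp_form k f \<longleftrightarrow>
     f holomorphic_on upper_half_plane \<and>
     (\<forall>a b c d :: int. a * d - b * c = 1 \<longrightarrow>
        (\<forall>z\<in>upper_half_plane.
           f ((of_int a * z + of_int b) / (of_int c * z + of_int d)) =
             (of_int c * z + of_int d) ^ k * f z)) \<and>
     (\<exists>a. a 0 = 0 \<and> has_q_expansion f a)"

(* T_n f (z) = n^(k-1) * (sum over m * d = n and 0 <= b < d of d^(-k) f ((m z + b) / d)) *)
definition hecke_op :: "nat \<Rightarrow> nat \<Rightarrow> (complex \<Rightarrow> complex) \<Rightarrow> complex \<Rightarrow> complex" where
  "hecke_op k n f z =
     of_nat n ^ (k - 1) *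
     (\<Sum>d | d dvd n. \<Sum>b<d.
        f ((of_nat (n div d) * z + of_nat b) / of_nat d) / of_nat d ^ k)"

(* Eigenforms are nonzero, but not required to be normalized to have first coefficient 1. *)
definition hecke_eigenform :: "nat \<Rightarrow> (complex \<Rightarrow> complex) \<Rightarrow> bool" where
  "hecke_eigenform k f \<longleftrightarrow>
     cusp_form k f \<and>
     (\<exists>z\<in>upper_half_plane. f z \<noteq> 0) \<and>
     (\<forall>n>0. \<exists>ev. \<forall>z\<in>upper_half_plane. hecke_op k n f z = ev * f z)"

(* The entire continuation of the Dirichlet series, which is unique if it exists.
   The series starts at n = 1, hence the index shift; a 0 is irrelevant. *)
definition L_function :: "(nat \<Rightarrow> complex) \<Rightarrow> complex \<Rightarrow> complex" where
  "L_function a =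
     (THE L. L holomorphic_on UNIV \<and>
        (\<exists>\<sigma>::real. \<forall>s. Re s > \<sigma> \<longrightarrow>
           (\<lambda>n. a (Suc n) * of_nat (Suc n) powr (-s)) sums L s))"

definition odd_period_poly :: "nat \<Rightarrow> (nat \<Rightarrow> complex) \<Rightarrow> complex poly" where
  "odd_period_poly w a =
     (\<Sum>n | n \<in> {1..w-1} \<and> odd n.
        monom ((-1) ^ ((n - 1) div 2) * of_nat (w choose n) * fact n
                 * (2 * of_real pi) powi (- int n - 1)
                 * L_function a (of_nat (n + 1)))
              (w - n))"

end

theory Submission
  imports Defs
begin

text \<open>
  Up to a constant factor the odd period polynomial is \<open>X P(X\<^sup>2)\<close>, where the \<open>i\<close>-th coefficient of \<open>P\<close> is
  the coefficient \<open>(-1)\<^sup>i (2\<pi>)\<^bsup>2i+1\<^esup> / (2i+1)!\<close> of \<open>sin(2\<pi>X)\<close> times \<open>L(w - 2i) / a(1)\<close>, a real number close to \<open>1\<close>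
  as long as \<open>i\<close> is small. The functional equation makes \<open>P\<close> palindromic, so that \<open>P\<close> is twice the real part of
  a rotation of one half \<open>Q\<close> of it on the unit circle, and \<open>Q(Y) / (Y - 1)\<close> stays so close to
  \<open>sin(2\<pi>X) / (X (X\<^sup>2 - 1))\<close> that its winding, together with the rotation, produces all the zeros
  on the circle (here \<open>Y = X\<^sup>2\<close>). The zeros at \<open>\<plusminus>1\<close>, \<open>\<plusminus>2\<close>, \<open>\<plusminus>1/2\<close> come from shifting contours.

  Two points replace deeper facts. Comparing suprema of the invariant function \<open>|f(z)| y\<^bsup>k/2\<^esup>\<close> in the Hecke relation
  bounds the eigenvalues by \<open>n\<^bsup>k/2+1\<^esup>\<close>, which suffices instead of Deligne's bound since \<open>k \<ge> 80\<close>.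
  The eigenvalues are real because \<open>\<langle>T\<^sub>n f, f\<rangle>\<close>, unfolded to a sum over all integral matrices of determinant \<open>n\<close>,
  is symmetric under passing to the adjugate matrix.
\<close>

section \<open>The upper half plane and the Siegel set\<close>

text \<open>In the variable Y the limit function sin(2 pi X) / X has the zeros Y = n^2/4, of which
  only 1/4 lies inside the unit circle and only 1 on it. The factor Y - 1 removes the latter;
  dividing by a further factor Y compensates the winding due to the former, and what remains has
  positive real part on the whole circle. This open condition passes to Q once the L-values are
  close enough to a(1). For P of degree m the phase then gains (m - 3) pi instead of m pi, which
  gives m - 4 zeros on the circle besides Y = 1. With the double zero Y = 1 and the zeros 4 and 1/4
  the degree is used up, so no further zero has to be located.

  The obstacle is that L-values near the centre of symmetry need not be close to a(1). They are only
  bounded by a power of k, which is harmless because they are multiplied by sine coefficients of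
  index about k/4, whose factorial denominators win. The threshold 80 comes from estimating all
  these deviations together by a multiple of exp(6 pi) / 2^(k/2).\<close>

lemma Im_moebius:
  fixes a b c d :: int and z :: complex
  assumes "of_int c * z + of_int d \<noteq> (0::complex)"
  shows "Im ((of_int a * z + of_int b) / (of_int c * z + of_int d)) =
    of_int (a * d - b * c) * Im z / (cmod (of_int c * z + of_int d))\<^sup>2"
  by (simp add: Im_divide cmod_power2 algebra_simps)

lemma moebius_denom_nonzero:
  fixes c d :: int and z :: complex
  assumes "Im z > 0" "(c, d) \<noteq> (0, 0)"
  shows "of_int c * z + of_int d \<noteq> (0::complex)"
  using assms by (auto simp: complex_eq_iff)

text \<open>The height 1/5 is what Dirichlet approximation yields without any reduction theory. The
  set meets every orbit and need not be a fundamental domain: it enters only through bounds and,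
  slightly enlarged, through a weighted average over orbits.\<close>

definition siegel_set :: "complex set" where
  "siegel_set = {z. \<bar>Re z\<bar> \<le> 1/2 \<and> Im z \<ge> 1/5}"

text \<open>Put z = x + i y. Dirichlet approximation of x with denominators up to N, about
  1/sqrt(y), gives q with |q x - h| < 1/N <= sqrt(y) and q y <= 2 sqrt(y), so |q z - h|^2 <= y + 4
  y.\<close>

lemma siegel_small_denominator:
  fixes z :: complex
  assumes "Im z > 0"
  obtains c d :: int where "(c, d) \<noteq> (0, 0)" "(cmod (of_int c * z + of_int d))\<^sup>2 \<le> 5 * Im z"
proof (cases "Im z \<ge> 1")
  case True
  then show ?thesis using that[of 0 1] by simp
next
  case False
  define y where "y = Im z"
  have y: "0 < y" "y < 1" using assms False by (auto simp: y_def)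
  define N where "N = nat \<lceil>1 / sqrt y\<rceil>"
  have sy: "0 < sqrt y" "sqrt y < 1" using y by auto
  have N1: "1 / sqrt y \<le> real N" unfolding N_def by (simp add: le_nat_iff real_nat_ceiling_ge)
  have "1 < 1 / sqrt y" using sy by simp
  have N2: "real N < 1 / sqrt y + 1" unfolding N_def
    using \<open>1 < 1 / sqrt y\<close> by linarith
  hence N3: "real N \<le> 2 / sqrt y" using \<open>1 < 1 / sqrt y\<close> by simp
  have N0: "N > 0" using N1 sy 
    by (intro gr0I) (auto simp: field_simps)
  have "\<exists>q h::int. 0 < q \<and> q \<le> int N \<and> \<bar>of_int q * Re z - of_int h\<bar> < 1 / real N"
  proof (rule Dirichlet_approx_simult[OF N0, of 1 "\<lambda>_. Re z"])
    fix q and p :: "nat \<Rightarrow> int"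
    assume A: "0 < q" "q \<le> int (N ^ 1)" "\<And>i. i < 1 \<Longrightarrow> \<bar>of_int q * Re z - of_int (p i)\<bar> < 1 / real N"
    show ?thesis using A(1,2) A(3)[of 0] by auto
  qed
  then obtain q h where qp: "0 < q" "q \<le> int N" and h: "\<bar>of_int q * Re z - of_int h\<bar> < 1 / real N"
    by blast
  have "1 / real N \<le> sqrt y" using N1 sy N0 by (simp add: field_simps)
  hence "\<bar>of_int q * Re z - of_int h\<bar>\<^sup>2 \<le> (sqrt y)\<^sup>2" using h by (intro power_mono) auto
  hence A: "(of_int q * Re z - of_int h)\<^sup>2 \<le> y" using y by simp
  have "real_of_int q \<le> 2 / sqrt y" using qp(2) N3 by simp
  hence "(of_int q * y) \<le> 2 / sqrt y * y" using y by (intro mult_right_mono) auto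
  also have "\<dots> = 2 * sqrt y" using y real_sqrt_mult_self[of y] by (simp add: field_simps del: real_sqrt_mult_self)
  finally have "(of_int q * y)\<^sup>2 \<le> (2 * sqrt y)\<^sup>2" using qp(1) y by (intro power_mono) auto
  hence B: "(of_int q * y)\<^sup>2 \<le> 4 * y" using y by (simp add: power_mult_distrib)
  have "(cmod (of_int q * z + of_int (-h)))\<^sup>2 = (of_int q * Re z - of_int h)\<^sup>2 + (of_int q * y)\<^sup>2"
    by (simp add: cmod_power2 y_def)
  also have "\<dots> \<le> 5 * y" using A B by simp
  finally show ?thesis using that[of q "-h"] qp(1) by (simp add: y_def)
qed

text \<open>Dividing a small pair (c, d) by its gcd keeps it small, and Bezout completes a coprime
  pair to a matrix of determinant 1. The new height is Im z / |c z + d|^2 >= 1/5, and a translation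
  by a rounded integer centres the real part.\<close>

lemma exists_siegel_representative:
  fixes z :: complex
  assumes "Im z > 0"
  obtains a b c d :: int where "a * d - b * c = 1"
    "(of_int a * z + of_int b) / (of_int c * z + of_int d) \<in> siegel_set"
proof -
  obtain c0 d0 where cd0: "(c0, d0) \<noteq> (0, 0::int)" "(cmod (of_int c0 * z + of_int d0))\<^sup>2 \<le> 5 * Im z"
    using siegel_small_denominator[OF assms] by blast
  define g where "g = gcd c0 d0"
  have "g \<noteq> 0" "g \<ge> 0" using cd0(1) unfolding g_def by auto
  hence g: "g \<ge> 1" by simp
  obtain c d where cd: "c0 = c * g" "d0 = d * g" and cop: "coprime c d"
    using gcd_coprime_exists[of c0 d0] \<open>g \<noteq> 0\<close> unfolding g_def by blast
  have nz: "(c, d) \<noteq> (0, 0)" using cd0 cd by auto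
  have "of_int c0 * z + of_int d0 = of_int g * (of_int c * z + of_int d)"
    by (simp add: cd algebra_simps)
  hence "cmod (of_int c0 * z + of_int d0) = of_int g * cmod (of_int c * z + of_int d)"
    using g by (simp add: norm_mult)
  hence "cmod (of_int c * z + of_int d) \<le> cmod (of_int c0 * z + of_int d0)"
    using g by (simp add: mult_le_cancel_right1)
  hence le: "(cmod (of_int c * z + of_int d))\<^sup>2 \<le> 5 * Im z"
    using cd0(2) power_mono[of _ _ 2] norm_ge_zero order_trans by blast
  obtain u v where "u * c + v * d = 1"
    using cop bezout_int[of c d] by (auto simp: coprime_iff_gcd_eq_1)
  then have det: "v * d - (-u) * c = 1" by simp
  define z' where "z' = (of_int v * z + of_int (-u)) / (of_int c * z + of_int d)"
  define m where "m = - round (Re z')"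
  have den: "of_int c * z + of_int d \<noteq> 0" by (rule moebius_denom_nonzero[OF assms nz])
  have eq: "(of_int (v + m * c) * z + of_int (-u + m * d)) / (of_int c * z + of_int d) = z' + of_int m"
    using den by (simp add: z'_def field_simps)
  have det': "(v + m * c) * d - (-u + m * d) * c = 1" using det by (simp add: algebra_simps)
  have "Im z' = Im z / (cmod (of_int c * z + of_int d))\<^sup>2"
    unfolding z'_def by (subst Im_moebius[OF den]) (use det in simp)
  moreover have "(cmod (of_int c * z + of_int d))\<^sup>2 > 0" using den by simp
  ultimately have "Im z' \<ge> 1/5" using le by (simp add: le_divide_eq)
  moreover have "\<bar>Re z' + of_int m\<bar> \<le> 1/2"
    using of_int_round_abs_le[of "Re z'"] by (simp add: m_def abs_minus_commute)
  ultimately have "z' + of_int m \<in> siegel_set" by (simp add: siegel_set_def)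
  with eq det' that show thesis by metis
qed

lemma power_le_fact_exp:
  fixes x :: real
  assumes "x \<ge> 0"
  shows "x ^ n \<le> fact n * exp x"
proof -
  have "(\<lambda>n. x ^ n / fact n) sums exp x" using exp_converges[of x] by (simp add: field_simps)
  moreover have "sum (\<lambda>n. x ^ n / fact n) {n} \<le> suminf (\<lambda>n. x ^ n / fact n)"
    using assms calculation by (intro sum_le_suminf) (auto simp: sums_iff)
  ultimately show ?thesis by (simp add: sums_iff field_simps)
qed

section \<open>Growth and decay of a cusp form\<close>

locale cusp_expansion =
  fixes k :: nat and f :: "complex \<Rightarrow> complex" and a :: "nat \<Rightarrow> complex"
  assumes cusp: "cusp_form k f" and qexp: "has_q_expansion f a" and a0: "a 0 = 0"
begin

lemma holo: "f holomorphic_on upper_half_plane"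
  using cusp by (simp add: cusp_form_def)

lemma transform:
  fixes A B C D :: int
  assumes "A * D - B * C = 1" "Im z > 0"
  shows "f ((of_int A * z + of_int B) / (of_int C * z + of_int D)) = (of_int C * z + of_int D) ^ k * f z"
  using cusp assms unfolding cusp_form_def upper_half_plane_def by blast

lemma periodic: "Im z > 0 \<Longrightarrow> f (z + of_int m) = f z"
  using transform[of 1 1 m 0 z] by simp

lemma invert: "Im z > 0 \<Longrightarrow> f (- 1 / z) = z ^ k * f z"
  using transform[of 0 0 "-1" 1 z] by simp

lemma sums_f: "Im z > 0 \<Longrightarrow> (\<lambda>n. a n * exp (2 * of_real pi * \<i> * of_nat n * z)) sums f z"
  using qexp by (simp add: has_q_expansion_def upper_half_plane_def)

lemma norm_q_power: "cmod (exp (2 * of_real pi * \<i> * of_nat n * z)) = exp (- (2 * pi * real n * Im z))"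
  by (simp add: algebra_simps)

lemma q_power: "exp (2 * of_real pi * \<i> * of_nat n * z) = exp (2 * of_real pi * \<i> * z) ^ n"
  by (simp add: exp_of_nat_mult[symmetric] algebra_simps)

lemma summable_abs_coeffs:
  assumes "y > 0"
  shows "summable (\<lambda>n. cmod (a n) * exp (- (2 * pi * real n * y)))"
proof -
  let ?q = "\<lambda>y. exp (2 * of_real pi * \<i> * (\<i> * of_real y))"
  have "(\<lambda>n. a n * exp (2 * of_real pi * \<i> * of_nat n * (\<i> * of_real (y/2)))) sums f (\<i> * of_real (y/2))"
    using assms by (intro sums_f) auto
  hence "summable (\<lambda>n. a n * ?q (y/2) ^ n)" unfolding q_power by (rule sums_summable)
  moreover have "norm (?q y) < norm (?q (y/2))" using assms by simp
  ultimately have "summable (\<lambda>n. norm (a n * ?q y ^ n))" by (rule powser_insidea)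
  moreover have "norm (a n * ?q y ^ n) = cmod (a n) * exp (- (2 * pi * real n * y))" for n
    using norm_q_power[of n "\<i> * of_real y"] by (simp add: q_power[symmetric] norm_mult)
  ultimately show ?thesis by simp
qed

text \<open>As a(0) = 0, every term has a factor exp(-2 pi Im z); what is left over is at most its
  value at height y0, because (n - 1) (Im z - y0) >= 0 for n >= 1.\<close>

lemma decay:
  assumes "y0 > 0"
  obtains C where "C \<ge> 0" "\<And>z. Im z \<ge> y0 \<Longrightarrow> cmod (f z) \<le> C * exp (- (2 * pi * Im z))"
proof -
  define C where "C = exp (2 * pi * y0) * (\<Sum>n. cmod (a n) * exp (- (2 * pi * real n * y0)))"
  have S: "summable (\<lambda>n. cmod (a n) * exp (- (2 * pi * real n * y0)))"
    by (rule summable_abs_coeffs[OF assms])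
  show ?thesis
  proof (rule that[of C])
    show "C \<ge> 0" unfolding C_def using S by (intro mult_nonneg_nonneg suminf_nonneg) auto
    fix z assume z: "Im z \<ge> y0"
    hence z0: "Im z > 0" using assms by simp
    let ?b = "\<lambda>n. exp (- (2 * pi * Im z)) * (exp (2 * pi * y0) * (cmod (a n) * exp (- (2 * pi * real n * y0))))"
    have "cmod (f z) = cmod (\<Sum>n. a n * exp (2 * of_real pi * \<i> * of_nat n * z))"
      using sums_f[OF z0] by (simp add: sums_iff)
    also have "\<dots> \<le> (\<Sum>n. ?b n)"
    proof (rule norm_suminf_le)
      show "summable ?b" by (intro summable_mult S)
      fix n
      show "cmod (a n * exp (2 * of_real pi * \<i> * of_nat n * z)) \<le> ?b n"
      proof (cases "n = 0")
        case True then show ?thesis using a0 by simp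
      next
        case False
        have "(real n - 1) * (Im z - y0) \<ge> 0" using False z by auto
        hence "2 * pi * ((real n - 1) * (Im z - y0)) \<ge> 0" by simp
        hence "exp (- (2 * pi * real n * Im z)) \<le> exp (- (2 * pi * Im z) + 2 * pi * y0 - (2 * pi * real n * y0))"
          by (simp add: algebra_simps)
        also have "\<dots> = exp (- (2 * pi * Im z)) * exp (2 * pi * y0) * exp (- (2 * pi * real n * y0))"
          by (simp add: exp_add exp_diff exp_minus field_simps)
        finally show ?thesis unfolding norm_mult norm_q_power
          by (simp add: mult_left_mono mult.assoc mult.left_commute)
      qed
    qed
    also have "\<dots> = exp (- (2 * pi * Im z)) * C"
      unfolding C_def by (simp only: suminf_mult[OF S] suminf_mult[OF summable_mult[OF S]])
    finally show "cmod (f z) \<le> C * exp (- (2 * pi * Im z))" by (simp add: mult.commute)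
  qed
qed

lemma invariant_norm:
  fixes A B C D :: int
  assumes "k = 2 * h" "A * D - B * C = 1" "Im z > 0"
  defines "w \<equiv> (of_int A * z + of_int B) / (of_int C * z + of_int D)"
  shows "Im w > 0" "cmod (f w) * Im w ^ h = cmod (f z) * Im z ^ h"
proof -
  have den: "of_int C * z + of_int D \<noteq> 0" using assms by (intro moebius_denom_nonzero) auto
  have Im: "Im w = Im z / (cmod (of_int C * z + of_int D))\<^sup>2"
    unfolding w_def Im_moebius[OF den] using assms by simp
  show "Im w > 0" using Im den assms by simp
  show "cmod (f w) * Im w ^ h = cmod (f z) * Im z ^ h"
    unfolding Im unfolding w_def transform[OF assms(2,3)] using den
    by (simp add: norm_mult norm_power assms(1) power_divide power_mult)
qed

text \<open>The invariant |f| y^h need only be bounded on the Siegel set, where the exponential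
  decay of f absorbs y^h.\<close>

lemma bounded_invariant_norm:
  assumes "k = 2 * h"
  obtains M where "\<And>z. Im z > 0 \<Longrightarrow> cmod (f z) * Im z ^ h \<le> M"
proof -
  obtain C where C: "C \<ge> 0" "\<And>z. Im z \<ge> 1/5 \<Longrightarrow> cmod (f z) \<le> C * exp (- (2 * pi * Im z))"
    using decay[of "1/5"] by auto
  show thesis
  proof (rule that[of "C * fact h"])
    fix z :: complex assume z: "Im z > 0"
    obtain A B E D :: int where g: "A * D - B * E = 1"
      "(of_int A * z + of_int B) / (of_int E * z + of_int D) \<in> siegel_set"
      using exists_siegel_representative[OF z] by blast
    define w where "w = (of_int A * z + of_int B) / (of_int E * z + of_int D)"
    have eq: "cmod (f w) * Im w ^ h = cmod (f z) * Im z ^ h"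
      unfolding w_def by (rule invariant_norm[OF assms g(1) z])
    have w: "Im w \<ge> 1/5" using g(2) by (simp add: w_def siegel_set_def)
    have "cmod (f w) * Im w ^ h \<le> (C * exp (- (2 * pi * Im w))) * (fact h * exp (Im w))"
      using w C by (intro mult_mono power_le_fact_exp) auto
    also have "\<dots> = C * fact h * exp (Im w - 2 * pi * Im w)" by (simp add: exp_diff exp_minus field_simps)
    also have "Im w - 2 * pi * Im w \<le> 0" using w pi_gt3 by (simp add: mult_le_cancel_right1)
    hence "C * fact h * exp (Im w - 2 * pi * Im w) \<le> C * fact h * 1" using C(1) by (intro mult_left_mono) auto
    finally show "cmod (f z) * Im z ^ h \<le> C * fact h" using eq by simp
  qed
qed

end

section \<open>Hecke eigenvalues as coefficients\<close>

text \<open>Induction on n: the constant term is the limit at 0, and the rest can be divided by q.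
  The disc is punctured because q = exp(2 pi i z) never vanishes.\<close>

lemma power_series_zero_imp_coeffs_zero:
  fixes e :: "nat \<Rightarrow> complex"
  assumes "\<And>q. q \<noteq> 0 \<Longrightarrow> norm q < 1 \<Longrightarrow> (\<lambda>n. e n * q ^ n) sums 0"
  shows "e n = 0"
  using assms
proof (induction n arbitrary: e)
  case 0
  have "((\<lambda>_. 0) \<longlongrightarrow> e 0) (at (0::complex))"
    using 0 by (intro powser_limit_0_strong[of 1 e "\<lambda>_. 0"]) simp_all
  from tendsto_unique[OF _ this tendsto_const] show ?case by simp
next
  case (Suc n)
  have e0: "e 0 = 0"
  proof -
    have "((\<lambda>_. 0) \<longlongrightarrow> e 0) (at (0::complex))"
      using Suc.prems by (intro powser_limit_0_strong[of 1 e "\<lambda>_. 0"]) simp_all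
    from tendsto_unique[OF _ this tendsto_const] show ?thesis by simp
  qed
  show ?case
  proof (rule Suc.IH)
    fix q :: complex assume q: "q \<noteq> 0" "norm q < 1"
    have "(\<lambda>n. e (Suc n) * q ^ Suc n) sums 0"
      using Suc.prems[OF q] e0 by (subst sums_Suc_iff) simp
    from sums_mult[OF this, of "1/q"] show "(\<lambda>n. e (Suc n) * q ^ n) sums 0"
      using q(1) by (simp add: field_simps)
  qed
qed

lemma sum_roots_of_unity:
  fixes l d :: nat
  assumes "d > 0"
  shows "(\<Sum>b<d. exp (2 * of_real pi * \<i> * of_nat l * of_nat b / of_nat d)) =
    (if d dvd l then of_nat d else (0::complex))"
proof -
  define x where "x = exp (2 * of_real pi * \<i> * (of_nat l / of_nat d))"
  have pw: "exp (2 * of_real pi * \<i> * of_nat l * of_nat b / of_nat d) = x ^ b" for b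
    unfolding x_def exp_of_nat_mult[symmetric] by (simp add: field_simps)
  have xd: "x ^ d = 1"
    unfolding x_def exp_of_nat_mult[symmetric] using assms exp_integer_2pi[of "of_nat l"]
    by (simp add: field_simps)
  have x1: "x = 1 \<longleftrightarrow> d dvd l"
  proof
    assume "d dvd l"
    then obtain j where "l = d * j" by auto
    thus "x = 1" unfolding x_def using assms exp_integer_2pi[of "of_nat j"] by (simp add: field_simps)
  next
    assume "x = 1"
    then obtain j :: int where "2 * pi * (real l / real d) = of_int (2 * j) * pi"
      unfolding x_def exp_eq_1 by auto
    hence "real l = of_int j * real d" using assms by (simp add: field_simps)
    hence "int l = j * int d" by (metis of_int_eq_iff of_int_mult of_int_of_nat_eq)
    thus "d dvd l" by (metis dvd_triv_right int_dvd_int_iff)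
  qed
  show ?thesis
  proof (cases "d dvd l")
    case True
    with x1 show ?thesis by (simp add: pw)
  next
    case False
    with x1 have "x \<noteq> 1" by simp
    with False xd show ?thesis by (simp add: pw geometric_sum)
  qed
qed

context cusp_expansion
begin

text \<open>Summing over the translates b kills every coefficient a(l) with l not divisible by d;
  for l = d j the surviving term carries q^(m j).\<close>

lemma sum_translates_sums:
  assumes z: "Im z > 0" and d: "d > 0" and m: "m > 0"
  shows "(\<lambda>j. (if m dvd j then of_nat d * a (d * (j div m)) else 0) * exp (2 * of_real pi * \<i> * z) ^ j) sums
    (\<Sum>b<d. f ((of_nat m * z + of_nat b) / of_nat d))"
proof -
  define q where "q = exp (2 * of_real pi * \<i> * z)"
  let ?u = "\<lambda>b. (of_nat m * z + of_nat b) / of_nat d"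
  let ?g = "\<lambda>l. a l * exp (2 * of_real pi * \<i> * of_nat l * (of_nat m * z / of_nat d)) * (if d dvd l then of_nat d else 0)"
  have "Im (?u b) > 0" for b using z d m by (simp add: Im_divide_of_nat)
  hence "(\<lambda>l. \<Sum>b<d. a l * exp (2 * of_real pi * \<i> * of_nat l * ?u b)) sums (\<Sum>b<d. f (?u b))"
    by (intro sums_sum sums_f)
  also have "(\<lambda>l. \<Sum>b<d. a l * exp (2 * of_real pi * \<i> * of_nat l * ?u b)) = ?g"
  proof
    fix l
    have "exp (2 * of_real pi * \<i> * of_nat l * ?u b) =
      exp (2 * of_real pi * \<i> * of_nat l * (of_nat m * z / of_nat d)) *
      exp (2 * of_real pi * \<i> * of_nat l * of_nat b / of_nat d)" for b
      by (simp add: exp_add[symmetric] algebra_simps add_divide_distrib)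
    thus "(\<Sum>b<d. a l * exp (2 * of_real pi * \<i> * of_nat l * ?u b)) = ?g l"
      using sum_roots_of_unity[OF d, of l]
      by (simp add: sum_distrib_left[symmetric] mult.assoc)
  qed
  finally have 1: "?g sums (\<Sum>b<d. f (?u b))" .
  have "(\<lambda>j. ?g (d * j)) sums (\<Sum>b<d. f (?u b))"
    by (subst sums_mono_reindex[where f = ?g]) (use 1 d in \<open>auto simp: strict_mono_def\<close>)
  also have "(\<lambda>j. ?g (d * j)) = (\<lambda>j. (of_nat d * a (d * j)) * q ^ (m * j))"
    using d unfolding q_def exp_of_nat_mult[symmetric] by (auto simp: algebra_simps)
  finally have 2: "(\<lambda>j. (of_nat d * a (d * j)) * q ^ (m * j)) sums (\<Sum>b<d. f (?u b))" .
  let ?h = "\<lambda>j. (if m dvd j then of_nat d * a (d * (j div m)) else 0) * q ^ j"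
  have "?h sums (\<Sum>b<d. f (?u b)) \<longleftrightarrow> (\<lambda>j. ?h (m * j)) sums (\<Sum>b<d. f (?u b))"
    by (rule sums_mono_reindex[symmetric]) (use m in \<open>auto simp: strict_mono_def\<close>)
  with 2 m show ?thesis by (simp add: q_def)
qed

text \<open>Comparison of the coefficients of q^1: the divisor d contributes on the Hecke side only
  if n / d divides 1, that is, for d = n.\<close>

lemma hecke_eigenvalue_coeff:
  assumes n: "n > 0" and k: "k > 0" and ev: "\<And>z. Im z > 0 \<Longrightarrow> hecke_op k n f z = ev * f z"
  shows "a n = ev * a 1"
proof -
  let ?c = "\<lambda>d j. (if n div d dvd j then of_nat d * a (d * (j div (n div d))) else 0)"
  define c where "c = (\<lambda>j. of_nat n ^ (k - 1) * (\<Sum>d | d dvd n. ?c d j / of_nat d ^ k))"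
  have sums: "(\<lambda>j. c j * exp (2 * of_real pi * \<i> * z) ^ j) sums hecke_op k n f z" if z: "Im z > 0" for z
  proof -
    have *: "(\<lambda>j. (?c d j * exp (2 * of_real pi * \<i> * z) ^ j) / of_nat d ^ k) sums
      ((\<Sum>b<d. f ((of_nat (n div d) * z + of_nat b) / of_nat d)) / of_nat d ^ k)"
      if "d dvd n" for d
      using that n by (intro sums_divide sum_translates_sums z) (auto intro: dvd_pos_nat dvd_div_eq_0_iff gr0I)
    have "(\<lambda>j. of_nat n ^ (k - 1) * (\<Sum>d | d dvd n. (?c d j * exp (2 * of_real pi * \<i> * z) ^ j) / of_nat d ^ k)) sums
      (of_nat n ^ (k - 1) * (\<Sum>d | d dvd n. (\<Sum>b<d. f ((of_nat (n div d) * z + of_nat b) / of_nat d)) / of_nat d ^ k))"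
      by (intro sums_mult sums_sum) (use * in blast)
    also have "(of_nat n ^ (k - 1) * (\<Sum>d | d dvd n. (\<Sum>b<d. f ((of_nat (n div d) * z + of_nat b) / of_nat d)) / of_nat d ^ k))
       = hecke_op k n f z"
      unfolding hecke_op_def by (simp add: sum_divide_distrib)
    finally show ?thesis by (simp add: c_def sum_distrib_right mult.assoc)
  qed
  have "c 1 - ev * a 1 = 0"
  proof (rule power_series_zero_imp_coeffs_zero[where e = "\<lambda>j. c j - ev * a j"])
    fix q :: complex assume q: "q \<noteq> 0" "norm q < 1"
    define z where "z = Ln q / (2 * of_real pi * \<i>)"
    have qz: "exp (2 * of_real pi * \<i> * z) = q" using q by (simp add: z_def)
    have "Im z = - ln (norm q) / (2 * pi)" using q by (simp add: z_def Im_divide field_simps power2_eq_square)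
    moreover have "ln (norm q) < 0" using q by simp
    ultimately have z: "Im z > 0" by (simp add: divide_neg_pos)
    have "(\<lambda>j. c j * q ^ j - ev * (a j * q ^ j)) sums (hecke_op k n f z - ev * f z)"
      using sums[OF z] sums_f[OF z] unfolding q_power qz by (intro sums_diff sums_mult)
    thus "(\<lambda>j. (c j - ev * a j) * q ^ j) sums 0" by (simp add: ev[OF z] algebra_simps)
  qed
  moreover have "c 1 = a n"
  proof -
    have "(\<Sum>d | d dvd n. ?c d 1 / of_nat d ^ k) = (\<Sum>d | d dvd n. if d = n then of_nat n * a n / of_nat n ^ k else 0)"
      using n by (intro sum.cong refl) (auto simp: dvd_div_eq_iff elim!: dvdE)
    also have "\<dots> = of_nat n * a n / of_nat n ^ k" using n by (simp add: sum.delta)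
    finally have "c 1 = of_nat n ^ (k - 1) * (of_nat n * a n / of_nat n ^ k)" by (simp only: c_def)
    thus ?thesis using n k by (cases k) simp_all
  qed
  ultimately show ?thesis by simp
qed

lemma hecke_eigenvalue_bound:
  assumes n: "n > 0" and k: "k = 2 * h" and h: "h > 0" and z0: "Im z0 > 0" "f z0 \<noteq> 0"
    and ev: "\<And>z. Im z > 0 \<Longrightarrow> hecke_op k n f z = ev * f z"
  shows "cmod ev \<le> real n ^ (h + 1)"
proof -
  define g where "g = (\<lambda>z. cmod (f z) * Im z ^ h)"
  define M where "M = Sup (g ` upper_half_plane)"
  obtain M0 where "\<And>z. Im z > 0 \<Longrightarrow> g z \<le> M0"
    unfolding g_def using bounded_invariant_norm[OF k] by metis
  hence bdd: "bdd_above (g ` upper_half_plane)"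
    by (auto simp: upper_half_plane_def bdd_above_def intro!: exI[of _ M0])
  have gM: "g z \<le> M" if "Im z > 0" for z
    unfolding M_def using that bdd by (intro cSup_upper) (auto simp: upper_half_plane_def)
  have "g z0 > 0" using z0 by (simp add: g_def)
  with gM[OF z0(1)] have M: "M > 0" by simp
  have key: "cmod ev * g z \<le> real n ^ (h + 1) * M" if z: "Im z > 0" for z
  proof -
    \<comment> \<open>With n = d m and y = Im z the point u has height m y / d, so |f(u)| y^h / d^k
      <= M (d / m)^h / d^(2h) = M / n^h.\<close>
    have tm: "cmod (f ((of_nat (n div d) * z + of_nat b) / of_nat d) / of_nat d ^ k) * Im z ^ h \<le> M / real n ^ h"
      if d: "d dvd n" for b d
    proof -
      obtain m where m: "n = d * m" using d by auto
      have pos: "m > 0" "d > 0" using n m by auto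
      define u where "u = (of_nat m * z + of_nat b) / of_nat d"
      have Imu: "Im u = real m * Im z / real d" by (simp add: u_def Im_divide_of_nat)
      hence "Im u > 0" using z pos by simp
      from gM[OF this] have "cmod (f u) * (real m * Im z / real d) ^ h \<le> M" by (simp add: g_def Imu)
      hence "cmod (f u) * Im z ^ h * real m ^ h \<le> M * real d ^ h"
        using pos by (simp add: power_mult_distrib power_divide field_simps)
      also have "M * real d ^ h \<le> M * real d ^ (2 * h) / real d ^ h" using pos by (simp add: power_mult power2_eq_square power_mult_distrib)
      finally show ?thesis using pos by (simp add: m u_def k norm_divide norm_power power_mult_distrib field_simps)
    qed
    have "cmod ev * g z = cmod (hecke_op k n f z) * Im z ^ h"
      by (simp add: ev[OF z] g_def norm_mult)
    also have "\<dots> \<le> real n ^ (k - 1) * (\<Sum>d | d dvd n. \<Sum>b<d. cmod (f ((of_nat (n div d) * z + of_nat b) / of_nat d) / of_nat d ^ k)) * Im z ^ h"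
      unfolding hecke_op_def norm_mult using z
      by (intro mult_right_mono mult_mono order.trans[OF norm_sum] sum_mono norm_sum) (auto simp: norm_power)
    also have "\<dots> = real n ^ (k - 1) * (\<Sum>d | d dvd n. \<Sum>b<d. cmod (f ((of_nat (n div d) * z + of_nat b) / of_nat d) / of_nat d ^ k) * Im z ^ h)"
      by (simp add: sum_distrib_right mult.assoc)
    also have "\<dots> \<le> real n ^ (k - 1) * (\<Sum>d | d dvd n. \<Sum>b<d. M / real n ^ h)"
      by (intro mult_left_mono sum_mono tm) auto
    \<comment> \<open>At most n divisors d with at most n translates each; in total n^(2h-1) n^2 /
      n^h = n^(h+1).\<close>
    also have "\<dots> \<le> real n ^ (k - 1) * (\<Sum>d\<in>{1..n}. \<Sum>b<n. M / real n ^ h)"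
      using n M by (intro mult_left_mono order.trans[OF sum_mono sum_mono2] sum_mono2)
        (auto intro!: sum_nonneg divide_right_mono mult_right_mono dest: dvd_imp_le dvd_pos_nat)
    also have "\<dots> = real n ^ (h + 1) * M"
    proof -
      obtain h' where h': "h = Suc h'" using h by (cases h) auto
      show ?thesis using n by (simp add: k h' power_add field_simps power2_eq_square power_mult)
    qed
    finally show ?thesis .
  qed
  have "cmod ev * M \<le> real n ^ (h + 1) * M"
  proof (cases "ev = 0")
    case True then show ?thesis using M by simp
  next
    case False
    have "Sup (g ` upper_half_plane) \<le> real n ^ (h + 1) * M / cmod ev"
      by (rule cSup_least) (use key False z0 in \<open>auto simp: upper_half_plane_def le_divide_eq mult.commute\<close>)
    hence "M \<le> real n ^ (h + 1) * M / cmod ev" by (simp only: M_def[symmetric])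
    with False show ?thesis by (simp add: field_simps)
  qed
  with M show ?thesis by simp
qed

end

section \<open>Hyperbolic area\<close>

text \<open>In the coordinates \<open>z = e\<^sup>t (u + i)\<close> the hyperbolic area \<open>dx dy / y\<^sup>2\<close> becomes \<open>du dt\<close>,
  and each generator of the action of \<open>GL\<^sub>2\<^sup>+\<close> becomes a composition of shears, reflections and translations,
  so that its invariance needs no Jacobian.\<close>

definition hyp_point :: "real \<times> real \<Rightarrow> complex" where
  "hyp_point p = Complex (exp (snd p) * fst p) (exp (snd p))"

text \<open>Phrased through a measure-preserving lift to the coordinates (u, t), which composes well
  and can be used directly as a substitution in integrals over \<open>lborel\<close>.\<close>

definition preserves_hyp_area :: "(complex \<Rightarrow> complex) \<Rightarrow> bool" where
  "preserves_hyp_area g \<longleftrightarrow>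
     (\<exists>\<sigma>\<in>borel_measurable borel. distr lborel borel \<sigma> = lborel \<and> (\<forall>p. hyp_point (\<sigma> p) = g (hyp_point p)))"

lemma Im_hyp_point_pos [simp]: "Im (hyp_point p) > 0"
  by (simp add: hyp_point_def)

lemma continuous_on_hyp_point: "continuous_on S hyp_point"
  unfolding hyp_point_def Complex_eq by (intro continuous_intros)

lemma hyp_point_surj:
  assumes "Im z > 0"
  obtains p where "hyp_point p = z"
proof
  show "hyp_point (Re z / Im z, ln (Im z)) = z" using assms by (simp add: hyp_point_def complex_eq_iff)
qed

text \<open>Tonelli: on each fibre of constant first coordinate the map is a translation, which
  preserves Lebesgue measure.\<close>

lemma distr_shear_snd:
  fixes c :: "real \<Rightarrow> real"
  assumes [measurable]: "c \<in> borel_measurable borel"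
  shows "distr lborel borel (\<lambda>p. (fst p, snd p + c (fst p))) = lborel"
proof (rule measure_eqI)
  fix A :: "(real \<times> real) set"
  assume "A \<in> sets (distr lborel borel (\<lambda>p. (fst p, snd p + c (fst p))))"
  hence A: "A \<in> sets borel" by simp
  have [measurable]: "A \<in> sets (borel \<Otimes>\<^sub>M borel)" unfolding borel_prod by (rule A)
  have m: "(\<lambda>p. (fst p, snd p + c (fst p))) \<in> measurable (borel \<Otimes>\<^sub>M borel) (borel \<Otimes>\<^sub>M borel)"
    by measurable
  have "emeasure (distr lborel borel (\<lambda>p. (fst p, snd p + c (fst p)))) A =
        (\<integral>\<^sup>+p. indicator A (fst p, snd p + c (fst p)) \<partial>lborel)"
    using m A by (subst nn_integral_indicator[symmetric], simp, subst nn_integral_distr) (auto simp: borel_prod)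
  also have "\<dots> = (\<integral>\<^sup>+u. \<integral>\<^sup>+t. indicator A (u, t + c u) \<partial>lborel \<partial>lborel)"
    unfolding lborel_prod[symmetric]
    using lborel.nn_integral_fst[of "\<lambda>p. indicator A (fst p, snd p + c (fst p))" lborel] by simp
  also have "\<dots> = (\<integral>\<^sup>+u. \<integral>\<^sup>+t. indicator A (u, t) \<partial>lborel \<partial>lborel)"
  proof (rule nn_integral_cong)
    fix u :: real
    have [measurable]: "(\<lambda>t. indicator A (u, t) :: ennreal) \<in> borel_measurable borel" by measurable
    have "(\<integral>\<^sup>+t. indicator A (u, t) \<partial>lborel) = (\<integral>\<^sup>+t. indicator A (u, t) \<partial>(distr lborel borel ((+) (c u))))"
      by (simp only: lborel_distr_plus)
    also have "\<dots> = (\<integral>\<^sup>+t. indicator A (u, c u + t) \<partial>lborel)"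
      using nn_integral_distr[of "(+) (c u)" lborel borel "\<lambda>t. indicator A (u, t)"] by simp
    finally show "(\<integral>\<^sup>+t. indicator A (u, t + c u) \<partial>lborel) = (\<integral>\<^sup>+t. indicator A (u, t) \<partial>lborel)"
      by (simp add: add.commute)
  qed
  also have "\<dots> = (\<integral>\<^sup>+p. indicator A p \<partial>lborel)"
    unfolding lborel_prod[symmetric] using lborel.nn_integral_fst[of "indicator A" lborel] by simp
  also have "\<dots> = emeasure lborel A" using A by simp
  finally show "emeasure (distr lborel borel (\<lambda>p. (fst p, snd p + c (fst p)))) A = emeasure lborel A" .
qed simp

lemma distr_shear_fst:
  fixes c :: "real \<Rightarrow> real"
  assumes [measurable]: "c \<in> borel_measurable borel"
  shows "distr lborel borel (\<lambda>p. (fst p + c (snd p), snd p)) = lborel"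
proof (rule measure_eqI)
  fix A :: "(real \<times> real) set"
  assume "A \<in> sets (distr lborel borel (\<lambda>p. (fst p + c (snd p), snd p)))"
  hence A: "A \<in> sets borel" by simp
  have [measurable]: "A \<in> sets (borel \<Otimes>\<^sub>M borel)" unfolding borel_prod by (rule A)
  have m: "(\<lambda>p. (fst p + c (snd p), snd p)) \<in> measurable (borel \<Otimes>\<^sub>M borel) (borel \<Otimes>\<^sub>M borel)"
    by measurable
  have "emeasure (distr lborel borel (\<lambda>p. (fst p + c (snd p), snd p))) A =
        (\<integral>\<^sup>+p. indicator A (fst p + c (snd p), snd p) \<partial>lborel)"
    using m A by (subst nn_integral_indicator[symmetric], simp, subst nn_integral_distr) (auto simp: borel_prod)
  also have "\<dots> = (\<integral>\<^sup>+t. \<integral>\<^sup>+u. indicator A (u + c t, t) \<partial>lborel \<partial>lborel)"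
    unfolding lborel_prod[symmetric]
    using lborel_pair.nn_integral_snd[of "\<lambda>p. indicator A (fst p + c (snd p), snd p)"] by simp
  also have "\<dots> = (\<integral>\<^sup>+t. \<integral>\<^sup>+u. indicator A (u, t) \<partial>lborel \<partial>lborel)"
  proof (rule nn_integral_cong)
    fix t :: real
    have [measurable]: "(\<lambda>u. indicator A (u, t) :: ennreal) \<in> borel_measurable borel" by measurable
    have "(\<integral>\<^sup>+u. indicator A (u, t) \<partial>lborel) = (\<integral>\<^sup>+u. indicator A (u, t) \<partial>(distr lborel borel ((+) (c t))))"
      by (simp only: lborel_distr_plus)
    also have "\<dots> = (\<integral>\<^sup>+u. indicator A (c t + u, t) \<partial>lborel)"
      using nn_integral_distr[of "(+) (c t)" lborel borel "\<lambda>u. indicator A (u, t)"] by simp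
    finally show "(\<integral>\<^sup>+u. indicator A (u + c t, t) \<partial>lborel) = (\<integral>\<^sup>+u. indicator A (u, t) \<partial>lborel)"
      by (simp add: add.commute)
  qed
  also have "\<dots> = (\<integral>\<^sup>+p. indicator A p \<partial>lborel)"
    unfolding lborel_prod[symmetric] using lborel_pair.nn_integral_snd[of "indicator A"] by simp
  also have "\<dots> = emeasure lborel A" using A by simp
  finally show "emeasure (distr lborel borel (\<lambda>p. (fst p + c (snd p), snd p))) A = emeasure lborel A" .
qed simp

lemma preserves_hyp_area_comp:
  assumes "preserves_hyp_area g" "preserves_hyp_area h"
  shows "preserves_hyp_area (\<lambda>z. g (h z))"
proof -
  obtain \<sigma> where s: "\<sigma> \<in> borel_measurable borel" "distr lborel borel \<sigma> = lborel" "\<forall>p. hyp_point (\<sigma> p) = g (hyp_point p)"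
    using assms(1) unfolding preserves_hyp_area_def by blast
  obtain \<tau> where t: "\<tau> \<in> borel_measurable borel" "distr lborel borel \<tau> = lborel" "\<forall>p. hyp_point (\<tau> p) = h (hyp_point p)"
    using assms(2) unfolding preserves_hyp_area_def by blast
  have "distr lborel borel (\<sigma> \<circ> \<tau>) = distr (distr lborel borel \<tau>) borel \<sigma>"
    using s(1) t(1) by (subst distr_distr) auto
  also have "\<dots> = lborel" using s(2) t(2) by simp
  finally have d: "distr lborel borel (\<sigma> \<circ> \<tau>) = lborel" .
  have m: "\<sigma> \<circ> \<tau> \<in> borel_measurable borel" using s(1) t(1) by (rule measurable_comp[rotated])
  show ?thesis unfolding preserves_hyp_area_def
    by (intro bexI[OF _ m] conjI allI d) (simp only: o_def s(3)[rule_format] t(3)[rule_format])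
qed

lemma preserves_hyp_area_translation: "preserves_hyp_area (\<lambda>z. z + of_real b)"
  unfolding preserves_hyp_area_def
proof (intro bexI conjI allI)
  show "distr lborel borel (\<lambda>p. (fst p + b * exp (- snd p), snd p)) = lborel"
    by (rule distr_shear_fst) measurable
  show "hyp_point (fst p + b * exp (- snd p), snd p) = hyp_point p + of_real b" for p
    by (simp add: hyp_point_def complex_eq_iff algebra_simps exp_minus)
  show "(\<lambda>p. (fst p + b * exp (- snd p), snd p)) \<in> borel_measurable borel"
    by (intro borel_measurable_continuous_onI continuous_intros)
qed

lemma preserves_hyp_area_scaling: "r > 0 \<Longrightarrow> preserves_hyp_area (\<lambda>z. of_real r * z)"
  unfolding preserves_hyp_area_def
proof (intro bexI conjI allI)
  show "distr lborel borel (\<lambda>p::real\<times>real. (fst p, snd p + ln r)) = lborel"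
    using distr_shear_snd[of "\<lambda>_. ln r"] by simp
  show "r > 0 \<Longrightarrow> hyp_point (fst p, snd p + ln r) = of_real r * hyp_point p" for p
    by (simp add: hyp_point_def complex_eq_iff exp_add)
  show "(\<lambda>p::real\<times>real. (fst p, snd p + ln r)) \<in> borel_measurable borel"
    by (intro borel_measurable_continuous_onI continuous_intros)
qed

lemma distr_uminus_real_pair: "distr lborel borel uminus = (lborel :: (real \<times> real) measure)"
  using lborel_affine[of "-1" "0 :: real \<times> real"] by (simp add: density_1 one_ennreal_def[symmetric])

text \<open>-1 / (e^t (u + i)) = e^s (-u + i) with s = -t - ln (1 + u^2): a point reflection
  followed by a shear.\<close>

lemma preserves_hyp_area_inversion: "preserves_hyp_area (\<lambda>z. - 1 / z)"
proof -
  let ?\<sigma> = "\<lambda>p::real\<times>real. (fst p, snd p + (- ln (1 + (fst p)\<^sup>2)))"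
  have m: "?\<sigma> \<in> borel_measurable borel"
    by (intro borel_measurable_continuous_onI continuous_intros) (auto intro: add_pos_nonneg less_imp_neq simp: add_nonneg_eq_0_iff)
  have m2: "?\<sigma> \<circ> uminus \<in> borel_measurable borel"
    by (rule measurable_comp[OF _ m]) simp
  have "distr lborel borel (?\<sigma> \<circ> uminus) = distr (distr lborel borel uminus) borel ?\<sigma>"
    using m by (subst distr_distr) auto
  also have "\<dots> = distr lborel borel ?\<sigma>" by (simp only: distr_uminus_real_pair)
  also have "\<dots> = lborel" by (rule distr_shear_snd) measurable
  finally have d: "distr lborel borel (?\<sigma> \<circ> uminus) = lborel" .
  have h: "hyp_point ((?\<sigma> \<circ> uminus) p) = - 1 / hyp_point p" for p
  proof -
    have pos: "1 + (fst p)\<^sup>2 > 0" by (simp add: add_pos_nonneg)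
    have nz: "hyp_point p \<noteq> 0" by (metis Im_hyp_point_pos less_irrefl zero_complex.sel(2))
    have "(hyp_point ((?\<sigma> \<circ> uminus) p)) * hyp_point p = -1"
    proof -
      define e u where "e = exp (snd p)" and "u = fst p"
      have e: "e > 0" and u: "1 + u * u \<noteq> 0" using pos by (simp_all add: e_def u_def power2_eq_square)
      have E: "exp (- snd p - ln (1 + u\<^sup>2)) = 1 / (e * (1 + u * u))"
        using pos by (simp add: exp_diff exp_minus e_def u_def power2_eq_square divide_inverse)
      show ?thesis
        using e u by (simp add: hyp_point_def complex_eq_iff E e_def[symmetric] u_def[symmetric] divide_simps)
    qed
    with nz show ?thesis by (simp add: field_simps)
  qed
  show ?thesis unfolding preserves_hyp_area_def
    by (rule bexI[OF _ m2]) (use d h in auto)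
qed

lemma preserves_hyp_area_cong:
  assumes "preserves_hyp_area g" "\<And>z. Im z > 0 \<Longrightarrow> g z = h z"
  shows "preserves_hyp_area h"
  using assms unfolding preserves_hyp_area_def by auto

text \<open>For c = 0 the map is affine; otherwise it equals a/c - n / (c^2 (z + d/c)) with n = a d
  - b c, a composition of translations, a scaling and the inversion.\<close>

lemma preserves_hyp_area_moebius:
  fixes a b c d :: int
  assumes "a * d - b * c > 0"
  shows "preserves_hyp_area (\<lambda>z. (of_int a * z + of_int b) / (of_int c * z + of_int d))"
proof (cases "c = 0")
  case True
  with assms have ad: "a * d > 0" by simp
  hence r: "real_of_int a / real_of_int d > 0" by (simp add: zero_less_mult_iff zero_less_divide_iff)
  have "preserves_hyp_area (\<lambda>z. of_real (of_int a / of_int d) * z + of_real (of_int b / of_int d))"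
    by (rule preserves_hyp_area_comp[OF preserves_hyp_area_translation preserves_hyp_area_scaling[OF r]])
  then show ?thesis
    by (rule preserves_hyp_area_cong) (use True ad in \<open>auto simp: add_divide_distrib\<close>)
next
  case False
  define n where "n = a * d - b * c"
  have "n > 0" using assms by (simp add: n_def)
  hence r: "real_of_int n / (real_of_int c)\<^sup>2 > 0" using False by simp
  have "preserves_hyp_area (\<lambda>z. of_real (of_int n / (of_int c)\<^sup>2) * (- 1 / (z + of_real (of_int d / of_int c)))
      + of_real (of_int a / of_int c))"
    by (rule preserves_hyp_area_comp[OF preserves_hyp_area_translation
         preserves_hyp_area_comp[OF preserves_hyp_area_scaling[OF r]
         preserves_hyp_area_comp[OF preserves_hyp_area_inversion preserves_hyp_area_translation]]])
  then show ?thesis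
  proof (rule preserves_hyp_area_cong)
    fix z :: complex assume z: "Im z > 0"
    have den: "of_int c * z + of_int d \<noteq> 0" using False by (intro moebius_denom_nonzero[OF z]) auto
    have c: "(of_int c :: complex) \<noteq> 0" using False by simp
    have e: "z + of_int d / of_int c = (of_int c * z + of_int d) / of_int c" using c by (simp add: field_simps)
    show "of_real (of_int n / (of_int c)\<^sup>2) * (- 1 / (z + of_real (of_int d / of_int c))) + of_real (of_int a / of_int c)
       = (of_int a * z + of_int b) / (of_int c * z + of_int d)"
      using c den by (simp add: e n_def divide_simps) (simp add: algebra_simps power2_eq_square)
  qed
qed

section \<open>Integral matrices of given determinant\<close>

type_synonym imat = "int \<times> int \<times> int \<times> int"

fun mdet :: "imat \<Rightarrow> int" where "mdet (a, b, c, d) = a * d - b * c"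
fun mmul :: "imat \<Rightarrow> imat \<Rightarrow> imat" where
  "mmul (a, b, c, d) (a', b', c', d') = (a * a' + b * c', a * b' + b * d', c * a' + d * c', c * b' + d * d')"
fun madj :: "imat \<Rightarrow> imat" where "madj (a, b, c, d) = (d, - b, - c, a)"
fun mob :: "imat \<Rightarrow> complex \<Rightarrow> complex" where
  "mob (a, b, c, d) z = (of_int a * z + of_int b) / (of_int c * z + of_int d)"
fun jac :: "imat \<Rightarrow> complex \<Rightarrow> complex" where "jac (a, b, c, d) z = of_int c * z + of_int d"

definition mats :: "nat \<Rightarrow> imat set" where "mats n = {A. mdet A = int n}"

lemma mdet_mmul: "mdet (mmul A B) = mdet A * mdet B"
  by (cases A; cases B) (simp add: algebra_simps)

lemma mdet_madj [simp]: "mdet (madj A) = mdet A" and madj_madj [simp]: "madj (madj A) = A"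
  by (cases A; simp)+

lemma mmul_assoc: "mmul (mmul A B) C = mmul A (mmul B C)"
  by (cases A; cases B; cases C) (simp add: algebra_simps)

lemma mmul_one: "mmul (1, 0, 0, 1) A = A"
  by (cases A) simp

lemma mmul_madj: "mmul (madj A) A = (mdet A, 0, 0, mdet A)" "mmul A (madj A) = (mdet A, 0, 0, mdet A)"
  by (cases A; simp add: algebra_simps)+

lemma jac_nonzero:
  assumes "mdet A \<noteq> 0" "Im z > 0"
  shows "jac A z \<noteq> 0"
proof (cases A)
  case (fields a b c d)
  have "(c, d) \<noteq> (0, 0)" using assms(1) fields by auto
  from moebius_denom_nonzero[OF assms(2) this] show ?thesis by (simp add: fields)
qed

lemma Im_mob:
  assumes "mdet A \<noteq> 0" "Im z > 0"
  shows "Im (mob A z) = of_int (mdet A) * Im z / (cmod (jac A z))\<^sup>2"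
proof (cases A)
  case (fields a b c d)
  then show ?thesis using Im_moebius[of c z d a b] jac_nonzero[OF assms] by simp
qed

lemma Im_mob_pos: "mdet A > 0 \<Longrightarrow> Im z > 0 \<Longrightarrow> Im (mob A z) > 0"
  using jac_nonzero[of A z] by (simp add: Im_mob)

lemma mob_mmul:
  assumes "mdet A > 0" "mdet B > 0" "Im z > 0"
  shows "mob (mmul A B) z = mob A (mob B z)" and "jac (mmul A B) z = jac A (mob B z) * jac B z"
proof -
  obtain a b c d where A: "A = (a, b, c, d)" by (cases A)
  obtain a' b' c' d' where B: "B = (a', b', c', d')" by (cases B)
  have nzB: "of_int c' * z + of_int d' \<noteq> 0" using jac_nonzero[of B z] assms by (simp add: B)
  show j: "jac (mmul A B) z = jac A (mob B z) * jac B z"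
    using nzB by (simp add: A B field_simps)
  have "of_int c * ((of_int a' * z + of_int b') / (of_int c' * z + of_int d')) + of_int d \<noteq> 0"
    using jac_nonzero[of A "mob B z"] Im_mob_pos[of B z] assms by (simp add: A B)
  with nzB show "mob (mmul A B) z = mob A (mob B z)"
    by (simp add: A B divide_simps) (simp add: algebra_simps)
qed

lemma finite_lattice_points:
  fixes z :: complex
  assumes "Im z > 0"
  shows "finite {(c::int, d::int). cmod (of_int c * z + of_int d) \<le> B}"
proof -
  define C where "C = \<lceil>B / Im z\<rceil>"
  define D where "D = \<lceil>B + of_int \<bar>C\<bar> * cmod z\<rceil>"
  have "{(c::int, d::int). cmod (of_int c * z + of_int d) \<le> B} \<subseteq> {-\<bar>C\<bar>..\<bar>C\<bar>} \<times> {-D..D}"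
  proof safe
    fix c d :: int
    assume le: "cmod (of_int c * z + of_int d) \<le> B"
    have "\<bar>of_int c * Im z\<bar> \<le> cmod (of_int c * z + of_int d)"
      using abs_Im_le_cmod[of "of_int c * z + of_int d"] by simp
    hence "\<bar>of_int c\<bar> * Im z \<le> B" using le assms by (simp add: abs_mult)
    hence "\<bar>of_int c\<bar> \<le> B / Im z" using assms by (simp add: field_simps)
    hence c: "\<bar>c\<bar> \<le> C" unfolding C_def by linarith
    thus "c \<in> {-\<bar>C\<bar>..\<bar>C\<bar>}" by auto
    have "cmod (of_int d) \<le> cmod (of_int c * z + of_int d) + cmod (of_int c * z)"
      using norm_triangle_ineq4[of "of_int c * z + of_int d" "of_int c * z"] by simp
    also have "\<dots> \<le> B + of_int \<bar>C\<bar> * cmod z"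
    proof (intro add_mono le)
      have "cmod (of_int c * z) = of_int \<bar>c\<bar> * cmod z" by (simp add: norm_mult)
      also have "of_int \<bar>c\<bar> \<le> (of_int \<bar>C\<bar> :: real)" using c by linarith
      finally show "cmod (of_int c * z) \<le> of_int \<bar>C\<bar> * cmod z" by (simp add: mult_right_mono)
    qed
    finally have "\<bar>of_int d\<bar> \<le> B + of_int \<bar>C\<bar> * cmod z" by simp
    hence "\<bar>d\<bar> \<le> D" unfolding D_def by linarith
    thus "d \<in> {-D..D}" by auto
  qed
  thus ?thesis by (rule finite_subset) simp
qed

text \<open>An open neighbourhood of the Siegel set, so that the weight below is positive on a set of positive measure.\<close>

definition siegel_nbhd :: "complex set" where
  "siegel_nbhd = {z. \<bar>Re z\<bar> < 1 \<and> Im z > 1/6}"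

text \<open>With j = c z + d the height n Im z / |j|^2 of the image exceeds 1/6, which leaves
  finitely many bottom rows; for each of them a z + b is the image times j, hence bounded, which
  leaves finitely many top rows.\<close>

lemma finite_mats_into_siegel:
  assumes z: "Im z > 0" and n: "n > 0"
  shows "finite {A \<in> mats n. mob A z \<in> siegel_nbhd}"
proof -
  define P where "P = {(c::int, d::int). cmod (of_int c * z + of_int d) \<le> 6 * real n * Im z + 1}"
  define b where "b = (\<lambda>(c, d). (1 + real n * Im z / (cmod (of_int c * z + of_int d))\<^sup>2) * cmod (of_int c * z + of_int d))"
  have "finite (SIGMA cd : P. {(a'::int, b'::int). cmod (of_int a' * z + of_int b') \<le> b cd})"
    unfolding P_def by (intro finite_SigmaI finite_lattice_points z)
  hence "finite ((\<lambda>((c, d), (a, b)). (a, b, c, d)) ` (SIGMA cd : P. {(a'::int, b'::int). cmod (of_int a' * z + of_int b') \<le> b cd}))"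
    by (rule finite_imageI)
  moreover have "{A \<in> mats n. mob A z \<in> siegel_nbhd} \<subseteq>
     (\<lambda>((c, d), (a, b)). (a, b, c, d)) ` (SIGMA cd : P. {(a'::int, b'::int). cmod (of_int a' * z + of_int b') \<le> b cd})"
  proof
    fix A assume "A \<in> {A \<in> mats n. mob A z \<in> siegel_nbhd}"
    hence det: "mdet A = int n" and w: "mob A z \<in> siegel_nbhd" by (auto simp: mats_def)
    obtain a1 b1 c1 d1 where A: "A = (a1, b1, c1, d1)" by (cases A)
    define j where "j = of_int c1 * z + of_int d1"
    have j0: "j \<noteq> 0" using jac_nonzero[of A z] det n z by (simp add: A j_def)
    have Im: "Im (mob A z) = real n * Im z / (cmod j)\<^sup>2"
    proof -
      have "jac A z = j" by (simp add: A j_def)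
      thus ?thesis using Im_mob[of A z] det n z by simp
    qed
    have "1/6 < real n * Im z / (cmod j)\<^sup>2" using w Im by (simp add: siegel_nbhd_def)
    hence j1: "(cmod j)\<^sup>2 < 6 * real n * Im z" using j0 by (simp add: field_simps)
    have "cmod j \<le> (cmod j)\<^sup>2 + 1" using zero_le_power2[of "cmod j - 1/2"] by (simp add: power2_eq_square algebra_simps)
    hence "(c1, d1) \<in> P" using j1 by (simp add: P_def j_def)
    moreover have "cmod (of_int a1 * z + of_int b1) \<le> b (c1, d1)"
    proof -
      have "of_int a1 * z + of_int b1 = mob A z * j" using j0 by (simp add: A j_def)
      hence "cmod (of_int a1 * z + of_int b1) = cmod (mob A z) * cmod j" by (simp add: norm_mult)
      also have "cmod (mob A z) \<le> \<bar>Re (mob A z)\<bar> + \<bar>Im (mob A z)\<bar>" by (rule cmod_le)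
      also have "\<bar>Re (mob A z)\<bar> \<le> 1" using w by (simp add: siegel_nbhd_def)
      also have "\<bar>Im (mob A z)\<bar> = real n * Im z / (cmod j)\<^sup>2" using z by (simp add: Im)
      finally show ?thesis by (simp add: b_def j_def mult_right_mono)
    qed
    ultimately show "A \<in> (\<lambda>((c, d), (a, b)). (a, b, c, d)) ` (SIGMA cd : P. {(a'::int, b'::int). cmod (of_int a' * z + of_int b') \<le> b cd})"
      by (force simp: A)
  qed
  ultimately show ?thesis by (rule finite_subset[rotated])
qed

text \<open>Hermite normal forms: representatives for the left action of SL(2, Z) on
  \<open>mats n\<close>, indexed like the double sum in \<open>hecke_op\<close>.\<close>

definition hecke_reps :: "nat \<Rightarrow> imat set" where
  "hecke_reps n = (\<lambda>(d, b). (int (n div d), int b, 0, int d)) ` (SIGMA d : {d. d dvd n}. {..<d})"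

lemma inj_hecke_reps: "n > 0 \<Longrightarrow> inj_on (\<lambda>(d, b). (int (n div d), int b, 0 :: int, int d)) (SIGMA d : {d. d dvd n}. {..<d})"
  by (auto simp: inj_on_def)

lemma hecke_reps_altdef:
  assumes "n > 0"
  shows "hecke_reps n = {(m, b, c, d). c = 0 \<and> m * d = int n \<and> 0 < m \<and> 0 \<le> b \<and> b < d}"
proof safe
  fix m b c d :: int
  assume "(m, b, c, d) \<in> hecke_reps n"
  then obtain d' b' where *: "d' dvd n" "b' < d'" "m = int (n div d')" "b = int b'" "c = 0" "d = int d'"
    by (auto simp: hecke_reps_def)
  from *(1) obtain e where e: "n = d' * e" by auto
  show "c = 0" "m * d = int n" "0 < m" "0 \<le> b" "b < d" using * e assms by auto
next
  fix m b d :: int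
  assume *: "m * d = int n" "0 < m" "0 \<le> b" "b < d"
  hence "n = nat m * nat d" by (metis nat_int nat_mult_distrib less_imp_le)
  hence "(nat d) dvd n" "n div nat d = nat m" using * by auto
  thus "(m, b, 0, d) \<in> hecke_reps n" unfolding hecke_reps_def using *
    by (intro image_eqI[of _ _ "(nat d, nat b)"]) auto
qed

lemma finite_hecke_reps: "n > 0 \<Longrightarrow> finite (hecke_reps n)"
  unfolding hecke_reps_def by (intro finite_imageI finite_SigmaI) auto

lemma hecke_reps_subset: "n > 0 \<Longrightarrow> hecke_reps n \<subseteq> mats n"
  by (auto simp: hecke_reps_altdef mats_def)

lemma mmul_inj_left:
  assumes "mmul G A = mmul H A" "mdet A \<noteq> 0"
  shows "G = H"
proof -
  have "mmul (mmul G A) (madj A) = mmul (mmul H A) (madj A)" using assms by simp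
  hence "mmul G (mdet A, 0, 0, mdet A) = mmul H (mdet A, 0, 0, mdet A)" by (simp only: mmul_assoc mmul_madj)
  thus ?thesis using assms(2) by (cases G; cases H) simp
qed

lemma bij_betw_hecke_reps:
  assumes n: "n > 0"
  shows "bij_betw (\<lambda>(B, G). mmul G B) (hecke_reps n \<times> mats 1) (mats n)"
  unfolding bij_betw_def
proof
  show "inj_on (\<lambda>(B, G). mmul G B) (hecke_reps n \<times> mats 1)"
  proof (rule inj_onI, safe)
    fix m b c d p q r s m' b' c' d' p' q' r' s' :: int
    define B G B' G' where defs: "B = (m, b, c, d)" "G = (p, q, r, s)" "B' = (m', b', c', d')" "G' = (p', q', r', s')"
    assume *: "(m, b, c, d) \<in> hecke_reps n" "(p, q, r, s) \<in> mats 1"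
      "(m', b', c', d') \<in> hecke_reps n" "(p', q', r', s') \<in> mats 1"
      "mmul (p, q, r, s) (m, b, c, d) = mmul (p', q', r', s') (m', b', c', d')"
    have B: "c = 0" "m * d = int n" "0 < m" "0 \<le> b" "b < d" using *(1) by (auto simp: hecke_reps_altdef[OF n])
    have B': "c' = 0" "m' * d' = int n" "0 < m'" "0 \<le> b'" "b' < d'" using *(3) by (auto simp: hecke_reps_altdef[OF n])
    \<comment> \<open>D B = B' with both B and B' upper triangular forces D to be upper triangular.
      Its diagonal entries are positive with product 1, and its corner entry vanishes because b and
      b' both lie in [0, d).\<close>
    define D where "D = mmul (madj G') G"
    have DB: "mmul D B = B'"
    proof -
      have "mmul D B = mmul (madj G') (mmul G' B')" unfolding D_def mmul_assoc using *(5) by (simp only: defs)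
      also have "\<dots> = mmul (mdet G', 0, 0, mdet G') B'" by (simp only: mmul_assoc[symmetric] mmul_madj)
      also have "mdet G' = 1" using *(4) by (simp add: mats_def defs)
      finally show ?thesis by (simp only: mmul_one)
    qed
    have detD: "mdet D = 1" using *(2,4) unfolding D_def by (simp only: mdet_mmul mdet_madj defs mats_def mem_Collect_eq)
    obtain x y u v where D: "D = (x, y, u, v)" by (cases D)
    have e: "x * m = m'" "x * b + y * d = b'" "u * m = 0" "u * b + v * d = d'"
      using DB B(1) B'(1) by (auto simp: D defs)
    have u: "u = 0" using e(3) B(3) by simp
    hence xv: "x * v = 1" using detD by (simp add: D)
    have "x > 0" using e(1) B(3) B'(3) by (metis zero_less_mult_pos2)
    with xv have x: "x = 1" and v: "v = 1" by (auto simp: zmult_eq_1_iff)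
    have d: "d' = d" using e(4) u v by simp
    have "b + y * d = b'" using e(2) x by simp
    hence "y = 0" using B B' d by (smt (verit) mult_less_cancel_right2 mult_le_cancel_right1 mult_minus_left)
    hence "D = (1, 0, 0, 1)" using x u v D by simp
    hence BB: "B = B'" using DB by (simp only: mmul_one)
    have "mmul G B = mmul G' B" using *(5) BB by (simp only: defs)
    moreover have "mdet B \<noteq> 0" using B n by (simp add: defs)
    ultimately have "G = G'" by (rule mmul_inj_left)
    with BB show "m = m'" "b = b'" "c = c'" "d = d'" "p = p'" "q = q'" "r = r'" "s = s'" by (auto simp: defs)
  qed
next
  show "(\<lambda>(B, G). mmul G B) ` (hecke_reps n \<times> mats 1) = mats n"
  proof (intro equalityI subsetI)
    fix A assume "A \<in> (\<lambda>(B, G). mmul G B) ` (hecke_reps n \<times> mats 1)"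
    then obtain B G where "A = mmul G B" "B \<in> hecke_reps n" "G \<in> mats 1" by (auto split: prod.splits)
    thus "A \<in> mats n" using hecke_reps_subset[OF n] by (auto simp: mats_def mdet_mmul)
  next
    fix A :: imat assume "A \<in> mats n"
    then obtain a b c d where A: "A = (a, b, c, d)" "(a, b, c, d) \<in> mats n" by (cases A) auto
    from A(2) have det: "a * d - b * c = int n" by (simp add: mats_def)
    \<comment> \<open>The gcd of the first column becomes the upper left entry of the normal form. A
      Bezout matrix clears the column, \<open>b0\<close> is the upper right entry that it produces,
      and \<open>t\<close> is the quotient that reduces \<open>b0\<close> modulo the lower right
      entry \<open>d'\<close>.\<close>
    define m where "m = gcd a c"
    have "m \<noteq> 0" using det n by (auto simp: m_def)
    hence m: "m > 0" unfolding m_def by simp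
    obtain a1 c1 where ac: "a = a1 * m" "c = c1 * m" "coprime a1 c1"
      using gcd_coprime_exists[of a c] \<open>m \<noteq> 0\<close> unfolding m_def by blast
    obtain x y where xy: "x * a1 + y * c1 = 1"
      using ac(3) bezout_int[of a1 c1] by (auto simp: coprime_iff_gcd_eq_1)
    define d' where "d' = a1 * d - c1 * b"
    have md: "m * d' = int n" using det by (simp add: d'_def ac algebra_simps)
    have d': "d' > 0" using md m n by (metis of_nat_0_less_iff zero_less_mult_pos)
    define b0 where "b0 = x * b + y * d"
    define t where "t = b0 div d'"
    define b' where "b' = b0 mod d'"
    have b0: "b0 = b' + t * d'" by (simp add: b'_def t_def)
    have b': "0 \<le> b'" "b' < d'" using d' by (simp_all add: b'_def)
    have rep: "(m, b', 0, d') \<in> hecke_reps n" using md m b' by (simp add: hecke_reps_altdef[OF n])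
    define G where "G = (a1, a1 * t - y, c1, c1 * t + x)"
    have "mdet G = 1" using xy by (simp add: G_def algebra_simps)
    hence G: "G \<in> mats 1" by (simp add: mats_def)
    have "a1 * b' + (a1 * t - y) * d' = a1 * b0 - y * d'" by (simp add: b0 algebra_simps)
    also have "\<dots> = (x * a1 + y * c1) * b" by (simp add: b0_def d'_def algebra_simps)
    finally have 1: "a1 * b' + (a1 * t - y) * d' = b" by (simp add: xy)
    have "c1 * b' + (c1 * t + x) * d' = c1 * b0 + x * d'" by (simp add: b0 algebra_simps)
    also have "\<dots> = (x * a1 + y * c1) * d" by (simp add: b0_def d'_def algebra_simps)
    finally have 2: "c1 * b' + (c1 * t + x) * d' = d" by (simp add: xy)
    have "mmul G (m, b', 0, d') = (a, b, c, d)" using 1 2 by (simp add: G_def ac)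
    with rep G A show "A \<in> (\<lambda>(B, G). mmul G B) ` (hecke_reps n \<times> mats 1)"
      by (intro image_eqI[of _ _ "((m, b', 0, d'), G)"]) auto
  qed
qed

section \<open>A partition of unity for the modular group\<close>

definition siegel_mult :: "complex \<Rightarrow> nat" where
  "siegel_mult z = card {G \<in> mats 1. mob G z \<in> siegel_nbhd}"

text \<open>Integrating against this weight replaces integration over a fundamental domain of \<open>SL\<^sub>2(\<int>)\<close>.\<close>

definition siegel_weight :: "complex \<Rightarrow> real" where
  "siegel_weight z = (if z \<in> siegel_nbhd then 1 / real (siegel_mult z) else 0)"

lemma siegel_mult_invariant:
  assumes G: "G \<in> mats 1" and z: "Im z > 0"
  shows "siegel_mult (mob G z) = siegel_mult z"
  unfolding siegel_mult_def
proof (rule bij_betw_same_card)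
  have d: "mdet G = 1" using G by (simp add: mats_def)
  have inv: "mmul (mmul H G) (madj G) = H" "mmul (mmul H (madj G)) G = H" for H
    by (cases H; simp add: mmul_assoc mmul_madj d)+
  have m: "mob (mmul H G) z = mob H (mob G z)" if "H \<in> mats 1" for H
    using that d z by (intro mob_mmul) (auto simp: mats_def)
  show "bij_betw (\<lambda>H. mmul H G) {H \<in> mats 1. mob H (mob G z) \<in> siegel_nbhd} {H \<in> mats 1. mob H z \<in> siegel_nbhd}"
  proof (rule bij_betw_byWitness[where f' = "\<lambda>H. mmul H (madj G)"])
    show "(\<lambda>H. mmul H G) ` {H \<in> mats 1. mob H (mob G z) \<in> siegel_nbhd} \<subseteq> {H \<in> mats 1. mob H z \<in> siegel_nbhd}"
      using m d by (auto simp: mats_def mdet_mmul)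
    show "(\<lambda>H. mmul H (madj G)) ` {H \<in> mats 1. mob H z \<in> siegel_nbhd} \<subseteq> {H \<in> mats 1. mob H (mob G z) \<in> siegel_nbhd}"
    proof (rule image_subsetI)
      fix H assume "H \<in> {H \<in> mats 1. mob H z \<in> siegel_nbhd}"
      hence H: "mdet H = 1" "mob H z \<in> siegel_nbhd" by (auto simp: mats_def)
      have 1: "mmul H (madj G) \<in> mats 1" using H d by (simp add: mats_def mdet_mmul)
      moreover have "mob (mmul H (madj G)) (mob G z) \<in> siegel_nbhd"
        using m[OF 1] H(2) by (simp only: inv)
      ultimately show "mmul H (madj G) \<in> {H \<in> mats 1. mob H (mob G z) \<in> siegel_nbhd}" by simp
    qed
  qed (auto simp only: inv)
qed

lemma siegel_mult_pos:
  assumes "Im z > 0"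
  shows "siegel_mult z > 0"
proof -
  obtain a b c d :: int where "a * d - b * c = 1" "(of_int a * z + of_int b) / (of_int c * z + of_int d) \<in> siegel_set"
    using exists_siegel_representative[OF assms] by blast
  hence "(a, b, c, d) \<in> {G \<in> mats 1. mob G z \<in> siegel_nbhd}"
    by (auto simp: mats_def siegel_set_def siegel_nbhd_def)
  thus ?thesis unfolding siegel_mult_def
    using finite_mats_into_siegel[OF assms, of 1] by (auto simp: card_gt_0_iff)
qed

lemma siegel_weight_nonneg: "siegel_weight z \<ge> 0"
  by (simp add: siegel_weight_def)

lemma siegel_weight_partition:
  assumes "Im z > 0"
  shows "(\<Sum>G | G \<in> mats 1 \<and> mob G z \<in> siegel_nbhd. siegel_weight (mob G z)) = 1"
proof -
  have "(\<Sum>G | G \<in> mats 1 \<and> mob G z \<in> siegel_nbhd. siegel_weight (mob G z)) =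
    (\<Sum>G | G \<in> mats 1 \<and> mob G z \<in> siegel_nbhd. 1 / real (siegel_mult z))"
    by (intro sum.cong) (auto simp: siegel_weight_def siegel_mult_invariant[OF _ assms])
  also have "\<dots> = 1" using siegel_mult_pos[OF assms] by (simp add: siegel_mult_def)
  finally show ?thesis .
qed

text \<open>Every A is uniquely G B with B in \<open>hecke_reps n\<close>; g sees only B, and over
  all G the weights at the images of \<open>mob B z\<close> add up to 1. This is the unfolding of a
  sum over cosets.\<close>

lemma sum_siegel_weight_mats:
  fixes g :: "imat \<Rightarrow> complex"
  assumes z: "Im z > 0" and n: "n > 0"
    and g: "\<And>G B. G \<in> mats 1 \<Longrightarrow> B \<in> mats n \<Longrightarrow> g (mmul G B) = g B"
  shows "(\<Sum>A | A \<in> mats n \<and> mob A z \<in> siegel_nbhd. of_real (siegel_weight (mob A z)) * g A) = (\<Sum>B\<in>hecke_reps n. g B)"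
proof -
  let ?S = "SIGMA B : hecke_reps n. {G \<in> mats 1. mob G (mob B z) \<in> siegel_nbhd}"
  have m: "mob (mmul G B) z = mob G (mob B z)" if "B \<in> hecke_reps n" "G \<in> mats 1" for B G
    using that hecke_reps_subset[OF n] n z by (intro mob_mmul) (auto simp: mats_def)
  have im: "Im (mob B z) > 0" if "B \<in> hecke_reps n" for B
    using that hecke_reps_subset[OF n] n z by (intro Im_mob_pos) (auto simp: mats_def)
  have bij: "bij_betw (\<lambda>(B, G). mmul G B) ?S {A \<in> mats n. mob A z \<in> siegel_nbhd}"
    unfolding bij_betw_def
  proof
    show "inj_on (\<lambda>(B, G). mmul G B) ?S"
      using bij_betw_imp_inj_on[OF bij_betw_hecke_reps[OF n]] by (rule inj_on_subset) auto
    show "(\<lambda>(B, G). mmul G B) ` ?S = {A \<in> mats n. mob A z \<in> siegel_nbhd}"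
    proof (intro equalityI subsetI)
      fix A assume "A \<in> (\<lambda>(B, G). mmul G B) ` ?S"
      then obtain B G where BG: "A = mmul G B" "B \<in> hecke_reps n" "G \<in> mats 1" "mob G (mob B z) \<in> siegel_nbhd"
        by (auto split: prod.splits)
      show "A \<in> {A \<in> mats n. mob A z \<in> siegel_nbhd}"
        using BG m[OF BG(2,3)] hecke_reps_subset[OF n] by (auto simp: mats_def mdet_mmul)
    next
      fix A assume A: "A \<in> {A \<in> mats n. mob A z \<in> siegel_nbhd}"
      hence "A \<in> (\<lambda>(B, G). mmul G B) ` (hecke_reps n \<times> mats 1)"
        using bij_betw_imp_surj_on[OF bij_betw_hecke_reps[OF n]] by simp
      then obtain B G where BG: "A = mmul G B" "B \<in> hecke_reps n" "G \<in> mats 1"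
        by (auto split: prod.splits)
      with A m[OF BG(2,3)] show "A \<in> (\<lambda>(B, G). mmul G B) ` ?S"
        by (intro image_eqI[of _ _ "(B, G)"]) auto
    qed
  qed
  have "(\<Sum>A | A \<in> mats n \<and> mob A z \<in> siegel_nbhd. of_real (siegel_weight (mob A z)) * g A) =
    (\<Sum>(B, G)\<in>?S. of_real (siegel_weight (mob (mmul G B) z)) * g (mmul G B))"
    by (subst sum.reindex_bij_betw[OF bij, symmetric]) (auto intro!: sum.cong)
  also have "\<dots> = (\<Sum>(B, G)\<in>?S. of_real (siegel_weight (mob G (mob B z))) * g B)"
    using m g hecke_reps_subset[OF n] by (intro sum.cong) auto
  also have "\<dots> = (\<Sum>B\<in>hecke_reps n. \<Sum>G | G \<in> mats 1 \<and> mob G (mob B z) \<in> siegel_nbhd.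
      of_real (siegel_weight (mob G (mob B z))) * g B)"
    by (rule sum.Sigma[symmetric]) (use finite_hecke_reps[OF n] finite_mats_into_siegel im in auto)
  also have "\<dots> = (\<Sum>B\<in>hecke_reps n. g B)"
  proof (intro sum.cong refl)
    fix B assume "B \<in> hecke_reps n"
    from siegel_weight_partition[OF im[OF this]]
    show "(\<Sum>G | G \<in> mats 1 \<and> mob G (mob B z) \<in> siegel_nbhd. of_real (siegel_weight (mob G (mob B z))) * g B) = g B"
      by (simp add: sum_distrib_right[symmetric] of_real_sum[symmetric] del: of_real_sum)
  qed
  finally show ?thesis .
qed

lemma siegel_weight_le: "siegel_weight z \<le> indicator siegel_nbhd z"
proof (cases "z \<in> siegel_nbhd")
  case True
  hence "siegel_mult z \<ge> 1" using siegel_mult_pos[of z] by (simp add: siegel_nbhd_def Suc_le_eq)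
  with True show ?thesis by (simp add: siegel_weight_def)
qed (simp add: siegel_weight_def)

lemma open_siegel_nbhd: "open siegel_nbhd"
  unfolding siegel_nbhd_def by (intro open_Collect_conj open_Collect_less continuous_intros)

lemma continuous_on_mob_hyp_point:
  assumes "mdet A > 0"
  shows "continuous_on UNIV (\<lambda>p. mob A (hyp_point p))" "continuous_on UNIV (\<lambda>p. jac A (hyp_point p))"
proof -
  have "jac A (hyp_point p) \<noteq> 0" for p using jac_nonzero[of A "hyp_point p"] assms by simp
  then show "continuous_on UNIV (\<lambda>p. mob A (hyp_point p))"
    by (cases A) (auto intro!: continuous_intros continuous_on_hyp_point)
  show "continuous_on UNIV (\<lambda>p. jac A (hyp_point p))"
    by (cases A) (auto intro!: continuous_intros continuous_on_hyp_point)
qed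

lemma countable_mats: "countable (mats n)"
  by simp

lemma sigma_finite_mats: "sigma_finite_measure (count_space (mats n))"
  by (intro sigma_finite_measure_count_space_countable countable_mats)

text \<open>\<open>siegel_mult\<close> is an integral of indicators of open sets against counting
  measure on the countable set \<open>mats 1\<close>, so it depends measurably on the parameter
  p.\<close>

lemma siegel_weight_measurable [measurable]: "(\<lambda>p. siegel_weight (hyp_point p)) \<in> borel_measurable borel"
proof -
  interpret sigma_finite_measure "count_space (mats 1)" by (rule sigma_finite_mats)
  have [measurable]: "Measurable.pred borel (\<lambda>p. mob G (hyp_point p) \<in> siegel_nbhd)" if "G \<in> mats 1" for G
  proof -
    have "open ((\<lambda>p. mob G (hyp_point p)) -` siegel_nbhd)"
      using that by (intro open_vimage open_siegel_nbhd continuous_on_mob_hyp_point) (simp add: mats_def)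
    hence "(\<lambda>p. mob G (hyp_point p)) -` siegel_nbhd \<in> sets borel" by simp
    thus ?thesis by (simp add: pred_def vimage_def)
  qed
  have [measurable]: "Measurable.pred borel (\<lambda>p. hyp_point p \<in> siegel_nbhd)"
  proof -
    have "open (hyp_point -` siegel_nbhd)"
      by (intro open_vimage open_siegel_nbhd continuous_on_hyp_point)
    hence "hyp_point -` siegel_nbhd \<in> sets borel" by simp
    thus ?thesis by (simp add: pred_def vimage_def)
  qed
  have "(\<lambda>(G, p). indicator siegel_nbhd (mob G (hyp_point p)) :: real)
      \<in> borel_measurable (count_space (mats 1) \<Otimes>\<^sub>M borel)"
    by (rule measurable_pair_measure_countable1[OF countable_mats]) simp
  hence "(\<lambda>(p, G). indicator siegel_nbhd (mob G (hyp_point p)) :: real)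
      \<in> borel_measurable (borel \<Otimes>\<^sub>M count_space (mats 1))"
    by (subst measurable_pair_swap_iff) (simp add: case_prod_unfold)
  hence *: "(\<lambda>p. \<integral>G. indicator siegel_nbhd (mob G (hyp_point p)) \<partial>count_space (mats 1) :: real) \<in> borel_measurable borel"
    by (rule borel_measurable_lebesgue_integral)
  have "(\<integral>G. indicator siegel_nbhd (mob G (hyp_point p)) \<partial>count_space (mats 1)) = real (siegel_mult (hyp_point p))" for p
    using finite_mats_into_siegel[of "hyp_point p" 1]
    by (subst lebesgue_integral_count_space_finite_support) (auto simp: indicator_def siegel_mult_def)
  with * have [measurable]: "(\<lambda>p. real (siegel_mult (hyp_point p))) \<in> borel_measurable borel" by simp
  show ?thesis unfolding siegel_weight_def by measurable
qed

text \<open>The weight is at most 1 and lives on \<open>siegel_nbhd\<close>, which in the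
  coordinates (u, t) lies above t = ln (1/6) and has slices of length at most 2 exp (-t): a finite
  area.\<close>

lemma integrable_siegel_weight: "integrable lborel (\<lambda>p. siegel_weight (hyp_point p))"
proof (rule integrableI_bounded)
  let ?E = "{p::real\<times>real. \<bar>fst p\<bar> \<le> exp (- snd p) \<and> snd p \<ge> ln (1/6)}"
  show "(\<lambda>p. siegel_weight (hyp_point p)) \<in> borel_measurable lborel" by simp
  have m: "(\<lambda>p::real\<times>real. indicator ?E p :: ennreal) \<in> borel_measurable borel"
  proof (rule borel_measurable_indicator, rule borel_closed)
    show "closed ?E"
      by (intro closed_Collect_conj closed_Collect_le continuous_intros)
  qed
  have "(\<integral>\<^sup>+p. ennreal (norm (siegel_weight (hyp_point p))) \<partial>lborel) \<le>
    (\<integral>\<^sup>+p. indicator ?E p \<partial>lborel)"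
  proof (rule nn_integral_mono)
    fix p :: "real \<times> real"
    have "p \<in> ?E" if "hyp_point p \<in> siegel_nbhd"
    proof -
      have 1: "\<bar>exp (snd p) * fst p\<bar> < 1" "exp (snd p) > 1/6" using that by (auto simp: siegel_nbhd_def hyp_point_def)
      have "\<bar>fst p\<bar> \<le> exp (- snd p)" using 1(1) by (simp add: abs_mult exp_minus field_simps)
      moreover have "ln (1/6) \<le> snd p" using 1(2) ln_less_cancel_iff[of "1/6" "exp (snd p)"] by simp
      ultimately show ?thesis by simp
    qed
    thus "ennreal (norm (siegel_weight (hyp_point p))) \<le> indicator ?E p"
      using siegel_weight_le[of "hyp_point p"] siegel_weight_nonneg[of "hyp_point p"]
      by (auto simp: indicator_def siegel_weight_def)
  qed
  also have "\<dots> = (\<integral>\<^sup>+t. \<integral>\<^sup>+u. indicator ?E (u, t) \<partial>lborel \<partial>lborel)"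
    using lborel_pair.nn_integral_snd[of "indicator ?E"] m
    by (simp add: lborel_prod)
  also have "\<dots> = (\<integral>\<^sup>+t. ennreal (2 * exp (- t)) * indicator {ln (1/6)..} t \<partial>lborel)"
  proof (rule nn_integral_cong)
    fix t :: real
    have "(\<integral>\<^sup>+u. indicator ?E (u, t) \<partial>lborel) =
      (\<integral>\<^sup>+u. indicator {- exp (- t)..exp (- t)} u * indicator {ln (1/6)..} t \<partial>lborel)"
      by (intro nn_integral_cong) (auto simp: indicator_def)
    also have "\<dots> = ennreal (2 * exp (- t)) * indicator {ln (1/6)..} t"
      by (subst nn_integral_multc) simp_all
    finally show "(\<integral>\<^sup>+u. indicator ?E (u, t) \<partial>lborel) =
      ennreal (2 * exp (- t)) * indicator {ln (1/6)..} t" .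
  qed
  also have "\<dots> = ennreal (0 - (- 2 * exp (- ln (1/6))))"
  proof (rule nn_integral_FTC_atLeast[where F = "\<lambda>t. - 2 * exp (- t)"])
    show "((\<lambda>t::real. - 2 * exp (- t)) \<longlongrightarrow> 0) at_top" by real_asymp
  qed (auto intro!: derivative_eq_intros)
  also have "\<dots> < \<infinity>" by simp
  finally show "(\<integral>\<^sup>+p. ennreal (norm (siegel_weight (hyp_point p))) \<partial>lborel) < \<infinity>" .
qed

section \<open>Hecke eigenvalues are real\<close>

context cusp_expansion
begin

text \<open>The terms of \<open>\<langle>T\<^sub>n f, f\<rangle>\<close>, before the sum over cosets is unfolded to a sum over all matrices.\<close>

definition hecke_kernel :: "imat \<Rightarrow> complex \<Rightarrow> complex" where
  "hecke_kernel A z = cnj (f z) * (f (mob A z) / jac A z ^ k) * of_real (Im z) ^ k"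

lemma f_mob:
  assumes "G \<in> mats 1" "Im z > 0"
  shows "f (mob G z) = jac G z ^ k * f z"
proof (cases G)
  case (fields a b c d)
  then show ?thesis using transform[of a d b c z] assms by (simp add: mats_def)
qed

lemma hecke_kernel_left_invariant:
  assumes "G \<in> mats 1" "B \<in> mats n" "n > 0" "Im z > 0"
  shows "hecke_kernel (mmul G B) z = hecke_kernel B z"
proof -
  have d: "mdet G > 0" "mdet B > 0" using assms by (auto simp: mats_def)
  have pos: "Im (mob B z) > 0" by (rule Im_mob_pos[OF d(2) assms(4)])
  have "jac G (mob B z) \<noteq> 0" using d pos by (intro jac_nonzero) auto
  then show ?thesis unfolding hecke_kernel_def mob_mmul[OF d assms(4)] f_mob[OF assms(1) pos]
    by (simp add: power_mult_distrib)
qed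

text \<open>This symmetry is the self-adjointness of the Hecke operators.\<close>

lemma hecke_kernel_adj:
  assumes "A \<in> mats n" "n > 0" "Im z > 0"
  shows "hecke_kernel A (mob (madj A) z) = cnj (hecke_kernel (madj A) z)"
    and "mob A (mob (madj A) z) = z"
proof -
  define w J where "w = mob (madj A) z" and "J = jac (madj A) z"
  have d: "mdet A = int n" "mdet A > 0" "mdet (madj A) > 0" using assms by (auto simp: mats_def)
  have J0: "J \<noteq> 0" unfolding J_def using d(3) assms(3) by (intro jac_nonzero) auto
  have e: "mmul A (madj A) = (int n, 0, 0, int n)" by (simp add: mmul_madj d)
  show Aw: "mob A (mob (madj A) z) = z"
    using mob_mmul(1)[OF d(2,3) assms(3)] assms(2) by (simp add: e)
  have "jac A w * J = of_nat n"
    using mob_mmul(2)[OF d(2,3) assms(3)] by (simp add: e w_def J_def)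
  hence jA: "jac A w = of_nat n / J" using J0 by (simp add: field_simps)
  have "Im w = real n * Im z / (cmod J)\<^sup>2"
    using Im_mob[of "madj A" z] d assms(3) by (simp add: w_def J_def)
  hence "of_real (Im w) = of_nat n * of_real (Im z) / (J * cnj J)"
    by (simp add: complex_norm_square[symmetric])
  \<comment> \<open>The key identity: since j(A, w) j(A', z) = n for the adjugate A', one factor of
    Im w = n Im z / |j(A', z)|^2 cancels, and the automorphy factor at w turns into the conjugate of
    the one at z.\<close>
  hence r: "of_real (Im w) / jac A w = of_real (Im z) / cnj J"
    using J0 assms(2) by (simp add: jA field_simps)
  have "hecke_kernel A w = cnj (f w) * f z * (of_real (Im w) / jac A w) ^ k"
    unfolding hecke_kernel_def using Aw by (simp add: w_def power_divide)
  also have "\<dots> = cnj (f w) * f z * (of_real (Im z) / cnj J) ^ k" by (simp only: r)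
  also have "\<dots> = cnj (hecke_kernel (madj A) z)"
    by (simp add: hecke_kernel_def w_def[symmetric] J_def[symmetric] power_divide mult.commute)
  finally show "hecke_kernel A (mob (madj A) z) = cnj (hecke_kernel (madj A) z)" by (simp add: w_def)
qed

lemma sum_hecke_reps_kernel:
  assumes "n > 0" "k > 0" "hecke_op k n f z = ev * f z"
  shows "(\<Sum>B\<in>hecke_reps n. hecke_kernel B z) =
    ev / of_nat n ^ (k - 1) * of_real ((cmod (f z))\<^sup>2 * Im z ^ k)"
proof -
  let ?S = "SIGMA d : {d. d dvd n}. {..<d}"
  have fin: "finite {d. d dvd n}" using assms(1) by simp
  have "(\<Sum>B\<in>hecke_reps n. hecke_kernel B z) =
     (\<Sum>(d, b)\<in>?S. cnj (f z) * of_real (Im z) ^ k * (f ((of_nat (n div d) * z + of_nat b) / of_nat d) / of_nat d ^ k))"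
    unfolding hecke_reps_def by (subst sum.reindex[OF inj_hecke_reps[OF assms(1)]])
      (auto intro!: sum.cong simp: hecke_kernel_def)
  also have "\<dots> = cnj (f z) * of_real (Im z) ^ k *
     (\<Sum>d | d dvd n. \<Sum>b<d. f ((of_nat (n div d) * z + of_nat b) / of_nat d) / of_nat d ^ k)"
    by (subst sum.Sigma[symmetric]) (use fin in \<open>auto simp: sum_distrib_left\<close>)
  also have "(\<Sum>d | d dvd n. \<Sum>b<d. f ((of_nat (n div d) * z + of_nat b) / of_nat d) / of_nat d ^ k) =
     ev * f z / of_nat n ^ (k - 1)"
    using assms(1,3) by (simp add: hecke_op_def field_simps)
  also have "cnj (f z) * of_real (Im z) ^ k * (ev * f z / of_nat n ^ (k - 1)) =
     ev / of_nat n ^ (k - 1) * of_real ((cmod (f z))\<^sup>2 * Im z ^ k)"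
    unfolding of_real_mult complex_norm_square by simp
  finally show ?thesis .
qed

text \<open>Up to the factor n^h the modulus of the kernel is the product of the invariant norms |f|
  y^h at z and at \<open>mob A z\<close>.\<close>

lemma hecke_kernel_bounded:
  assumes k: "k = 2 * h" and n: "n > 0"
  obtains M where "\<And>A z. A \<in> mats n \<Longrightarrow> Im z > 0 \<Longrightarrow> cmod (hecke_kernel A z) \<le> M"
proof -
  obtain M where M: "\<And>z. Im z > 0 \<Longrightarrow> cmod (f z) * Im z ^ h \<le> M" using bounded_invariant_norm[OF k] by blast
  have M0: "M \<ge> 0" by (rule order.trans[OF _ M[of \<i>]]) (auto intro!: mult_nonneg_nonneg)
  show thesis
  proof (rule that[of "M * M"])
    fix A z assume A: "A \<in> mats n" and z: "Im z > 0"
    have d: "mdet A = int n" "mdet A > 0" using A n by (auto simp: mats_def)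
    have j: "cmod (jac A z) > 0" using jac_nonzero[of A z] d z by simp
    have Im: "Im (mob A z) = real n * Im z / (cmod (jac A z))\<^sup>2" using Im_mob[of A z] d z by simp
    have "cmod (hecke_kernel A z) = (cmod (f z) * Im z ^ h) * (cmod (f (mob A z)) * (Im z ^ h / cmod (jac A z) ^ k))"
      unfolding hecke_kernel_def using z by (simp add: norm_mult norm_divide norm_power k power_add mult_2)
    also have "\<dots> \<le> M * M"
    proof (intro mult_mono M z M0)
      have "Im z ^ h / cmod (jac A z) ^ k = (Im z / (cmod (jac A z))\<^sup>2) ^ h"
        by (simp add: k power_mult power_divide)
      also have "\<dots> \<le> (Im (mob A z)) ^ h"
        unfolding Im using j z n by (intro power_mono) (auto simp: field_simps)
      finally have "cmod (f (mob A z)) * (Im z ^ h / cmod (jac A z) ^ k) \<le> cmod (f (mob A z)) * Im (mob A z) ^ h"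
        by (intro mult_left_mono) auto
      also have "\<dots> \<le> M" using Im_mob_pos[OF d(2) z] by (rule M)
      finally show "cmod (f (mob A z)) * (Im z ^ h / cmod (jac A z) ^ k) \<le> M" .
    qed (use z in auto)
    finally show "cmod (hecke_kernel A z) \<le> M * M" .
  qed
qed

lemma continuous_f_comp:
  assumes "continuous_on S g" "\<And>x. x \<in> S \<Longrightarrow> Im (g x) > 0"
  shows "continuous_on S (\<lambda>x. f (g x))"
  by (rule continuous_on_compose2[OF holomorphic_on_imp_continuous_on[OF holo] assms(1)])
    (use assms(2) in \<open>auto simp: upper_half_plane_def\<close>)

lemma measurable_hecke_kernel:
  assumes "A \<in> mats n" "n > 0"
  shows "(\<lambda>p. hecke_kernel A (hyp_point p)) \<in> borel_measurable borel"
proof -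
  have d: "mdet A > 0" using assms by (auto simp: mats_def)
  have "jac A (hyp_point p) \<noteq> 0" for p using jac_nonzero[of A "hyp_point p"] d by simp
  thus ?thesis unfolding hecke_kernel_def
    by (intro borel_measurable_continuous_onI continuous_intros continuous_f_comp
        continuous_on_mob_hyp_point[OF d] continuous_on_hyp_point Im_mob_pos d) auto
qed

lemma obtain_area_preserving_lift:
  assumes "A \<in> mats n" "n > 0"
  obtains \<sigma> where "\<sigma> \<in> borel_measurable borel" "distr lborel borel \<sigma> = lborel"
    "\<And>p. hyp_point (\<sigma> p) = mob A (hyp_point p)"
proof (cases A)
  case (fields a b c d)
  hence "preserves_hyp_area (mob A)"
    using preserves_hyp_area_moebius[of a d b c] assms by (simp add: mats_def fun_eq_iff preserves_hyp_area_def)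
  thus ?thesis using that unfolding preserves_hyp_area_def by blast
qed

text \<open>The weight at the point itself stands for integration over a fundamental domain, the
  weight at its image is the partition of unity used for unfolding. With both present the expression
  is symmetric in the two points, which the adjugate exchanges.\<close>

definition petersson_term :: "(real \<times> real) \<Rightarrow> imat \<Rightarrow> complex" where
  "petersson_term p A = of_real (siegel_weight (hyp_point p)) *
     (of_real (siegel_weight (mob A (hyp_point p))) * hecke_kernel A (hyp_point p))"

lemma measurable_petersson_term:
  assumes A: "A \<in> mats n" and n: "n > 0"
  shows "(\<lambda>p. petersson_term p A) \<in> borel_measurable borel"
proof -
  obtain \<sigma> where s: "\<sigma> \<in> borel_measurable borel" "\<And>p. hyp_point (\<sigma> p) = mob A (hyp_point p)"
    using obtain_area_preserving_lift[OF A n] by blast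
  have [measurable]: "(\<lambda>p. siegel_weight (mob A (hyp_point p))) \<in> borel_measurable borel"
    using measurable_compose[OF s(1) siegel_weight_measurable] by (simp add: s(2))
  note [measurable] = measurable_hecke_kernel[OF A n]
  show ?thesis unfolding petersson_term_def by measurable
qed

text \<open>Area-preserving substitution of \<open>mob (madj A) z\<close> for z: the two weights
  trade places because A maps this point back to z, and the kernel becomes a conjugate.\<close>

lemma integral_petersson_term_adj:
  assumes A: "A \<in> mats n" and n: "n > 0"
  shows "(\<integral>p. petersson_term p A \<partial>lborel) = cnj (\<integral>p. petersson_term p (madj A) \<partial>lborel)"
proof -
  have A': "madj A \<in> mats n" using A by (simp add: mats_def)
  obtain \<sigma> where s: "\<sigma> \<in> borel_measurable borel" "distr lborel borel \<sigma> = lborel"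
      "\<And>p. hyp_point (\<sigma> p) = mob (madj A) (hyp_point p)"
    using obtain_area_preserving_lift[OF A' n] by blast
  have "(\<integral>p. petersson_term p A \<partial>lborel) = (\<integral>p. petersson_term p A \<partial>(distr lborel borel \<sigma>))"
    by (simp only: s(2))
  also have "\<dots> = (\<integral>p. petersson_term (\<sigma> p) A \<partial>lborel)"
    using s(1) measurable_petersson_term[OF A n] by (intro integral_distr) auto
  also have "\<dots> = (\<integral>p. cnj (petersson_term p (madj A)) \<partial>lborel)"
    by (simp add: petersson_term_def s(3) hecke_kernel_adj[OF A n] mult_ac)
  finally show ?thesis by simp
qed

text \<open>Let I be the integral of all Petersson terms. Summing over A first gives I = R ev /
  n^(k-1) with R the squared Petersson norm of f, up to normalisation; integrating over the points
  first and permuting \<open>mats n\<close> by the adjugate gives I = cnj I.\<close>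

lemma hecke_eigenvalue_real:
  assumes n: "n > 0" and k: "k = 2 * h" "h > 0" and z0: "Im z0 > 0" "f z0 \<noteq> 0"
    and ev: "\<And>z. Im z > 0 \<Longrightarrow> hecke_op k n f z = ev * f z"
  shows "ev \<in> \<real>"
proof -
  interpret C: sigma_finite_measure "count_space (mats n)" by (rule sigma_finite_mats)
  interpret P: pair_sigma_finite "lborel :: (real \<times> real) measure" "count_space (mats n)" ..
  obtain M where M: "\<And>A z. A \<in> mats n \<Longrightarrow> Im z > 0 \<Longrightarrow> cmod (hecke_kernel A z) \<le> M"
    using hecke_kernel_bounded[OF k(1) n] by blast
  define W where "W = (\<lambda>p. siegel_weight (hyp_point p))"
  define g where "g = (\<lambda>p. (cmod (f (hyp_point p)))\<^sup>2 * Im (hyp_point p) ^ k)"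
  have fin: "finite {A \<in> mats n. petersson_term p A \<noteq> 0}" for p
    by (rule finite_subset[OF _ finite_mats_into_siegel[of "hyp_point p" n]])
      (use n in \<open>auto simp: petersson_term_def siegel_weight_def split: if_splits\<close>)
  have fin': "finite {A \<in> mats n. mob A (hyp_point p) \<in> siegel_nbhd}" for p
    using finite_mats_into_siegel[of "hyp_point p" n] n by simp
  have unfold: "(\<integral>A. petersson_term p A \<partial>count_space (mats n)) = of_real (W p * g p) * (ev / of_nat n ^ (k - 1))" for p
  proof -
    have "(\<integral>A. petersson_term p A \<partial>count_space (mats n)) = (\<Sum>A | A \<in> mats n \<and> petersson_term p A \<noteq> 0. petersson_term p A)"
      by (rule lebesgue_integral_count_space_finite_support) (rule fin)
    also have "\<dots> = (\<Sum>A | A \<in> mats n \<and> mob A (hyp_point p) \<in> siegel_nbhd. petersson_term p A)"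
      by (rule sum.mono_neutral_left) (use fin' in \<open>auto simp: petersson_term_def siegel_weight_def split: if_splits\<close>)
    also have "\<dots> = of_real (W p) * (\<Sum>B\<in>hecke_reps n. hecke_kernel B (hyp_point p))"
      unfolding petersson_term_def sum_distrib_left[symmetric] W_def
      by (subst sum_siegel_weight_mats) (use n hecke_kernel_left_invariant in auto)
    also have "\<dots> = of_real (W p * g p) * (ev / of_nat n ^ (k - 1))"
      by (subst sum_hecke_reps_kernel[OF n _ ev]) (use k in \<open>auto simp: g_def\<close>)
    finally show ?thesis .
  qed
  \<comment> \<open>Domination for Fubini: the kernel is bounded by M, and unfolding the constant
    function 1 shows that the weights add up to the number of representatives.\<close>
  have normbd: "(\<integral>A. norm (petersson_term p A) \<partial>count_space (mats n)) \<le> W p * (M * real (card (hecke_reps n)))" for p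
  proof -
    have "(\<integral>A. norm (petersson_term p A) \<partial>count_space (mats n)) =
       (\<Sum>A | A \<in> mats n \<and> norm (petersson_term p A) \<noteq> 0. norm (petersson_term p A))"
      by (rule lebesgue_integral_count_space_finite_support) (use fin in simp)
    also have "\<dots> = (\<Sum>A | A \<in> mats n \<and> mob A (hyp_point p) \<in> siegel_nbhd. norm (petersson_term p A))"
      by (rule sum.mono_neutral_left) (use fin' in \<open>auto simp: petersson_term_def siegel_weight_def split: if_splits\<close>)
    also have "\<dots> \<le> (\<Sum>A | A \<in> mats n \<and> mob A (hyp_point p) \<in> siegel_nbhd. W p * (siegel_weight (mob A (hyp_point p)) * M))"
      by (intro sum_mono) (auto simp: petersson_term_def norm_mult W_def siegel_weight_nonneg intro!: mult_left_mono M)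
    also have "\<dots> = W p * M * (\<Sum>A | A \<in> mats n \<and> mob A (hyp_point p) \<in> siegel_nbhd. siegel_weight (mob A (hyp_point p)))"
      by (simp add: sum_distrib_left mult_ac)
    also have "(\<Sum>A | A \<in> mats n \<and> mob A (hyp_point p) \<in> siegel_nbhd. siegel_weight (mob A (hyp_point p))) = real (card (hecke_reps n))"
    proof -
      have "complex_of_real (\<Sum>A | A \<in> mats n \<and> mob A (hyp_point p) \<in> siegel_nbhd. siegel_weight (mob A (hyp_point p))) =
         of_real (real (card (hecke_reps n)))"
        using sum_siegel_weight_mats[of "hyp_point p" n "\<lambda>_. 1"] n by simp
      thus ?thesis by (simp only: of_real_eq_iff)
    qed
    finally show ?thesis by (simp add: mult.assoc)
  qed
  have gm: "g \<in> borel_measurable borel" unfolding g_def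
    by (intro borel_measurable_continuous_onI continuous_intros continuous_f_comp continuous_on_hyp_point) auto
  have Wm [measurable]: "W \<in> borel_measurable borel" by (simp add: W_def)
  have Wi: "integrable lborel W" using integrable_siegel_weight by (simp add: W_def)
  have "(\<lambda>(A, p). petersson_term p A) \<in> borel_measurable (count_space (mats n) \<Otimes>\<^sub>M lborel)"
    by (rule measurable_pair_measure_countable1[OF countable_mats]) (simp add: measurable_petersson_term[OF _ n])
  hence meas: "(\<lambda>(p, A). petersson_term p A) \<in> borel_measurable (lborel \<Otimes>\<^sub>M count_space (mats n))"
    by (subst measurable_pair_swap_iff) (simp add: case_prod_unfold)
  have int: "integrable (lborel \<Otimes>\<^sub>M count_space (mats n)) (\<lambda>(p, A). petersson_term p A)"
  proof (rule P.Fubini_integrable[OF meas])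
    show "integrable lborel (\<lambda>p. \<integral>A. norm (case (p, A) of (p, A) \<Rightarrow> petersson_term p A) \<partial>count_space (mats n))"
    proof (rule Bochner_Integration.integrable_bound)
      show "integrable lborel (\<lambda>p. W p * (M * real (card (hecke_reps n))))" using Wi by simp
      have "(\<lambda>(p, A). norm (petersson_term p A)) \<in> borel_measurable (lborel \<Otimes>\<^sub>M count_space (mats n))"
        using measurable_compose[OF meas borel_measurable_norm] by (simp add: case_prod_unfold)
      from C.borel_measurable_lebesgue_integral[OF this]
      show "(\<lambda>p. \<integral>A. norm (case (p, A) of (p, A) \<Rightarrow> petersson_term p A) \<partial>count_space (mats n)) \<in> borel_measurable lborel"
        by simp
      show "AE p in lborel. norm (\<integral>A. norm (case (p, A) of (p, A) \<Rightarrow> petersson_term p A) \<partial>count_space (mats n))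
          \<le> norm (W p * (M * real (card (hecke_reps n))))"
        using normbd by (intro AE_I2) (auto intro!: order.trans[OF _ abs_ge_self])
    qed
    show "AE p in lborel. integrable (count_space (mats n)) (\<lambda>A. case (p, A) of (p, A) \<Rightarrow> petersson_term p A)"
    proof (intro AE_I2 integrableI_bounded)
      fix p
      have "(\<integral>\<^sup>+A. ennreal (norm (petersson_term p A)) \<partial>count_space (mats n)) =
        (\<Sum>A | A \<in> mats n \<and> 0 < ennreal (norm (petersson_term p A)). ennreal (norm (petersson_term p A)))"
        using fin[of p] by (intro nn_integral_count_space) (simp add: ennreal_less_zero_iff)
      also have "\<dots> < \<infinity>" by (simp add: ennreal_less_top less_top[symmetric])
      finally show "(\<integral>\<^sup>+A. ennreal (norm (case (p, A) of (p, A) \<Rightarrow> petersson_term p A)) \<partial>count_space (mats n)) < \<infinity>"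
        by simp
    qed simp
  qed
  define I where "I = (\<integral>p. (\<integral>A. petersson_term p A \<partial>count_space (mats n)) \<partial>lborel)"
  have I2: "I = (\<integral>A. (\<integral>p. petersson_term p A \<partial>lborel) \<partial>count_space (mats n))"
    unfolding I_def by (rule P.Fubini_integral[symmetric]) (rule int)
  also have "\<dots> = (\<integral>A. cnj (\<integral>p. petersson_term p (madj A) \<partial>lborel) \<partial>count_space (mats n))"
    by (intro Bochner_Integration.integral_cong) (use integral_petersson_term_adj n in auto)
  also have "\<dots> = cnj (\<integral>A. (\<integral>p. petersson_term p (madj A) \<partial>lborel) \<partial>count_space (mats n))"
    by simp
  also have "(\<integral>A. (\<integral>p. petersson_term p (madj A) \<partial>lborel) \<partial>count_space (mats n)) = I"
    unfolding I2
  proof (rule integral_bij_count_space)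
    show "bij_betw madj (mats n) (mats n)"
      by (rule bij_betw_byWitness[where f' = madj]) (auto simp del: madj.simps simp: mats_def)
  qed
  finally have real: "cnj I = I" by simp
  define R where "R = (\<integral>p. W p * g p \<partial>lborel)"
  obtain M' where M': "\<And>z. Im z > 0 \<Longrightarrow> cmod (f z) * Im z ^ h \<le> M'" using bounded_invariant_norm[OF k(1)] by blast
  have g_alt: "g p = (cmod (f (hyp_point p)) * Im (hyp_point p) ^ h)\<^sup>2" for p
    by (simp add: g_def k(1) power_mult_distrib power_mult[symmetric] mult.commute)
  have gle: "g p \<le> M'\<^sup>2" for p
    unfolding g_alt by (intro power_mono M') (auto intro!: mult_nonneg_nonneg simp: less_imp_le)
  have gnn: "g p \<ge> 0" for p by (simp add: g_alt)
  have Wg: "integrable lborel (\<lambda>p. W p * g p)"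
  proof (rule Bochner_Integration.integrable_bound)
    show "integrable lborel (\<lambda>p. W p * M'\<^sup>2)" using Wi by simp
    show "(\<lambda>p. W p * g p) \<in> borel_measurable lborel" using gm by simp
    show "AE p in lborel. norm (W p * g p) \<le> norm (W p * M'\<^sup>2)"
      using gle gnn by (intro AE_I2) (auto simp: abs_mult intro!: mult_left_mono)
  qed
  have "I = of_real R * (ev / of_nat n ^ (k - 1))"
    unfolding I_def unfold R_def by (simp del: of_real_mult add: integral_complex_of_real)
  \<comment> \<open>The weight is positive on the open set \<open>siegel_nbhd\<close>, and a point
    where f does not vanish can be moved there by the modular group, so W g is positive on a
    nonempty open set.\<close>
  have R0: "R \<noteq> 0"
  proof
    assume "R = 0"
    hence ae: "AE p in lborel. W p * g p = 0"
      using integral_nonneg_eq_0_iff_AE[OF Wg] gnn siegel_weight_nonneg by (simp add: R_def W_def)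
    define U where "U = {p. hyp_point p \<in> siegel_nbhd \<and> f (hyp_point p) \<noteq> 0}"
    have "open U"
    proof -
      have "open (hyp_point -` siegel_nbhd)" by (intro open_vimage open_siegel_nbhd continuous_on_hyp_point)
      moreover have "open ((\<lambda>p. f (hyp_point p)) -` (- {0}))"
        by (intro open_vimage continuous_f_comp continuous_on_hyp_point) auto
      ultimately have "open (hyp_point -` siegel_nbhd \<inter> (\<lambda>p. f (hyp_point p)) -` (- {0}))" by (rule open_Int)
      thus ?thesis by (simp add: U_def vimage_def Int_def)
    qed
    moreover have "U \<noteq> {}"
    proof -
      obtain a b c d :: int where G: "a * d - b * c = 1" "(of_int a * z0 + of_int b) / (of_int c * z0 + of_int d) \<in> siegel_set"
        using exists_siegel_representative[OF z0(1)] by blast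
      define z1 where "z1 = mob (a, b, c, d) z0"
      have Gm: "(a, b, c, d) \<in> mats 1" using G(1) by (simp add: mats_def)
      have "f z1 = jac (a, b, c, d) z0 ^ k * f z0" unfolding z1_def by (rule f_mob[OF Gm z0(1)])
      moreover have "jac (a, b, c, d) z0 \<noteq> 0" using G(1) z0(1) by (intro jac_nonzero) auto
      ultimately have "f z1 \<noteq> 0" using z0(2) by simp
      moreover have z1: "z1 \<in> siegel_nbhd" using G(2) by (simp add: z1_def siegel_set_def siegel_nbhd_def)
      moreover obtain p where "hyp_point p = z1" using hyp_point_surj[of z1] z1 by (auto simp: siegel_nbhd_def)
      ultimately have "p \<in> U" by (simp add: U_def)
      thus ?thesis by blast
    qed
    ultimately have "\<not> negligible U" by (rule open_not_negligible)
    moreover have "negligible U"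
    proof -
      have "W p * g p \<noteq> 0" if "p \<in> U" for p
        using that siegel_mult_pos[of "hyp_point p"] less_imp_neq[OF Im_hyp_point_pos[of p]] by (simp add: U_def W_def g_def siegel_weight_def)
      hence "AE p in lborel. p \<notin> U" using ae by (auto elim!: eventually_mono)
      hence "U \<in> null_sets lborel" using \<open>open U\<close> by (simp add: AE_iff_null_sets)
      hence "U \<in> null_sets lebesgue" by (rule null_sets_completionI)
      thus ?thesis by (simp add: negligible_iff_null_sets)
    qed
    ultimately show False by contradiction
  qed
  have "cnj ev = ev"
    using real R0 n unfolding \<open>I = of_real R * (ev / of_nat n ^ (k - 1))\<close> by simp
  thus ?thesis by (simp add: Reals_cnj_iff)
qed

end

section \<open>The Gamma integral in logarithmic coordinates\<close>

lemma integrable_exp_neg_abs: "integrable lborel (\<lambda>t::real. exp (- \<bar>t\<bar>))"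
proof -
  let ?h = "\<lambda>t::real. indicator {0..} t * exp (- t) :: real"
  have h: "integrable lborel ?h"
  proof (rule integrableI_bounded)
    have "(\<integral>\<^sup>+t. ennreal (norm (?h t)) \<partial>lborel) = (\<integral>\<^sup>+t. ennreal (exp (- t)) * indicator {0..} t \<partial>lborel)"
      by (intro nn_integral_cong) (auto simp: indicator_def)
    also have "\<dots> = ennreal (0 - (- exp (- 0)))"
    proof (rule nn_integral_FTC_atLeast[where F = "\<lambda>t. - exp (- t)"])
      show "((\<lambda>t::real. - exp (- t)) \<longlongrightarrow> 0) at_top" by real_asymp
    qed (auto intro!: derivative_eq_intros)
    finally show "(\<integral>\<^sup>+t. ennreal (norm (?h t)) \<partial>lborel) < \<infinity>" by simp
  qed simp
  have "integrable lborel (\<lambda>t. ?h (0 + (-1) * t))" by (rule lborel_integrable_real_affine[OF h]) simp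
  with h have "integrable lborel (\<lambda>t. ?h t + ?h (0 + (-1) * t))" by (rule Bochner_Integration.integrable_add)
  thus ?thesis
    by (rule Bochner_Integration.integrable_bound) (auto simp: indicator_def)
qed

lemma integrable_lborel_exp_bound:
  fixes g :: "real \<Rightarrow> 'a :: {banach, second_countable_topology}"
  assumes "g \<in> borel_measurable borel" "\<And>t. norm (g t) \<le> C * exp (- \<bar>t\<bar>)"
  shows "integrable lborel g"
proof (rule Bochner_Integration.integrable_bound)
  show "integrable lborel (\<lambda>t. C * exp (- \<bar>t\<bar>))" using integrable_exp_neg_abs by simp
  show "AE t in lborel. norm (g t) \<le> norm (C * exp (- \<bar>t\<bar>))"
    using assms(2) by (intro AE_I2) (auto intro: order.trans[OF _ abs_ge_self])
qed (use assms(1) in simp)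

lemma exp_mult_le_exp_exp:
  fixes t :: real
  shows "exp (real n * t) * exp (- exp t) \<le> fact n"
proof -
  have "exp (real n * t) = exp t ^ n" by (simp add: exp_of_nat_mult)
  also have "\<dots> \<le> fact n * exp (exp t)" by (rule power_le_fact_exp) simp
  finally show ?thesis by (simp add: exp_minus field_simps)
qed

text \<open>For t < 0 the condition Re s >= 1 makes the integrand at most exp t; for t >= 0 the
  double exponential beats exp ((Re s + 1) t). Both tails decay like exp (-|t|).\<close>

lemma integrable_Gamma_exp:
  fixes s :: complex
  assumes "Re s \<ge> 1"
  shows "integrable lborel (\<lambda>t. exp (s * of_real t) * of_real (exp (- exp t)))"
proof -
  define n where "n = nat \<lceil>Re s\<rceil> + 1"
  have n: "real n \<ge> Re s + 1" unfolding n_def by linarith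
  show ?thesis
  proof (rule integrable_lborel_exp_bound[where C = "fact n + 1"])
    show "(\<lambda>t. exp (s * of_real t) * of_real (exp (- exp t))) \<in> borel_measurable borel"
      by (intro borel_measurable_continuous_onI continuous_intros)
    fix t :: real
    have nm: "norm (exp (s * of_real t) * of_real (exp (- exp t))) = exp (Re s * t) * exp (- exp t)"
      by (simp add: norm_mult)
    show "norm (exp (s * of_real t) * of_real (exp (- exp t))) \<le> (fact n + 1) * exp (- \<bar>t\<bar>)"
    proof (cases "t \<ge> 0")
      case True
      have "(Re s + 1) * t \<le> real n * t" using n True by (intro mult_right_mono) auto
      hence "exp (Re s * t) \<le> exp (real n * t) * exp (- t)" by (simp add: exp_add[symmetric] algebra_simps)
      hence "exp (Re s * t) * exp (- exp t) \<le> (exp (real n * t) * exp (- exp t)) * exp (- t)" by simp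
      also have "\<dots> \<le> fact n * exp (- t)" using exp_mult_le_exp_exp[of n t] by (intro mult_right_mono) auto
      also have "\<dots> \<le> (fact n + 1) * exp (- t)" by simp
      finally show ?thesis using nm True by simp
    next
      case False
      have "Re s * t \<le> 1 * t" using assms False by (intro mult_right_mono_neg) auto
      hence "exp (Re s * t) * exp (- exp t) \<le> exp t * 1" by (intro mult_mono) auto
      also have "\<dots> \<le> (fact n + 1) * exp t" by simp
      finally show ?thesis using nm False by simp
    qed
  qed
qed

text \<open>Euler's integral under the substitution y = exp t.\<close>

lemma integral_Gamma_exp:
  fixes s :: complex
  assumes "Re s \<ge> 1"
  shows "(\<integral>t. exp (s * of_real t) * of_real (exp (- exp t)) \<partial>lborel) = Gamma s"
proof -
  define F where "F = (\<lambda>y::real. of_real y powr (s - 1) / of_real (exp y) :: complex)"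
  have e0: "einterval 0 \<infinity> = {0<..}" by (auto simp: einterval_def)
  have abs: "F absolutely_integrable_on {0<..}"
    unfolding F_def using assms by (intro absolutely_integrable_Gamma_integral') auto
  have meas: "set_borel_measurable borel {0<..} F"
  proof -
    have "continuous_on {0<..} F" unfolding F_def
      by (intro continuous_intros) (auto simp: complex_nonpos_Reals_iff)
    thus ?thesis unfolding set_borel_measurable_def
      by (intro borel_measurable_continuous_on_indicator) auto
  qed
  have set_int: "set_integrable lborel {0<..} F"
    using abs meas unfolding set_integrable_def set_borel_measurable_def
    by (subst (asm) integrable_completion) auto
  have FE: "exp x *\<^sub>R F (exp x) = exp (s * of_real x) * of_real (exp (- exp x))" for x
  proof -
    have "of_real (exp x) powr (s - 1) = exp ((s - 1) * of_real x)"
      using Ln_of_real[of "exp x"] by (simp add: powr_def exp_of_real[symmetric] del: of_real_exp)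
    hence "exp x *\<^sub>R F (exp x) = exp (of_real x) * exp ((s - 1) * of_real x) * of_real (exp (- exp x))"
      by (simp add: F_def scaleR_conv_of_real exp_minus field_simps flip: exp_of_real)
    also have "exp (of_real x) * exp ((s - 1) * of_real x) = exp (s * of_real x)"
      by (simp add: exp_add[symmetric] algebra_simps)
    finally show ?thesis .
  qed
  have "(LBINT y=0..\<infinity>. F y) = (LBINT t=-\<infinity>..\<infinity>. exp t *\<^sub>R F (exp t))"
  proof (rule interval_integral_substitution_integrable[where g = exp and g' = exp])
    show "isCont F (exp x)" for x :: real
      unfolding F_def by (intro continuous_intros) (auto simp: complex_nonpos_Reals_iff)
    show "((ereal \<circ> exp \<circ> real_of_ereal) \<longlongrightarrow> 0) (at_right (-\<infinity>))"
      unfolding ereal_tendsto_simps1 zero_ereal_def ereal_tendsto_simps2 by (rule exp_at_bot)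
    show "((ereal \<circ> exp \<circ> real_of_ereal) \<longlongrightarrow> \<infinity>) (at_left \<infinity>)"
      unfolding ereal_tendsto_simps1 ereal_tendsto_simps2 by (rule exp_at_top)
    show "set_integrable lborel (einterval (-\<infinity>) \<infinity>) (\<lambda>t. exp t *\<^sub>R F (exp t))"
      unfolding FE using integrable_Gamma_exp[OF assms] by (simp add: set_integrable_def einterval_def)
    show "set_integrable lborel (einterval 0 \<infinity>) F" unfolding e0 by (rule set_int)
  qed (auto intro!: derivative_eq_intros)
  also have "(LBINT y=0..\<infinity>. F y) = (LINT y:{0<..}|lborel. F y)"
    by (simp add: interval_lebesgue_integral_def e0)
  also have "\<dots> = integral {0<..} F" by (rule set_borel_integral_eq_integral(2)[OF set_int])
  also have "\<dots> = Gamma s" using Gamma_integral_complex'[of s] assms by (simp add: F_def integral_unique)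
  finally show ?thesis
    by (simp add: FE interval_lebesgue_integral_def einterval_def set_lebesgue_integral_def)
qed

lemma integral_exp_scaled:
  fixes s :: complex
  assumes "Re s \<ge> 1" "c > 0"
  shows "(\<integral>t. exp (s * of_real t) * of_real (exp (- (c * exp t))) \<partial>lborel) = Gamma s * of_real c powr (- s)"
    and "integrable lborel (\<lambda>t. exp (s * of_real t) * of_real (exp (- (c * exp t))))"
proof -
  let ?F = "\<lambda>t. exp (s * of_real t) * complex_of_real (exp (- exp t))"
  have e: "exp (s * of_real t) * of_real (exp (- (c * exp t))) = of_real c powr (- s) * ?F (ln c + 1 * t)" for t
    using assms by (simp add: powr_def exp_add distrib_left Ln_of_real) (simp add: exp_minus exp_add field_simps)
  have i: "integrable lborel (\<lambda>t. ?F (ln c + 1 * t))"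
    by (rule lborel_integrable_real_affine[OF integrable_Gamma_exp[OF assms(1)]]) simp
  show "integrable lborel (\<lambda>t. exp (s * of_real t) * of_real (exp (- (c * exp t))))"
    unfolding e using i by (rule integrable_mult_right)
  have "Gamma s = (\<integral>t. ?F (ln c + 1 * t) \<partial>lborel)"
    using lborel_integral_real_affine[of 1 ?F "ln c"] integral_Gamma_exp[OF assms(1)] by simp
  thus "(\<integral>t. exp (s * of_real t) * of_real (exp (- (c * exp t))) \<partial>lborel) = Gamma s * of_real c powr (- s)"
    unfolding e by simp
qed

section \<open>The completed L-function\<close>

context cusp_expansion
begin

definition f_axis :: "real \<Rightarrow> complex" where "f_axis t = f (\<i> * of_real (exp t))"

lemma continuous_f_axis: "continuous_on S f_axis"
  unfolding f_axis_def by (intro continuous_f_comp continuous_intros) auto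

lemma f_axis_minus: "f_axis (- t) = (\<i> * of_real (exp t)) ^ k * f_axis t"
proof -
  have "- 1 / (\<i> * of_real (exp t)) = \<i> * of_real (exp (- t))"
    by (simp add: exp_minus field_simps flip: exp_of_real)
  with invert[of "\<i> * of_real (exp t)"] show ?thesis by (simp add: f_axis_def)
qed

lemma norm_f_axis_minus: "norm (f_axis (- t)) = exp (real k * t) * norm (f_axis t)"
  by (simp add: f_axis_minus norm_mult norm_power exp_of_nat_mult)

text \<open>To the right this is the decay at the cusp. To the left, inversion costs a factor exp (k
  |t|), which is why the exponent N + k is established on the right half.\<close>

lemma f_axis_decay:
  obtains C where "C \<ge> 0" "\<And>t. norm (f_axis t) \<le> C * exp (- (real N * \<bar>t\<bar>))"
proof -
  obtain C where C: "C \<ge> 0" "\<And>z. Im z \<ge> 1 \<Longrightarrow> cmod (f z) \<le> C * exp (- (2 * pi * Im z))"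
    using decay[of 1] by auto
  define C' where "C' = C * fact (N + k)"
  have *: "norm (f_axis t) \<le> C' * exp (- (real (N + k) * t))" if t: "t \<ge> 0" for t
  proof -
    have "norm (f_axis t) \<le> C * exp (- (2 * pi * exp t))"
      unfolding f_axis_def using C(2)[of "\<i> * of_real (exp t)"] t by simp
    also have "exp (- (2 * pi * exp t)) \<le> exp (- exp t)"
      using pi_gt3 by simp
    also have "exp (- exp t) \<le> fact (N + k) * exp (- (real (N + k) * t))"
    proof -
      have "exp (- exp t) = (exp (real (N + k) * t) * exp (- exp t)) * exp (- (real (N + k) * t))"
        by (simp add: exp_minus)
      also have "\<dots> \<le> fact (N + k) * exp (- (real (N + k) * t))"
        by (intro mult_right_mono exp_mult_le_exp_exp) simp
      finally show ?thesis .
    qed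
    finally show ?thesis using C(1) by (simp add: C'_def mult_left_mono mult.assoc)
  qed
  show thesis
  proof (rule that[of C'])
    show "C' \<ge> 0" using C by (simp add: C'_def)
    fix t
    show "norm (f_axis t) \<le> C' * exp (- (real N * \<bar>t\<bar>))"
    proof (cases "t \<ge> 0")
      case True
      have "exp (- (real (N + k) * t)) \<le> exp (- (real N * t))" using True by (simp add: algebra_simps)
      with *[OF True] \<open>C' \<ge> 0\<close> True show ?thesis
        by (smt (verit) mult_left_mono)
    next
      case False
      hence "norm (f_axis t) = exp (real k * (- t)) * norm (f_axis (- t))"
        using norm_f_axis_minus[of "- t"] by simp
      also have "\<dots> \<le> exp (real k * (- t)) * (C' * exp (- (real (N + k) * (- t))))"
        using *[of "- t"] False by (intro mult_left_mono) auto
      also have "\<dots> = C' * exp (- (real N * (- t)))"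
        by (simp add: exp_add[symmetric] algebra_simps)
      finally show ?thesis using False by simp
    qed
  qed
qed

lemma norm_exp_mult_le: "norm (exp (s * of_real t)) \<le> exp (\<bar>Re s\<bar> * \<bar>t\<bar>)"
  by (simp add: abs_mult[symmetric])

lemma f_axis_exp_bound:
  obtains C where "\<And>t. norm (f_axis t) * exp (B * \<bar>t\<bar>) \<le> C * exp (- \<bar>t\<bar>)"
proof -
  define N where "N = nat \<lceil>B\<rceil> + 1"
  have N: "real N \<ge> B + 1" unfolding N_def by linarith
  obtain C where C: "C \<ge> 0" "\<And>t. norm (f_axis t) \<le> C * exp (- (real N * \<bar>t\<bar>))"
    using f_axis_decay by blast
  show thesis
  proof (rule that[of C])
    fix t
    have "norm (f_axis t) * exp (B * \<bar>t\<bar>) \<le> C * exp (- (real N * \<bar>t\<bar>)) * exp (B * \<bar>t\<bar>)"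
      by (intro mult_right_mono C) auto
    also have "\<dots> = C * exp ((B - real N) * \<bar>t\<bar>)" by (simp add: exp_add[symmetric] algebra_simps)
    also have "(B - real N) * \<bar>t\<bar> \<le> (- 1) * \<bar>t\<bar>" using N by (intro mult_right_mono) auto
    hence "C * exp ((B - real N) * \<bar>t\<bar>) \<le> C * exp ((- 1) * \<bar>t\<bar>)" using C(1) by (intro mult_left_mono) auto
    finally show "norm (f_axis t) * exp (B * \<bar>t\<bar>) \<le> C * exp (- \<bar>t\<bar>)" by simp
  qed
qed

lemma measurable_f_axis [measurable]: "f_axis \<in> borel_measurable borel"
  by (intro borel_measurable_continuous_onI continuous_f_axis)

lemma integrable_f_axis_exp_abs: "integrable lborel (\<lambda>t. norm (f_axis t) * exp (B * \<bar>t\<bar>))"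
proof -
  obtain C where "\<And>t. norm (f_axis t) * exp (B * \<bar>t\<bar>) \<le> C * exp (- \<bar>t\<bar>)" using f_axis_exp_bound by blast
  moreover have "(\<lambda>t. norm (f_axis t) * exp (B * \<bar>t\<bar>)) \<in> borel_measurable borel" by measurable
  ultimately show ?thesis by (intro integrable_lborel_exp_bound[where C = C]) auto
qed

lemma integrable_f_axis_exp: "integrable lborel (\<lambda>t. f_axis t * exp (s * of_real t))"
proof (rule Bochner_Integration.integrable_bound)
  show "integrable lborel (\<lambda>t. norm (f_axis t) * exp (\<bar>Re s\<bar> * \<bar>t\<bar>))" by (rule integrable_f_axis_exp_abs)
  show "(\<lambda>t. f_axis t * exp (s * of_real t)) \<in> borel_measurable lborel" by measurable
  show "AE t in lborel. norm (f_axis t * exp (s * of_real t)) \<le> norm (norm (f_axis t) * exp (\<bar>Re s\<bar> * \<bar>t\<bar>))"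
    using norm_exp_mult_le[of s] by (intro AE_I2) (simp add: norm_mult mult_left_mono)
qed

text \<open>This is the completed L-function \<open>(2\<pi>)\<^sup>-\<^sup>s \<Gamma>(s) L(s)\<close>: the Mellin transform of \<open>f\<close> along the imaginary
  axis, written in the logarithmic variable.\<close>

definition Lam :: "complex \<Rightarrow> complex" where
  "Lam s = (\<integral>t. f_axis t * exp (s * of_real t) \<partial>lborel)"

lemma Lam_functional_equation: "Lam (of_nat k - s) = \<i> ^ k * Lam s"
proof -
  have "Lam (of_nat k - s) = (\<integral>t. f_axis (0 + (-1) * t) * exp ((of_nat k - s) * of_real (0 + (-1) * t)) \<partial>lborel)"
    unfolding Lam_def by (subst lborel_integral_real_affine[of "-1" _ 0]) simp_all
  also have "\<dots> = (\<integral>t. \<i> ^ k * (f_axis t * exp (s * of_real t)) \<partial>lborel)"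
  proof (intro Bochner_Integration.integral_cong refl)
    fix t :: real
    have "of_real (exp t) ^ k * exp ((of_nat k - s) * of_real (- t)) = exp (s * of_real t)"
      by (simp add: exp_of_nat_mult[symmetric] exp_add[symmetric] algebra_simps flip: exp_of_real)
    thus "f_axis (0 + (-1) * t) * exp ((of_nat k - s) * of_real (0 + (-1) * t)) = \<i> ^ k * (f_axis t * exp (s * of_real t))"
      by (simp add: f_axis_minus power_mult_distrib mult_ac)
  qed
  finally show ?thesis by (simp add: Lam_def)
qed

text \<open>Expand exp (s t) and integrate term by term, with the partial sums dominated by the
  absolute value of \<open>f_axis\<close> times exp (|s| |t|). This yields that \<open>Lam\<close>
  is entire without differentiation under the integral.\<close>

lemma Lam_power_series:
  "(\<lambda>m. (\<integral>t. f_axis t * of_real (t ^ m / fact m) \<partial>lborel) * s ^ m) sums Lam s"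
proof -
  let ?F = "\<lambda>m t. f_axis t * of_real (t ^ m / fact m) * s ^ m"
  have ser: "(\<lambda>m. norm (?F m t)) sums (norm (f_axis t) * exp (norm s * \<bar>t\<bar>))" for t
  proof -
    have "(\<lambda>m. norm (f_axis t) * ((norm s * \<bar>t\<bar>) ^ m / fact m)) sums (norm (f_axis t) * exp (norm s * \<bar>t\<bar>))"
      using exp_converges[of "norm s * \<bar>t\<bar>"] by (intro sums_mult) (simp add: field_simps)
    thus ?thesis by (simp add: norm_mult norm_power norm_divide power_abs power_mult_distrib mult_ac)
  qed
  have ser2: "(\<lambda>m. ?F m t) sums (f_axis t * exp (s * of_real t))" for t
  proof -
    have "(\<lambda>m. f_axis t * ((s * of_real t) ^ m / fact m)) sums (f_axis t * exp (s * of_real t))"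
      using exp_converges[of "s * of_real t"] by (intro sums_mult) (simp add: scaleR_conv_of_real field_simps)
    thus ?thesis by (simp add: power_mult_distrib mult_ac)
  qed
  have int: "integrable lborel (?F m)" for m
  proof (rule Bochner_Integration.integrable_bound)
    show "integrable lborel (\<lambda>t. norm (f_axis t) * exp (norm s * \<bar>t\<bar>))" by (rule integrable_f_axis_exp_abs)
    show "?F m \<in> borel_measurable lborel" by measurable
    have "norm (?F m t) \<le> norm (f_axis t) * exp (norm s * \<bar>t\<bar>)" for t
      using sum_le_suminf[of "\<lambda>m. norm (?F m t)" "{m}"] ser[of t] by (simp add: sums_iff)
    thus "AE t in lborel. norm (?F m t) \<le> norm (norm (f_axis t) * exp (norm s * \<bar>t\<bar>))"
      by (intro AE_I2) simp
  qed
  have "(\<lambda>m. integral\<^sup>L lborel (?F m)) sums (\<integral>t. (\<Sum>m. ?F m t) \<partial>lborel)"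
  proof (rule sums_integral[OF int])
    show "AE t in lborel. summable (\<lambda>m. norm (?F m t))" using ser by (intro AE_I2) (simp add: sums_iff)
    show "summable (\<lambda>m. \<integral>t. norm (?F m t) \<partial>lborel)"
    proof (rule bounded_imp_summable)
      fix n
      have "(\<Sum>m\<le>n. \<integral>t. norm (?F m t) \<partial>lborel) = (\<integral>t. (\<Sum>m\<le>n. norm (?F m t)) \<partial>lborel)"
        using int by (intro Bochner_Integration.integral_sum[symmetric]) auto
      also have "\<dots> \<le> (\<integral>t. norm (f_axis t) * exp (norm s * \<bar>t\<bar>) \<partial>lborel)"
      proof (rule integral_mono)
        show "integrable lborel (\<lambda>t. \<Sum>m\<le>n. norm (?F m t))" using int by (intro Bochner_Integration.integrable_sum) auto
        show "(\<Sum>m\<le>n. norm (?F m t)) \<le> norm (f_axis t) * exp (norm s * \<bar>t\<bar>)" for t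
          using sum_le_suminf[of "\<lambda>m. norm (?F m t)" "{..n}"] ser[of t] by (simp add: sums_iff)
      qed (rule integrable_f_axis_exp_abs)
      finally show "(\<Sum>m\<le>n. \<integral>t. norm (?F m t) \<partial>lborel) \<le> (\<integral>t. norm (f_axis t) * exp (norm s * \<bar>t\<bar>) \<partial>lborel)" .
    qed simp
  qed
  moreover have "(\<integral>t. (\<Sum>m. ?F m t) \<partial>lborel) = Lam s"
    using ser2 unfolding Lam_def by (intro Bochner_Integration.integral_cong) (simp_all add: sums_iff)
  ultimately show ?thesis by simp
qed

lemma Lam_holomorphic: "Lam holomorphic_on UNIV"
proof -
  have "Lam holomorphic_on ball 0 r" for r
  proof (rule power_series_holomorphic)
    show "(\<lambda>m. (\<integral>t. f_axis t * of_real (t ^ m / fact m) \<partial>lborel) * (w - 0) ^ m) sums Lam w" for w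
      unfolding diff_zero by (rule Lam_power_series)
  qed
  hence "Lam field_differentiable (at z)" for z
    by (rule holomorphic_on_imp_differentiable_at[of _ "ball 0 (norm z + 1)"]) auto
  thus ?thesis by (auto simp: holomorphic_on_def intro: field_differentiable_at_within)
qed

lemma f_axis_sums: "(\<lambda>n. a n * of_real (exp (- (2 * pi * real n * exp t)))) sums f_axis t"
proof -
  have "exp (2 * of_real pi * \<i> * of_nat n * (\<i> * of_real (exp t))) = of_real (exp (- (2 * pi * real n * exp t)))" for n
    by (simp add: algebra_simps flip: exp_of_real)
  with sums_f[of "\<i> * of_real (exp t)"] show ?thesis by (simp add: f_axis_def)
qed

end

text \<open>The exponent h + 1 is the one in the eigenvalue bound; A will be |a(1)|, so that all
  error terms are relative to the first coefficient.\<close>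

locale bounded_cusp_expansion = cusp_expansion +
  fixes h :: nat and A :: real
  assumes k_eq: "k = 2 * h" and coeff_bound: "\<And>n. n \<ge> 1 \<Longrightarrow> cmod (a n) \<le> A * real n ^ (h + 1)"
begin

lemma A_nonneg: "A \<ge> 0"
  using order.trans[OF norm_ge_zero coeff_bound[of 1]] by simp

lemma summable_coeff_powr:
  assumes "\<sigma> > real h + 2"
  shows "summable (\<lambda>n. cmod (a n) * real n powr (- \<sigma>))"
proof (rule summable_comparison_test')
  show "summable (\<lambda>n. A * real n powr (real h + 1 - \<sigma>))"
    using assms by (intro summable_mult) (simp add: summable_real_powr_iff)
  fix n :: nat assume n: "n \<ge> 1"
  have "cmod (a n) * real n powr (- \<sigma>) \<le> A * real n ^ (h + 1) * real n powr (- \<sigma>)"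
    using n by (intro mult_right_mono coeff_bound) auto
  also have "real n ^ (h + 1) = real n powr (real h + 1)" using n powr_realpow[of "real n" "h + 1"] by (simp add: add.commute)
  also have "A * real n powr (real h + 1) * real n powr (- \<sigma>) = A * real n powr (real h + 1 - \<sigma>)"
    by (simp add: powr_add[symmetric])
  finally show "norm (cmod (a n) * real n powr (- \<sigma>)) \<le> A * real n powr (real h + 1 - \<sigma>)" by simp
qed

section \<open>Termwise Mellin transform and analytic continuation\<close>

lemma Mellin_term:
  assumes "Re s \<ge> 1"
  shows "(\<integral>t. a n * of_real (exp (- (2 * pi * real n * exp t))) * exp (s * of_real t) \<partial>lborel) =
      Gamma s * of_real (2 * pi) powr (- s) * (a n * of_nat n powr (- s))" (is ?I)
    and "integrable lborel (\<lambda>t. a n * of_real (exp (- (2 * pi * real n * exp t))) * exp (s * of_real t))" (is ?J)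
proof -
  show ?I
  proof (cases "n = 0")
    case False
    have "(\<integral>t. a n * of_real (exp (- (2 * pi * real n * exp t))) * exp (s * of_real t) \<partial>lborel) =
      a n * (\<integral>t. exp (s * of_real t) * of_real (exp (- (2 * pi * real n * exp t))) \<partial>lborel)"
      by (simp add: mult_ac flip: integral_mult_right_zero)
    also have "\<dots> = a n * (Gamma s * of_real (2 * pi * real n) powr (- s))"
      using integral_exp_scaled(1)[OF assms, of "2 * pi * real n"] False by simp
    also have "of_real (2 * pi * real n) powr (- s) = of_real (2 * pi) powr (- s) * of_real (real n) powr (- s)"
      unfolding of_real_mult by (rule powr_times_real) auto
    finally show ?thesis by (simp add: mult_ac)
  qed (simp add: a0)
  show ?J
  proof (cases "n = 0")
    case False
    have "integrable lborel (\<lambda>t. a n * (exp (s * of_real t) * of_real (exp (- (2 * pi * real n * exp t)))))"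
      using integral_exp_scaled(2)[OF assms, of "2 * pi * real n"] False by (intro integrable_mult_right) simp
    thus ?thesis by (simp add: mult_ac)
  qed (simp add: a0)
qed

lemma norm_Mellin_term:
  assumes "\<sigma> \<ge> 1"
  shows "(\<integral>t. cmod (a n) * exp (- (2 * pi * real n * exp t)) * exp (\<sigma> * t) \<partial>lborel) =
      Gamma \<sigma> * (2 * pi) powr (- \<sigma>) * (cmod (a n) * real n powr (- \<sigma>))" (is ?I)
    and "integrable lborel (\<lambda>t. cmod (a n) * exp (- (2 * pi * real n * exp t)) * exp (\<sigma> * t))" (is ?J)
proof -
  let ?f = "\<lambda>t. exp (complex_of_real \<sigma> * of_real t) * of_real (exp (- (2 * pi * real n * exp t)))"
  have re: "Re (?f t) = exp (- (2 * pi * real n * exp t)) * exp (\<sigma> * t)" for t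
  proof -
    have "exp (complex_of_real \<sigma> * of_real t) = of_real (exp (\<sigma> * t))" by (simp flip: exp_of_real)
    hence "?f t = of_real (exp (\<sigma> * t) * exp (- (2 * pi * real n * exp t)))" by (simp only: of_real_mult)
    thus ?thesis by (simp only: Re_complex_of_real mult.commute)
  qed
  show ?I
  proof (cases "n = 0")
    case False
    note I = integral_exp_scaled[of "complex_of_real \<sigma>" "2 * pi * real n"]
    have i: "integrable lborel ?f" using I(2) assms False by simp
    have "(\<integral>t. cmod (a n) * exp (- (2 * pi * real n * exp t)) * exp (\<sigma> * t) \<partial>lborel) = cmod (a n) * (\<integral>t. Re (?f t) \<partial>lborel)"
      unfolding re by (simp add: mult.assoc)
    also have "(\<integral>t. Re (?f t) \<partial>lborel) = Re (\<integral>t. ?f t \<partial>lborel)" using i by (rule integral_Re)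
    also have "\<dots> = Re (Gamma (of_real \<sigma>) * of_real (2 * pi * real n) powr (- of_real \<sigma>))" using I(1) assms False by simp
    also have "of_real (2 * pi * real n) powr (- complex_of_real \<sigma>) = of_real ((2 * pi * real n) powr (- \<sigma>))"
      using powr_of_real[of "2 * pi * real n" "- \<sigma>"] by simp
    also have "Re (Gamma (of_real \<sigma>) * of_real ((2 * pi * real n) powr (- \<sigma>))) = Gamma \<sigma> * (2 * pi * real n) powr (- \<sigma>)"
      by (simp add: Gamma_complex_of_real)
    also have "(2 * pi * real n) powr (- \<sigma>) = (2 * pi) powr (- \<sigma>) * real n powr (- \<sigma>)" by (simp add: powr_mult)
    finally show ?thesis by (simp add: mult_ac)
  qed (simp add: a0)
  show ?J
  proof (cases "n = 0")
    case False
    have "integrable lborel (\<lambda>t. cmod (a n) * Re (?f t))"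
      using integral_exp_scaled(2)[of "complex_of_real \<sigma>" "2 * pi * real n"] assms False
      by (intro integrable_mult_right integrable_Re) simp
    thus ?thesis unfolding re by (simp add: mult.assoc)
  qed (simp add: a0)
qed

lemma Mellin_sums:
  assumes "Re s > real h + 2"
  shows "(\<lambda>n. Gamma s * of_real (2 * pi) powr (- s) * (a n * of_nat n powr (- s))) sums Lam s"
proof -
  have s1: "Re s \<ge> 1" using assms by simp
  let ?F = "\<lambda>n t. a n * of_real (exp (- (2 * pi * real n * exp t))) * exp (s * of_real t)"
  have nm: "norm (?F n t) = cmod (a n) * exp (- (2 * pi * real n * exp t)) * exp (Re s * t)" for n t
    by (simp add: norm_mult)
  have "(\<lambda>n. integral\<^sup>L lborel (?F n)) sums (\<integral>t. (\<Sum>n. ?F n t) \<partial>lborel)"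
  proof (rule sums_integral)
    show "integrable lborel (?F n)" for n by (rule Mellin_term(2)[OF s1])
    show "AE t in lborel. summable (\<lambda>n. norm (?F n t))"
      unfolding nm by (intro AE_I2 summable_mult2 summable_abs_coeffs) simp
    show "summable (\<lambda>n. \<integral>t. norm (?F n t) \<partial>lborel)"
      unfolding nm norm_Mellin_term(1)[OF s1] by (intro summable_mult summable_coeff_powr assms)
  qed
  moreover have "(\<integral>t. (\<Sum>n. ?F n t) \<partial>lborel) = Lam s"
    unfolding Lam_def using sums_mult2[OF f_axis_sums] by (intro Bochner_Integration.integral_cong) (simp_all add: sums_iff)
  ultimately show ?thesis unfolding Mellin_term(1)[OF s1] by simp
qed

text \<open>Multiplying by the entire function \<open>rGamma\<close> rather than dividing by Gamma
  keeps the continuation free of singularities by construction.\<close>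

definition Lentire :: "complex \<Rightarrow> complex" where
  "Lentire s = Lam s * of_real (2 * pi) powr s * rGamma s"

lemma Lentire_holomorphic: "Lentire holomorphic_on UNIV"
  unfolding Lentire_def by (intro holomorphic_intros Lam_holomorphic)

lemma Lentire_sums:
  assumes "Re s > real h + 2"
  shows "(\<lambda>n. a (Suc n) * of_nat (Suc n) powr (- s)) sums Lentire s"
proof -
  have G: "Gamma s \<noteq> 0" "rGamma s * Gamma s = 1"
  proof -
    have "s \<notin> \<int>\<^sub>\<le>\<^sub>0" using assms by (auto elim!: nonpos_Ints_cases)
    thus "Gamma s \<noteq> 0" "rGamma s * Gamma s = 1" by (simp_all add: Gamma_eq_zero_iff rGamma_inverse_Gamma)
  qed
  have p: "complex_of_real (2 * pi) powr s * of_real (2 * pi) powr (- s) = 1"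
    by (simp flip: powr_add)
  have "(\<lambda>n. (Gamma s * of_real (2 * pi) powr (- s) * (a n * of_nat n powr (- s))) * (of_real (2 * pi) powr s * rGamma s)) sums
      (Lam s * (of_real (2 * pi) powr s * rGamma s))"
    by (intro sums_mult2 Mellin_sums assms)
  also have "(\<lambda>n. (Gamma s * of_real (2 * pi) powr (- s) * (a n * of_nat n powr (- s))) * (of_real (2 * pi) powr s * rGamma s)) =
     (\<lambda>n. a n * of_nat n powr (- s))"
  proof
    fix n
    have "(Gamma s * of_real (2 * pi) powr (- s) * (a n * of_nat n powr (- s))) * (of_real (2 * pi) powr s * rGamma s) =
      (rGamma s * Gamma s) * (complex_of_real (2 * pi) powr s * of_real (2 * pi) powr (- s)) * (a n * of_nat n powr (- s))"
      by (simp only: mult_ac)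
    thus "(Gamma s * of_real (2 * pi) powr (- s) * (a n * of_nat n powr (- s))) * (of_real (2 * pi) powr s * rGamma s) = a n * of_nat n powr (- s)"
      by (simp only: G(2) p mult_1)
  qed
  finally have "(\<lambda>n. a n * of_nat n powr (- s)) sums Lentire s" by (simp only: Lentire_def mult.assoc)
  thus ?thesis by (subst sums_Suc_iff) (simp add: a0)
qed

text \<open>Two entire functions given by the same Dirichlet series in right half planes agree on
  the smaller half plane, hence everywhere; this evaluates the definite description.\<close>

lemma L_function_eq: "L_function a = Lentire"
  unfolding L_function_def
proof (rule the_equality)
  show "Lentire holomorphic_on UNIV \<and> (\<exists>\<sigma>::real. \<forall>s. Re s > \<sigma> \<longrightarrow> (\<lambda>n. a (Suc n) * of_nat (Suc n) powr (-s)) sums Lentire s)"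
    using Lentire_holomorphic Lentire_sums by blast
next
  fix L assume L: "L holomorphic_on UNIV \<and> (\<exists>\<sigma>::real. \<forall>s. Re s > \<sigma> \<longrightarrow> (\<lambda>n. a (Suc n) * of_nat (Suc n) powr (-s)) sums L s)"
  then obtain \<sigma> :: real where \<sigma>: "\<And>s. Re s > \<sigma> \<Longrightarrow> (\<lambda>n. a (Suc n) * of_nat (Suc n) powr (-s)) sums L s" by blast
  define \<tau> where "\<tau> = max \<sigma> (real h + 2)"
  show "L = Lentire"
  proof
    fix s
    show "L s = Lentire s"
    proof (rule analytic_continuation_open[of "{s. Re s > \<tau>}" UNIV L Lentire])
      show "open {s. Re s > \<tau>}" by (rule open_halfspace_Re_gt)
      have "complex_of_real (\<tau> + 1) \<in> {s. Re s > \<tau>}" by simp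
      thus "{s. Re s > \<tau>} \<noteq> {}" by blast
      show "L z = Lentire z" if "z \<in> {s. Re s > \<tau>}" for z
        using that sums_unique2[OF \<sigma>[of z] Lentire_sums[of z]] by (simp add: \<tau>_def)
    qed (use L Lentire_holomorphic in auto)
  qed
qed

lemma L_function_nat: "L_function a (of_nat (Suc n)) = Lam (of_nat (Suc n)) * of_real (2 * pi) ^ Suc n / fact n"
proof -
  have "Gamma (of_nat (Suc n) :: complex) = fact n" using Gamma_fact[of n] by (simp add: add.commute)
  hence "rGamma (of_nat (Suc n) :: complex) = 1 / fact n" by (simp add: rGamma_inverse_Gamma inverse_eq_divide)
  moreover have "complex_of_real (2 * pi) powr of_nat (Suc n) = of_real (2 * pi) ^ Suc n"
    by (rule powr_nat') simp
  ultimately show ?thesis unfolding L_function_eq Lentire_def by simp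
qed

end

section \<open>Estimates for the L-function\<close>

lemma summable_inverse_squares_shift: "summable (\<lambda>n. 1 / (real n + 2)\<^sup>2)"
  and suminf_inverse_squares_shift_le: "(\<Sum>n. 1 / (real n + 2)\<^sup>2) \<le> 1"
proof -
  have "(\<lambda>n. 1 / real (Suc n)) \<longlonglongrightarrow> 0" using LIMSEQ_inverse_real_of_nat by (simp add: inverse_eq_divide)
  from telescope_sums'[OF this] have t: "(\<lambda>n. 1 / (real n + 1) - 1 / (real n + 2)) sums 1"
    by (simp add: add.commute)
  have le: "1 / (real n + 2)\<^sup>2 \<le> 1 / (real n + 1) - 1 / (real n + 2)" for n
  proof -
    have "1 / (real n + 1) - 1 / (real n + 2) = 1 / ((real n + 1) * (real n + 2))" by (simp add: field_simps)
    also have "\<dots> \<ge> 1 / ((real n + 2) * (real n + 2))"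
      by (intro divide_left_mono mult_right_mono mult_pos_pos) auto
    finally show ?thesis by (simp add: power2_eq_square)
  qed
  show s: "summable (\<lambda>n. 1 / (real n + 2)\<^sup>2)"
    by (rule summable_comparison_test'[OF sums_summable[OF t]]) (use le in auto)
  show "(\<Sum>n. 1 / (real n + 2)\<^sup>2) \<le> 1"
    using suminf_le[OF le s sums_summable[OF t]] t by (simp add: sums_iff)
qed

context bounded_cusp_expansion
begin

text \<open>For n >= 2 and u = N - h - 3, |a(n)| n^(-N) <= A n^(-u) n^(-2) <= A 2^(-u) n^(-2), and
  the sum of 1/n^2 over n >= 2 is at most 1. The stated bound is A / 2^u.\<close>

lemma Lentire_near_first_coeff:
  assumes "N \<ge> h + 3"
  shows "cmod (Lentire (of_nat N) - a 1) \<le> 4 * A / 2 ^ (N - h - 1)"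
proof -
  define u where "u = N - h - 3"
  have N: "N = h + 3 + u" using assms by (simp add: u_def)
  have "(\<lambda>n. a (Suc n) * of_nat (Suc n) powr (- of_nat N)) sums Lentire (of_nat N)"
    by (rule Lentire_sums) (simp add: N)
  hence s: "(\<lambda>n. a (Suc (Suc n)) * of_nat (Suc (Suc n)) powr (- of_nat N)) sums (Lentire (of_nat N) - a 1)"
    using sums_Suc_iff[of "\<lambda>n. a (Suc n) * of_nat (Suc n) powr (- of_nat N)" "Lentire (of_nat N) - a 1"] by simp
  have b: "norm (a (Suc (Suc n)) * of_nat (Suc (Suc n)) powr (- of_nat N)) \<le> A / 2 ^ u * (1 / (real n + 2)\<^sup>2)" for n
  proof -
    let ?m = "real (Suc (Suc n))"
    have "norm (a (Suc (Suc n)) * of_nat (Suc (Suc n)) powr (- of_nat N)) = cmod (a (Suc (Suc n))) * ?m powr (- real N)"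
      by (simp add: norm_mult norm_powr_real_powr' del: of_nat_Suc)
    also have "\<dots> \<le> A * ?m ^ (h + 1) * ?m powr (- real N)"
      by (intro mult_right_mono coeff_bound) auto
    also have "?m powr (- real N) = 1 / ?m ^ N"
      by (simp add: powr_minus powr_realpow divide_inverse del: of_nat_Suc)
    also have "A * ?m ^ (h + 1) * (1 / ?m ^ N) = A * (1 / ?m ^ u * (1 / ?m\<^sup>2))"
      by (simp add: N power_add field_simps power2_eq_square power3_eq_cube numeral_3_eq_3 del: of_nat_Suc)
    also have "\<dots> \<le> A * (1 / 2 ^ u * (1 / ?m\<^sup>2))"
      by (intro mult_left_mono mult_right_mono divide_left_mono power_mono A_nonneg) auto
    finally show ?thesis by (simp add: add.commute)
  qed
  have "norm (Lentire (of_nat N) - a 1) \<le> (\<Sum>n. A / 2 ^ u * (1 / (real n + 2)\<^sup>2))"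
    using norm_suminf_le[OF b summable_mult[OF summable_inverse_squares_shift]] s by (simp add: sums_iff)
  also have "\<dots> = A / 2 ^ u * (\<Sum>n. 1 / (real n + 2)\<^sup>2)"
    by (rule suminf_mult[OF summable_inverse_squares_shift])
  also have "\<dots> \<le> A / 2 ^ u * 1"
    by (intro mult_left_mono suminf_inverse_squares_shift_le) (use A_nonneg in auto)
  also have "\<dots> = 4 * A / 2 ^ (N - h - 1)"
    by (simp add: N power_add)
  finally show ?thesis .
qed

text \<open>On the line h + 3 the Dirichlet series converges absolutely, the sum of |a(n)| n^(-h-3)
  being at most A (1 + 1); the remaining factor is Gamma (h + 3) / (2 pi)^(h+3).\<close>

lemma integral_norm_f_axis_le:
  "(\<integral>t. norm (f_axis t) * exp (real (h + 3) * t) \<partial>lborel) \<le> 2 * A * fact (h + 2) / (2 * pi) ^ (h + 3)"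
proof -
  define \<sigma> where "\<sigma> = real (h + 3)"
  have \<sigma>: "\<sigma> \<ge> 1" "\<sigma> > real h + 2" by (simp_all add: \<sigma>_def)
  let ?F = "\<lambda>n t. cmod (a n) * exp (- (2 * pi * real n * exp t)) * exp (\<sigma> * t)"
  have sm: "summable (\<lambda>n. ?F n t)" for t by (intro summable_mult2 summable_abs_coeffs) simp
  have AE: "AE t in lborel. summable (\<lambda>n. norm (?F n t))" using sm by simp
  have sum: "summable (\<lambda>n. \<integral>t. norm (?F n t) \<partial>lborel)"
    using norm_Mellin_term(1)[OF \<sigma>(1)] summable_coeff_powr[OF \<sigma>(2)] by (simp add: summable_mult)
  note I = norm_Mellin_term(2)[OF \<sigma>(1)]
  have "(\<integral>t. norm (f_axis t) * exp (\<sigma> * t) \<partial>lborel) \<le> (\<integral>t. (\<Sum>n. ?F n t) \<partial>lborel)"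
  proof (rule integral_mono)
    have "integrable lborel (\<lambda>t. norm (f_axis t * exp (of_real \<sigma> * of_real t)))"
      by (intro integrable_norm integrable_f_axis_exp)
    thus "integrable lborel (\<lambda>t. norm (f_axis t) * exp (\<sigma> * t))" by (simp add: norm_mult)
    show "integrable lborel (\<lambda>t. \<Sum>n. ?F n t)" by (rule integrable_suminf[OF I AE sum])
    fix t
    have "norm (f_axis t) \<le> (\<Sum>n. cmod (a n) * exp (- (2 * pi * real n * exp t)))"
      using norm_suminf_le[of "\<lambda>n. a n * of_real (exp (- (2 * pi * real n * exp t)))", OF _ summable_abs_coeffs[of "exp t"]]
        f_axis_sums[of t] by (simp add: norm_mult sums_iff)
    hence "norm (f_axis t) * exp (\<sigma> * t) \<le> (\<Sum>n. cmod (a n) * exp (- (2 * pi * real n * exp t))) * exp (\<sigma> * t)"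
      by (rule mult_right_mono) simp
    also have "\<dots> = (\<Sum>n. ?F n t)" by (rule suminf_mult2[OF summable_abs_coeffs]) simp
    finally show "norm (f_axis t) * exp (\<sigma> * t) \<le> (\<Sum>n. ?F n t)" .
  qed
  also have "\<dots> = (\<Sum>n. Gamma \<sigma> * (2 * pi) powr (- \<sigma>) * (cmod (a n) * real n powr (- \<sigma>)))"
    using integral_suminf[OF I AE sum] norm_Mellin_term(1)[OF \<sigma>(1)] by simp
  also have "\<dots> = Gamma \<sigma> * (2 * pi) powr (- \<sigma>) * (\<Sum>n. cmod (a n) * real n powr (- \<sigma>))"
    by (rule suminf_mult[OF summable_coeff_powr[OF \<sigma>(2)]])
  also have "\<dots> \<le> Gamma \<sigma> * (2 * pi) powr (- \<sigma>) * (2 * A)"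
  proof (intro mult_left_mono)
    let ?g = "\<lambda>n. cmod (a n) * real n powr (- \<sigma>)"
    have b: "?g n \<le> A * (1 / (real n)\<^sup>2)" if "n \<ge> 1" for n
    proof -
      have e: "real n powr (- \<sigma>) = 1 / real n ^ (h + 3)"
        using that unfolding \<sigma>_def by (simp only: powr_minus) (simp add: powr_realpow divide_inverse del: of_nat_add)
      have "?g n \<le> A * real n ^ (h + 1) * (1 / real n ^ (h + 3))"
        unfolding e using that by (intro mult_right_mono coeff_bound) auto
      also have "A * real n ^ (h + 1) * (1 / real n ^ (h + 3)) = A * (1 / (real n)\<^sup>2)"
        using that by (simp add: power_add power2_eq_square power3_eq_cube)
      finally show ?thesis .
    qed
    have s: "summable ?g" by (rule summable_coeff_powr[OF \<sigma>(2)])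
    have "(\<Sum>n. ?g n) = (\<Sum>n. ?g (n + 2)) + (\<Sum>n<2. ?g n)" by (rule suminf_split_initial_segment[OF s])
    also have "(\<Sum>n<2. ?g n) = ?g 0 + ?g 1" by (simp add: numeral_2_eq_2)
    also have "\<dots> \<le> A" using b[of 1] by (simp add: a0)
    also have "(\<Sum>n. ?g (n + 2)) \<le> (\<Sum>n. A * (1 / (real n + 2)\<^sup>2))"
      by (rule suminf_le[OF _ summable_ignore_initial_segment[OF s] summable_mult[OF summable_inverse_squares_shift]])
        (use b[of "_ + 2"] in \<open>simp add: add.commute\<close>)
    also have "\<dots> = A * (\<Sum>n. 1 / (real n + 2)\<^sup>2)" by (rule suminf_mult[OF summable_inverse_squares_shift])
    also have "\<dots> \<le> A * 1" by (intro mult_left_mono suminf_inverse_squares_shift_le A_nonneg)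
    finally show "(\<Sum>n. ?g n) \<le> 2 * A" by simp
    show "0 \<le> Gamma \<sigma> * (2 * pi) powr (- \<sigma>)" using \<sigma> by (intro mult_nonneg_nonneg Gamma_real_nonneg) auto
  qed
  also have "Gamma \<sigma> = fact (h + 2)" using Gamma_fact[of "h + 2", where 'a = real] by (simp add: \<sigma>_def add.commute)
  also have "(2 * pi) powr (- \<sigma>) = 1 / (2 * pi) ^ (h + 3)"
    unfolding \<sigma>_def by (simp only: powr_minus) (simp add: powr_realpow divide_inverse del: of_nat_add)
  finally show ?thesis by (simp add: \<sigma>_def mult_ac)
qed

text \<open>For N <= h + 2 the coefficient bound gives no absolute convergence. Instead exp (N t) is
  at most exp ((h + 3) t) for t >= 0 and at most exp ((h - 3) t) for t <= 0, and the inversion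
  formula for f reflects the second integral into the first.\<close>

lemma Lam_central_bound:
  assumes "h \<le> N" "N \<le> h + 3"
  shows "cmod (Lam (of_nat N)) \<le> 4 * A * fact (h + 2) / (2 * pi) ^ (h + 3)"
proof -
  let ?g = "\<lambda>t. norm (f_axis t) * exp (real (h + 3) * t)"
  have "integrable lborel (\<lambda>t. norm (f_axis t * exp (of_nat (h + 3) * of_real t)))"
    by (intro integrable_norm integrable_f_axis_exp)
  hence g: "integrable lborel ?g" by (simp add: norm_mult)
  hence g': "integrable lborel (\<lambda>t. ?g (0 + (-1) * t))" by (rule lborel_integrable_real_affine) simp
  have "cmod (Lam (of_nat N)) \<le> (\<integral>t. norm (f_axis t * exp (of_nat N * of_real t)) \<partial>lborel)"
    unfolding Lam_def by (rule integral_norm_bound)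
  also have "\<dots> \<le> (\<integral>t. ?g t + ?g (0 + (-1) * t) \<partial>lborel)"
  proof (rule integral_mono)
    show "integrable lborel (\<lambda>t. norm (f_axis t * exp (of_nat N * of_real t)))"
      by (intro integrable_norm integrable_f_axis_exp)
    show "integrable lborel (\<lambda>t. ?g t + ?g (0 + (-1) * t))" using g g' by (rule Bochner_Integration.integrable_add)
    fix t
    have "exp (real N * t) \<le> exp (real (h + 3) * t) + exp (real k * t) * exp (real (h + 3) * (- t))"
    proof (cases "t \<ge> 0")
      case True
      hence "real N * t \<le> real (h + 3) * t" using assms by (intro mult_right_mono) auto
      hence "exp (real N * t) \<le> exp (real (h + 3) * t)" by simp
      thus ?thesis by (rule order.trans) simp
    next
      case False
      have "real N * t \<le> (real k - real (h + 3)) * t" using assms False by (intro mult_right_mono_neg) (auto simp: k_eq)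
      hence "exp (real N * t) \<le> exp (real k * t) * exp (real (h + 3) * (- t))"
        by (simp add: exp_add[symmetric] algebra_simps)
      thus ?thesis by (rule order.trans) simp
    qed
    hence "norm (f_axis t) * exp (real N * t) \<le>
        norm (f_axis t) * (exp (real (h + 3) * t) + exp (real k * t) * exp (real (h + 3) * (- t)))"
      by (intro mult_left_mono) auto
    thus "norm (f_axis t * exp (of_nat N * of_real t)) \<le> ?g t + ?g (0 + (-1) * t)"
      by (simp add: norm_mult norm_f_axis_minus algebra_simps)
  qed
  also have "\<dots> = (\<integral>t. ?g t \<partial>lborel) + (\<integral>t. ?g (0 + (-1) * t) \<partial>lborel)"
    by (rule Bochner_Integration.integral_add[OF g g'])
  also have "(\<integral>t. ?g (0 + (-1) * t) \<partial>lborel) = (\<integral>t. ?g t \<partial>lborel)"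
    by (subst (2) lborel_integral_real_affine[of "-1" _ 0]) simp_all
  finally show ?thesis using integral_norm_f_axis_le by simp
qed

end

section \<open>The trivial zeros\<close>

lemma power_le_fact_exp_inverse:
  fixes x :: real
  assumes "x > 0"
  shows "x ^ n * exp (- (2 * pi * x)) \<le> fact (Suc n) / x"
proof -
  have "x ^ n * exp (- (2 * pi * x)) \<le> x ^ n * exp (- x)"
    using assms pi_gt3 by (intro mult_left_mono) auto
  also have "x ^ n * exp (- x) = x ^ Suc n / (x * exp x)" using assms by (simp add: exp_minus field_simps)
  also have "\<dots> \<le> fact (Suc n) * exp x / (x * exp x)"
    using assms by (intro divide_right_mono power_le_fact_exp) auto
  finally show ?thesis by simp
qed

context cusp_expansion
begin

lemma holomorphic_primitive_bound:
  assumes G: "\<And>z. Im z > 0 \<Longrightarrow> (G has_field_derivative g z) (at z)"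
    and y: "Im u = y" "Im v = y" "y > 0"
    and B: "\<And>z. Im z = y \<Longrightarrow> z \<in> closed_segment u v \<Longrightarrow> cmod (g z) \<le> B"
  shows "cmod (G u - G v) \<le> B * cmod (u - v)"
proof (rule field_differentiable_bound[of "closed_segment u v" G g])
  have im: "Im z = y" if z: "z \<in> closed_segment u v" for z
  proof -
    obtain s where "z = (1 - s) *\<^sub>R u + s *\<^sub>R v" using z unfolding in_segment by blast
    hence "Im z = (1 - s) * y + s * y" using y by simp
    thus ?thesis by (simp add: algebra_simps)
  qed
  show "(G has_field_derivative g z) (at z within closed_segment u v)" if "z \<in> closed_segment u v" for z
    by (rule has_field_derivative_at_within[OF G]) (simp add: im[OF that] y)
  show "cmod (g z) \<le> B" if "z \<in> closed_segment u v" for z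
    by (rule B[OF im[OF that] that])
qed auto

text \<open>Under u = -1/z the form f(u) u^w du becomes f(z) dz, because the weight is w + 2: the
  power disappears, and the remaining integrand is periodic.\<close>

lemma invert_primitive:
  assumes G: "\<And>z. Im z > 0 \<Longrightarrow> (G has_field_derivative f z * z ^ w) (at z)"
    and k: "k = w + 2" "even w" and z: "Im z > 0"
  shows "((\<lambda>u. G (- 1 / u)) has_field_derivative f z) (at z)"
proof -
  have z0: "z \<noteq> 0" using z by auto
  have im: "Im (- 1 / z) > 0" using z by (simp add: Im_divide cmod_power2[symmetric] z0 divide_pos_pos)
  have "((\<lambda>u. G (- 1 / u)) has_field_derivative (f (- 1 / z) * (- 1 / z) ^ w) * (1 / z\<^sup>2)) (at z)"
    by (rule DERIV_chain'[where f = "\<lambda>u. - 1 / u", OF _ G[OF im]])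
      (use z0 in \<open>auto intro!: derivative_eq_intros simp: power2_eq_square\<close>)
  moreover have "(f (- 1 / z) * (- 1 / z) ^ w) * (1 / z\<^sup>2) = f z"
    using z0 k invert[OF z] by (simp add: power_add power_divide power2_eq_square)
  ultimately show ?thesis by simp
qed

text \<open>H(z + 1) - H(z) is constant, and integrating f along a horizontal segment at height y
  bounds it by C / y for every y >= 1.\<close>

lemma primitive_periodic:
  assumes H: "\<And>z. Im z > 0 \<Longrightarrow> (H has_field_derivative f z) (at z)" and z: "Im z > 0"
  shows "H (z + 1) = H z"
proof -
  define E where "E = (\<lambda>u. H (u + 1) - H u)"
  have "(E has_field_derivative 0) (at u within upper_half_plane)" if "u \<in> upper_half_plane" for u
  proof -
    have u: "Im u > 0" using that by (simp add: upper_half_plane_def)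
    have "((\<lambda>u. H (u + 1)) has_field_derivative f (u + 1) * 1) (at u)"
      by (rule DERIV_chain'[OF _ H]) (use u in \<open>auto intro!: derivative_eq_intros\<close>)
    hence "(E has_field_derivative f (u + 1) * 1 - f u) (at u)"
      unfolding E_def by (rule DERIV_diff[OF _ H[OF u]])
    thus ?thesis using periodic[OF u, of 1] by (simp add: has_field_derivative_at_within)
  qed
  moreover have "convex upper_half_plane" unfolding upper_half_plane_def by (rule convex_halfspace_Im_gt)
  ultimately have "\<exists>c. \<forall>u\<in>upper_half_plane. E u = c"
    by (intro has_field_derivative_zero_constant)
  then obtain c where c: "\<And>u. u \<in> upper_half_plane \<Longrightarrow> E u = c" by blast
  obtain C where C: "C \<ge> 0" "\<And>z. Im z \<ge> 1 \<Longrightarrow> cmod (f z) \<le> C * exp (- (2 * pi * Im z))"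
    using decay[of 1] by auto
  have bnd: "cmod c \<le> C / y" if y: "y \<ge> 1" for y
  proof -
    define u where "u = \<i> * complex_of_real y"
    have "cmod (H (u + 1) - H u) \<le> (C / y) * cmod ((u + 1) - u)"
    proof (rule holomorphic_primitive_bound[OF H])
      show "y > 0" using y by simp
      fix z assume "Im z = y"
      hence "cmod (f z) \<le> C * exp (- (2 * pi * y))" using C(2)[of z] y by simp
      also have "\<dots> \<le> C * (1 / y)"
        using power_le_fact_exp_inverse[of y 0] y C(1) by (intro mult_left_mono) auto
      finally show "cmod (f z) \<le> C / y" by simp
    qed (simp_all add: u_def)
    moreover have "E u = c" using y by (intro c) (simp add: u_def upper_half_plane_def)
    ultimately show ?thesis by (simp add: E_def)
  qed
  have "c = 0"
  proof (rule ccontr)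
    assume "c \<noteq> 0"
    define y where "y = max 1 (2 * C / cmod c)"
    have "cmod c \<le> C / y" by (rule bnd) (simp add: y_def)
    moreover have "y \<ge> 2 * C / cmod c" "y \<ge> 1" by (simp_all add: y_def)
    ultimately have "y * cmod c \<le> C" "2 * C \<le> y * cmod c" "y * cmod c > 0"
      using \<open>c \<noteq> 0\<close> by (auto simp: field_simps)
    thus False by linarith
  qed
  with c[of z] z show ?thesis by (simp add: E_def upper_half_plane_def)
qed

lemma primitive_periodic_nat:
  assumes H: "\<And>z. Im z > 0 \<Longrightarrow> (H has_field_derivative f z) (at z)" and z: "Im z > 0"
  shows "H (z + of_nat m) = H z"
proof (induction m)
  case (Suc m)
  have "H (z + of_nat (Suc m)) = H ((z + of_nat m) + 1)" by (simp add: add_ac)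
  also have "\<dots> = H (z + of_nat m)" using z by (intro primitive_periodic[OF H]) auto
  finally show ?case using Suc by simp
qed simp

text \<open>The points considered here approach the cusp \<open>1/N\<close> non-tangentially, and \<open>z / (1 - N z)\<close> moves this
  cusp to \<open>i\<infinity>\<close>.\<close>

lemma bound_near_cusp:
  fixes N :: nat
  assumes C: "C \<ge> 0" "\<And>z. Im z \<ge> 1 \<Longrightarrow> cmod (f z) \<le> C * exp (- (2 * pi * Im z))"
    and N: "N = 1 \<or> N = 2" and y: "0 < y" "y \<le> 1"
    and z: "Im z = y / (real N ^ 2 + y ^ 2)" "\<bar>Re z - 1 / real N\<bar> \<le> y * Im z / real N"
  shows "cmod (f z) \<le> C * 5 ^ k * fact (Suc k) * y"
proof -
  define \<eta> where "\<eta> = Im z"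
  have Np: "real N > 0" "(real N)\<^sup>2 \<le> 4" using N by auto
  have D: "(real N)\<^sup>2 + y\<^sup>2 > 0" using Np by (simp add: add_pos_nonneg)
  have \<eta>: "\<eta> > 0" "\<eta> * ((real N)\<^sup>2 + y\<^sup>2) = y" using y D z by (simp_all add: \<eta>_def)
  \<comment> \<open>N <= 2 and y <= 1 give N^2 + y^2 <= 5, hence y <= 5 Im z; this is the origin of
    the factor 5^k.\<close>
  have "y\<^sup>2 \<le> 1" using y by (simp add: power_le_one)
  hence "\<eta> * ((real N)\<^sup>2 + y\<^sup>2) \<le> \<eta> * 5" using Np(2) \<eta>(1) by (intro mult_left_mono) auto
  hence "y \<le> \<eta> * 5" using \<eta>(2) by linarith
  define j where "j = 1 - of_nat N * z"
  \<comment> \<open>The hypothesis on Re z bounds the right-hand side by \<eta> y, so the image z' =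
    z / (1 - N z) has height at least 1/y.\<close>
  have j2: "(cmod j)\<^sup>2 = (real N)\<^sup>2 * ((Re z - 1 / real N)\<^sup>2 + \<eta>\<^sup>2)"
  proof -
    have "Re j = - (real N * (Re z - 1 / real N))" "Im j = - (real N * \<eta>)"
      using Np(1) by (simp_all add: j_def \<eta>_def right_diff_distrib)
    thus ?thesis by (simp only: cmod_power2 power2_minus power_mult_distrib distrib_left)
  qed
  have "(Re z - 1 / real N)\<^sup>2 \<le> (y * \<eta> / real N)\<^sup>2"
    using power_mono[OF z(2), of 2] by (simp add: \<eta>_def)
  hence "(cmod j)\<^sup>2 \<le> (real N)\<^sup>2 * ((y * \<eta> / real N)\<^sup>2 + \<eta>\<^sup>2)" unfolding j2 by (intro mult_left_mono) auto
  also have "\<dots> = \<eta> * (\<eta> * ((real N)\<^sup>2 + y\<^sup>2))" using Np(1) by (simp add: power2_eq_square field_simps)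
  finally have j_le: "(cmod j)\<^sup>2 \<le> \<eta> * y" by (simp only: \<eta>(2))
  have "\<eta>\<^sup>2 \<le> (real N)\<^sup>2 * \<eta>\<^sup>2" using N \<eta>(1) by auto
  also have "\<dots> \<le> (cmod j)\<^sup>2" unfolding j2 by (intro mult_left_mono) auto
  finally have "\<eta>\<^sup>2 \<le> (cmod j)\<^sup>2" .
  from power2_le_imp_le[OF this] have j_ge: "\<eta> \<le> cmod j" by simp
  hence j0: "j \<noteq> 0" using \<eta>(1) by auto
  define z' where "z' = (of_int 1 * z + of_int 0) / (of_int (- int N) * z + of_int 1)"
  have fz': "f z' = j ^ k * f z"
    using transform[of 1 1 0 "- int N" z] \<eta>(1) by (simp add: z'_def \<eta>_def j_def)
  have "Im z' = \<eta> / (cmod j)\<^sup>2"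
    unfolding z'_def using Im_moebius[of "- int N" z 1 1 0] j0 by (simp add: j_def \<eta>_def)
  also have "\<dots> \<ge> \<eta> / (\<eta> * y)" using j_le \<eta>(1) y j0 by (intro divide_left_mono) auto
  finally have Im': "Im z' \<ge> 1 / y" using \<eta>(1) by simp
  have "1 / y \<ge> 1" using y by simp
  hence "Im z' \<ge> 1" using Im' by linarith
  hence "cmod (f z') \<le> C * exp (- (2 * pi * Im z'))" by (rule C(2))
  also have "\<dots> \<le> C * exp (- (2 * pi * (1 / y)))" 
  proof -
    have "2 * pi * (1 / y) \<le> 2 * pi * Im z'" using Im' by (intro mult_left_mono) auto
    thus ?thesis using C(1) by (intro mult_left_mono) auto
  qed
  finally have "cmod (f z) * cmod j ^ k \<le> C * exp (- (2 * pi * (1 / y)))"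
    by (simp add: fz' norm_mult norm_power mult.commute)
  moreover have "cmod j \<ge> y / 5" using \<open>y \<le> \<eta> * 5\<close> j_ge by simp
  hence "cmod j ^ k \<ge> (y / 5) ^ k" using y by (intro power_mono) auto
  hence "cmod (f z) * (y / 5) ^ k \<le> cmod (f z) * cmod j ^ k" by (rule mult_left_mono) simp
  ultimately have "cmod (f z) * (y / 5) ^ k \<le> C * exp (- (2 * pi * (1 / y)))" by linarith
  hence "cmod (f z) \<le> C * 5 ^ k * ((1 / y) ^ k * exp (- (2 * pi * (1 / y))))"
    using y by (simp add: power_divide field_simps)
  also have "\<dots> \<le> C * 5 ^ k * (fact (Suc k) / (1 / y))"
    using y C(1) by (intro mult_left_mono power_le_fact_exp_inverse) auto
  finally show ?thesis by simp
qed

section \<open>Vanishing of the boundary terms\<close>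

lemma tendsto_0_at_bot_exp:
  fixes D :: "real \<Rightarrow> complex"
  assumes "\<And>t. t \<le> 0 \<Longrightarrow> norm (D t) \<le> K * exp t"
  shows "(D \<longlongrightarrow> 0) at_bot"
proof (rule Lim_null_comparison)
  show "\<forall>\<^sub>F t in at_bot. norm (D t) \<le> K * exp t"
    using assms eventually_le_at_bot[of 0] by (rule eventually_mono[rotated])
  have "((\<lambda>t. K * exp t) \<longlongrightarrow> K * 0) at_bot" by (intro tendsto_mult tendsto_const exp_at_bot)
  thus "((\<lambda>t. K * exp t) \<longlongrightarrow> 0) at_bot" by simp
qed

lemma tendsto_0_at_top_exp:
  fixes D :: "real \<Rightarrow> complex"
  assumes "\<And>t. t \<ge> 0 \<Longrightarrow> norm (D t) \<le> K * exp (- t)"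
  shows "(D \<longlongrightarrow> 0) at_top"
proof (rule Lim_null_comparison)
  show "\<forall>\<^sub>F t in at_top. norm (D t) \<le> K * exp (- t)"
    using assms eventually_ge_at_top[of 0] by (rule eventually_mono[rotated])
  show "((\<lambda>t. K * exp (- t)) \<longlongrightarrow> 0) at_top" by real_asymp
qed

text \<open>Translating the two imaginary axes to \<open>Re z = -N\<close> and \<open>Re z = N\<close> and inverting turns the difference
  \<open>r(N) - r(-N)\<close> into the integral of \<open>f\<close> from \<open>-1/N\<close> to \<open>1/N\<close>, which is an integral over whole periods.\<close>

lemma trivial_zero_integral:
  fixes N :: nat
  assumes N: "N = 1 \<or> N = 2" and k: "k = w + 2" "even w"
  shows "(\<integral>t. f_axis t * of_real (exp t) *
      ((\<i> * of_real (exp t) - of_nat N) ^ w - (\<i> * of_real (exp t) + of_nat N) ^ w) \<partial>lborel) = 0"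
proof -
  obtain C where C: "C \<ge> 0" "\<And>z. Im z \<ge> 1 \<Longrightarrow> cmod (f z) \<le> C * exp (- (2 * pi * Im z))"
    using decay[of 1] by auto
  have hol: "(\<lambda>z. f z * z ^ w) holomorphic_on upper_half_plane" by (intro holomorphic_intros holo)
  have op: "open upper_half_plane" "convex upper_half_plane"
    unfolding upper_half_plane_def by (auto intro: open_halfspace_Im_gt convex_halfspace_Im_gt)
  obtain G where "\<And>z. z \<in> upper_half_plane \<Longrightarrow> (G has_field_derivative f z * z ^ w) (at z within upper_half_plane)"
    using holomorphic_convex_primitive'[OF op(2,1) hol] by blast
  hence G: "\<And>z. Im z > 0 \<Longrightarrow> (G has_field_derivative f z * z ^ w) (at z)"
    using op(1) by (metis at_within_open mem_Collect_eq upper_half_plane_def)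
  \<comment> \<open>Passing from G to H moves the lower ends -N and N of the two shifted axes to 1/N
    and -1/N, where the integrand is f alone and periodicity applies.\<close>
  define H where "H = (\<lambda>u. G (- 1 / u))"
  have H: "\<And>z. Im z > 0 \<Longrightarrow> (H has_field_derivative f z) (at z)"
    unfolding H_def by (rule invert_primitive[OF G k])
  define D where "D = (\<lambda>t. G (\<i> * of_real (exp t) - of_nat N) - G (\<i> * of_real (exp t) + of_nat N))"
  define d where "d = (\<lambda>t. f_axis t * of_real (exp t) *
      ((\<i> * of_real (exp t) - of_nat N) ^ w - (\<i> * of_real (exp t) + of_nat N) ^ w))"
  have deriv: "(D has_vector_derivative \<i> * d t) (at t)" for t
  proof -
    have f1: "f (\<i> * of_real (exp t) - of_nat N) = f_axis t" "f (\<i> * of_real (exp t) + of_nat N) = f_axis t"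
      using periodic[of "\<i> * of_real (exp t)" "- int N"] periodic[of "\<i> * of_real (exp t)" "int N"]
      by (simp_all add: f_axis_def)
    have e: "((\<lambda>t. \<i> * of_real (exp t) + c) has_vector_derivative \<i> * of_real (exp t)) (at t)" for c
      by (auto intro!: derivative_eq_intros simp: has_real_derivative_iff_has_vector_derivative[symmetric])
    have "((\<lambda>t. G (\<i> * of_real (exp t) + c)) has_vector_derivative
        \<i> * of_real (exp t) * (f (\<i> * of_real (exp t) + c) * (\<i> * of_real (exp t) + c) ^ w)) (at t)"
      if "Im c = 0" for c
      using field_vector_diff_chain_at[OF e G] that by (simp add: o_def)
    from has_vector_derivative_diff[OF this[of "- of_nat N"] this[of "of_nat N"]]
    show ?thesis using f1 by (simp add: D_def d_def algebra_simps)
  qed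
  have cont: "continuous_on UNIV d"
    unfolding d_def by (intro continuous_intros continuous_f_axis)
  have bot: "(D \<longlongrightarrow> 0) at_bot"
  proof (rule tendsto_0_at_bot_exp[where K = "2 * (C * 5 ^ k * fact (Suc k))"])
    fix t :: real assume t: "t \<le> 0"
    define y where "y = exp t"
    have y: "0 < y" "y \<le> 1" using t by (auto simp: y_def)
    define q where "q = (real N)\<^sup>2 + y\<^sup>2"
    have Np: "real N > 0" "(real N)\<^sup>2 \<ge> 1" using N by auto
    have q: "q > 0" "q \<ge> 1" using Np by (auto simp: q_def add_pos_nonneg add_increasing2)
    \<comment> \<open>The points -1/N and 1/N differ by 2/N, which is an integer exactly for N = 1
      and N = 2.\<close>
    define m where "m = (if N = 1 then 2 else 1 :: nat)"
    have m: "real m = 2 / real N" using N by (auto simp: m_def)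
    define u1 u0 where "u1 = Complex (real N / q) (y / q)" and "u0 = Complex (- (real N / q)) (y / q)"
    have inv: "- 1 / u1 = \<i> * of_real y - of_nat N" "- 1 / u0 = \<i> * of_real y + of_nat N"
    proof -
      have "u1 = (of_nat N + \<i> * of_real y) / of_real q" "u0 = (\<i> * of_real y - of_nat N) / of_real q"
        by (simp_all add: u1_def u0_def complex_eq_iff)
      moreover have "(of_nat N + \<i> * of_real y) * (\<i> * of_real y - of_nat N) = - of_real q"
        by (simp add: complex_eq_iff q_def power2_eq_square)
      moreover have "(\<i> * of_real y - of_nat N) * (\<i> * of_real y + of_nat N) = - of_real q"
        by (simp add: complex_eq_iff q_def power2_eq_square)
      ultimately have "u1 * (\<i> * of_real y - of_nat N) = - 1" "u0 * (\<i> * of_real y + of_nat N) = - 1"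
        using q(1) by simp_all
      moreover have "u1 \<noteq> 0" "u0 \<noteq> 0" using q(1) y by (auto simp: u1_def u0_def complex_eq_iff)
      ultimately show "- 1 / u1 = \<i> * of_real y - of_nat N" "- 1 / u0 = \<i> * of_real y + of_nat N"
        by (simp_all add: field_simps)
    qed
    have "D t = H u1 - H u0" unfolding D_def H_def inv by (simp add: y_def)
    also have "H u0 = H (u0 + of_nat m)"
      using primitive_periodic_nat[OF H, of u0 m] y q by (simp add: u0_def)
    finally have Dt: "D t = H u1 - H (u0 + of_nat m)" .
    \<comment> \<open>Thus \<open>u1\<close> and the translate of \<open>u0\<close> lie
      symmetrically on both sides of 1/N, at a distance of order y^2 and at height y / q, so the
      segment between them stays in the region covered by \<open>bound_near_cusp\<close>.\<close>
    have gap: "1 / real N - real N / q = y\<^sup>2 / (real N * q)"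
      using Np(1) q(1) by (simp add: q_def field_simps power2_eq_square)
    have "cmod (H u1 - H (u0 + of_nat m)) \<le> (C * 5 ^ k * fact (Suc k) * y) * cmod (u1 - (u0 + of_nat m))"
    proof (rule holomorphic_primitive_bound[OF H])
      show "Im u1 = y / q" "Im (u0 + of_nat m) = y / q" by (simp_all add: u1_def u0_def)
      show "y / q > 0" using y q by simp
      fix z assume z: "Im z = y / q" "z \<in> closed_segment u1 (u0 + of_nat m)"
      then obtain s where s: "0 \<le> s" "s \<le> 1" "z = (1 - s) *\<^sub>R u1 + s *\<^sub>R (u0 + of_nat m)"
        by (auto simp: in_segment)
      have "Re z - 1 / real N = (2 * s - 1) * (1 / real N - real N / q)"
        using m by (simp add: s(3) u1_def u0_def algebra_simps)
      hence "\<bar>Re z - 1 / real N\<bar> = \<bar>2 * s - 1\<bar> * (y\<^sup>2 / (real N * q))"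
        using Np(1) q(1) y by (simp add: gap abs_mult)
      also have "\<dots> \<le> 1 * (y\<^sup>2 / (real N * q))"
        using s Np(1) q(1) y by (intro mult_right_mono) auto
      also have "\<dots> = y * Im z / real N" by (simp add: z power2_eq_square)
      finally show "cmod (f z) \<le> C * 5 ^ k * fact (Suc k) * y"
        using z(1) by (intro bound_near_cusp[OF C N y]) (auto simp: q_def)
    qed
    also have "cmod (u1 - (u0 + of_nat m)) = \<bar>2 * (real N / q - 1 / real N)\<bar>"
    proof -
      have "u1 - (u0 + of_nat m) = of_real (2 * (real N / q - 1 / real N))"
        using m by (simp add: u1_def u0_def complex_eq_iff)
      thus ?thesis by (simp only: norm_of_real)
    qed
    also have "\<dots> \<le> 2"
    proof -
      have "0 \<le> y\<^sup>2 / (real N * q)" using Np(1) q(1) by simp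
      moreover have "y\<^sup>2 / (real N * q) \<le> 1"
      proof -
        have "y\<^sup>2 \<le> 1 * 1" using y by (simp add: power_le_one)
        also have "\<dots> \<le> real N * q" using N q(2) by (intro mult_mono) auto
        finally show ?thesis using Np(1) q(1) by simp
      qed
      moreover have "real N / q - 1 / real N = - (y\<^sup>2 / (real N * q))" using gap by linarith
      ultimately show ?thesis by (simp only: abs_le_iff) linarith
    qed
    finally have "cmod (H u1 - H (u0 + of_nat m)) \<le> C * 5 ^ k * fact (Suc k) * y * 2"
      using C(1) y by (simp add: mult_left_mono)
    thus "norm (D t) \<le> 2 * (C * 5 ^ k * fact (Suc k)) * exp t" by (simp add: Dt y_def mult_ac)
  qed
  have top: "(D \<longlongrightarrow> 0) at_top"
  proof (rule tendsto_0_at_top_exp[where K = "C * 3 ^ w * fact (Suc w) * 4"])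
    fix t :: real assume t: "t \<ge> 0"
    define y where "y = exp t"
    have y: "y \<ge> 1" using t by (simp add: y_def)
    have "cmod (D t) \<le> (C * 3 ^ w * (fact (Suc w) / y)) * cmod ((\<i> * of_real y - of_nat N) - (\<i> * of_real y + of_nat N))"
      unfolding D_def y_def[symmetric]
    proof (rule holomorphic_primitive_bound[OF G])
      show "Im (\<i> * of_real y - of_nat N) = y" "Im (\<i> * of_real y + of_nat N) = y" "y > 0" using y by auto
      fix z assume z: "Im z = y" "z \<in> closed_segment (\<i> * of_real y - of_nat N) (\<i> * of_real y + of_nat N)"
      then obtain s where s: "0 \<le> s" "s \<le> 1" "z = (1 - s) *\<^sub>R (\<i> * of_real y - of_nat N) + s *\<^sub>R (\<i> * of_real y + of_nat N)"
        by (auto simp: in_segment)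
      have "Re z = (2 * s - 1) * real N" by (simp add: s(3) algebra_simps)
      hence "\<bar>Re z\<bar> \<le> 1 * real N" using s by (simp only: abs_mult) (intro mult_mono, auto)
      hence "\<bar>Re z\<bar> \<le> 2 * y" using N y by auto
      hence "cmod z \<le> 3 * y" using cmod_le[of z] z(1) y by simp
      hence "cmod z ^ w \<le> (3 * y) ^ w" by (rule power_mono) simp
      hence "cmod (z ^ w) \<le> 3 ^ w * y ^ w" by (simp only: norm_power power_mult_distrib)
      moreover have "cmod (f z) \<le> C * exp (- (2 * pi * y))" using C(2)[of z] z(1) y by simp
      ultimately have "cmod (f z * z ^ w) \<le> (C * exp (- (2 * pi * y))) * (3 ^ w * y ^ w)"
        unfolding norm_mult using C(1) by (intro mult_mono) auto
      also have "\<dots> = C * 3 ^ w * (y ^ w * exp (- (2 * pi * y)))" by simp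
      also have "\<dots> \<le> C * 3 ^ w * (fact (Suc w) / y)"
        using y C(1) by (intro mult_left_mono power_le_fact_exp_inverse) auto
      finally show "cmod (f z * z ^ w) \<le> C * 3 ^ w * (fact (Suc w) / y)" .
    qed
    moreover have "cmod ((\<i> * of_real y - of_nat N) - (\<i> * of_real y + of_nat N)) \<le> 4"
      using N by auto
    moreover have "0 \<le> C * 3 ^ w * (fact (Suc w) / y)" using C(1) y by simp
    ultimately have "cmod (D t) \<le> (C * 3 ^ w * (fact (Suc w) / y)) * 4"
      by (meson mult_left_mono order_trans)
    thus "norm (D t) \<le> C * 3 ^ w * fact (Suc w) * 4 * exp (- t)" by (simp add: y_def exp_minus field_simps)
  qed
  have int: "integrable lborel d"
  proof (rule Bochner_Integration.integrable_bound)
    show "integrable lborel (\<lambda>t. 2 * 3 ^ w * (norm (f_axis t) * exp (real (w + 1) * \<bar>t\<bar>)))"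
      by (intro integrable_mult_right integrable_f_axis_exp_abs)
    show "d \<in> borel_measurable lborel" using borel_measurable_continuous_onI[OF cont] by simp
    have "norm (d t) \<le> 2 * 3 ^ w * (norm (f_axis t) * exp (real (w + 1) * \<bar>t\<bar>))" for t
    proof -
      have N2: "real N \<le> 2" using N by auto
      have e: "exp t \<le> exp \<bar>t\<bar>" "1 \<le> exp \<bar>t\<bar>" by auto
      have b: "norm ((\<i> * of_real (exp t) + c) ^ w) \<le> 3 ^ w * exp \<bar>t\<bar> ^ w" if "norm c = real N" for c
      proof -
        have "norm (\<i> * of_real (exp t) + c) \<le> norm (\<i> * of_real (exp t)) + norm c" by (rule norm_triangle_ineq)
        also have "\<dots> = exp t + real N" using that by (simp add: norm_mult)
        also have "\<dots> \<le> 3 * exp \<bar>t\<bar>" using e N2 by linarith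
        finally have "norm (\<i> * of_real (exp t) + c) ^ w \<le> (3 * exp \<bar>t\<bar>) ^ w" by (rule power_mono) simp
        thus ?thesis by (simp only: norm_power power_mult_distrib)
      qed
      have "norm ((\<i> * of_real (exp t) - of_nat N) ^ w - (\<i> * of_real (exp t) + of_nat N) ^ w) \<le>
         3 ^ w * exp \<bar>t\<bar> ^ w + 3 ^ w * exp \<bar>t\<bar> ^ w"
        using b[of "- of_nat N"] b[of "of_nat N"] by (intro order.trans[OF norm_triangle_ineq4] add_mono) auto
      hence "norm (d t) \<le> (norm (f_axis t) * exp \<bar>t\<bar>) * (2 * 3 ^ w * exp \<bar>t\<bar> ^ w)"
        unfolding d_def norm_mult using e by (intro mult_mono) auto
      also have "\<dots> = 2 * 3 ^ w * (norm (f_axis t) * exp (real (w + 1) * \<bar>t\<bar>))"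
        by (simp add: exp_of_nat_mult distrib_right exp_add)
      finally show ?thesis .
    qed
    thus "AE t in lborel. norm (d t) \<le> norm (2 * 3 ^ w * (norm (f_axis t) * exp (real (w + 1) * \<bar>t\<bar>)))"
      by (intro AE_I2) (auto intro: order.trans[OF _ abs_ge_self])
  qed
  have "(LBINT t=-\<infinity>..\<infinity>. \<i> * d t) = 0 - 0"
  proof (rule interval_integral_FTC_integrable[where F = D])
    show "(D has_vector_derivative \<i> * d t) (at t)" for t by (rule deriv)
    show "isCont (\<lambda>t. \<i> * d t) t" for t
      using cont by (intro continuous_intros) (auto simp: continuous_on_eq_continuous_at)
    show "set_integrable lborel (einterval (- \<infinity>) \<infinity>) (\<lambda>t. \<i> * d t)"
      using int by (simp add: set_integrable_def einterval_def)
    show "((D \<circ> real_of_ereal) \<longlongrightarrow> 0) (at_right (- \<infinity>))" unfolding ereal_tendsto_simps1 by (rule bot)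
    show "((D \<circ> real_of_ereal) \<longlongrightarrow> 0) (at_left \<infinity>)" unfolding ereal_tendsto_simps1 by (rule top)
  qed simp
  hence "(\<integral>t. d t \<partial>lborel) = 0"
    by (simp add: interval_lebesgue_integral_def einterval_def set_lebesgue_integral_def)
  thus ?thesis by (simp add: d_def)
qed

end

section \<open>Self-inversive polynomials on the unit circle\<close>

text \<open>A self-inversive polynomial is, on the unit circle, twice the real part of a rotated half \<open>q\<close> of it.
  If \<open>V\<close> (which is \<open>q\<close> divided by \<open>(Y - 1) Y\<close>) stays in the right half plane then the argument of the rotated
  half changes by \<open>(m - 3) \<pi>\<close> along the circle, which forces zeros.\<close>

definition half_coeffs :: "nat \<Rightarrow> (nat \<Rightarrow> real) \<Rightarrow> nat \<Rightarrow> real" where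
  "half_coeffs m p i = (if 2 * i < m then p i else if 2 * i = m then p i / 2 else 0)"

text \<open>(Y^i - 1) / ((Y - 1) Y) is written as a geometric sum, which also makes sense at Y = 1;
  the total is the quotient of q when the coefficients of q add up to 0. The shift of the
  frequencies by one is the division by Y.\<close>

definition reduced_half :: "nat \<Rightarrow> (nat \<Rightarrow> real) \<Rightarrow> real \<Rightarrow> complex" where
  "reduced_half m q \<alpha> = (\<Sum>i\<le>m. of_real (q i) * (\<Sum>l<i. cis ((real l - 1) * \<alpha>)))"

lemma palindromic_eq_half_coeffs:
  assumes pal: "\<And>i. i \<le> m \<Longrightarrow> p (m - i) = p i" and "i \<le> m"
  shows "p i = half_coeffs m p i + half_coeffs m p (m - i)"
proof -
  consider "2 * i < m" | "2 * i = m" | "2 * i > m" by linarith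
  thus ?thesis
  proof cases
    case 1
    hence "2 * (m - i) > m" by linarith
    with 1 show ?thesis by (simp add: half_coeffs_def)
  next
    case 2
    hence "m - i = i" by simp
    with 2 show ?thesis by (simp add: half_coeffs_def)
  next
    case 3
    hence "2 * (m - i) < m" using assms(2) by linarith
    with 3 pal[OF assms(2)] show ?thesis by (simp add: half_coeffs_def)
  qed
qed

lemma sum_half_coeffs:
  assumes "\<And>i. i \<le> m \<Longrightarrow> p (m - i) = p i" "(\<Sum>i\<le>m. p i) = 0"
  shows "(\<Sum>i\<le>m. half_coeffs m p i) = 0"
proof -
  have "0 = (\<Sum>i\<le>m. half_coeffs m p i + half_coeffs m p (m - i))"
    using assms(2) by (simp add: palindromic_eq_half_coeffs[where p = p and m = m, OF assms(1)] cong: sum.cong_simp)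
  also have "\<dots> = (\<Sum>i\<le>m. half_coeffs m p i) + (\<Sum>i\<le>m. half_coeffs m p (m - i))" by (rule sum.distrib)
  also have "(\<Sum>i\<le>m. half_coeffs m p (m - i)) = (\<Sum>i\<le>m. half_coeffs m p i)"
    by (rule sum.reindex_bij_witness[of _ "\<lambda>i. m - i" "\<lambda>i. m - i"]) auto
  finally show ?thesis by simp
qed

lemma cis_geometric_shift: "(cis \<alpha> - 1) * cis \<alpha> * (\<Sum>l<i. cis ((real l - 1) * \<alpha>)) = cis (real i * \<alpha>) - 1"
proof -
  have "cis \<alpha> * (\<Sum>l<i. cis ((real l - 1) * \<alpha>)) = (\<Sum>l<i. cis \<alpha> ^ l)"
    unfolding sum_distrib_left by (intro sum.cong refl) (simp only: cis_mult Complex.DeMoivre, simp add: algebra_simps)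
  hence "(cis \<alpha> - 1) * cis \<alpha> * (\<Sum>l<i. cis ((real l - 1) * \<alpha>)) = (cis \<alpha> - 1) * (\<Sum>l<i. cis \<alpha> ^ l)"
    by (simp add: mult.assoc)
  also have "\<dots> = cis \<alpha> ^ i - 1"
    by (simp add: power_diff_1_eq)
  finally show ?thesis by (simp add: Complex.DeMoivre)
qed

lemma half_sum_eq_reduced_half:
  assumes "(\<Sum>i\<le>m. q i) = 0"
  shows "(\<Sum>i\<le>m. of_real (q i) * cis (real i * \<alpha>)) = (cis \<alpha> - 1) * cis \<alpha> * reduced_half m q \<alpha>"
proof -
  have "(cis \<alpha> - 1) * cis \<alpha> * reduced_half m q \<alpha> =
     (\<Sum>i\<le>m. of_real (q i) * ((cis \<alpha> - 1) * cis \<alpha> * (\<Sum>l<i. cis ((real l - 1) * \<alpha>))))"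
    unfolding reduced_half_def sum_distrib_left by (simp add: mult_ac)
  also have "\<dots> = (\<Sum>i\<le>m. of_real (q i) * cis (real i * \<alpha>)) - (\<Sum>i\<le>m. of_real (q i))"
    unfolding cis_geometric_shift by (simp add: algebra_simps sum_subtractf)
  also have "(\<Sum>i\<le>m. complex_of_real (q i)) = 0" unfolding of_real_sum[symmetric] assms by simp
  finally show ?thesis by simp
qed

text \<open>With Y = cis \<alpha> and c = Y^(m/2) the palindrome is Q + Y^m cnj Q = 2 c Re (cnj c
  Q). The factor (Y - 1) Y of Q equals 2 i sin (\<alpha>/2) Y^(3/2), whence the frequency (m - 3) /
  2.\<close>

lemma self_inversive_on_circle:
  assumes pal: "\<And>i. i \<le> m \<Longrightarrow> p (m - i) = p i" and sum0: "(\<Sum>i\<le>m. p i) = 0"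
  shows "(\<Sum>i\<le>m. of_real (p i) * cis (real i * \<alpha>)) =
    cis (real m * \<alpha> / 2) * of_real (- 4 * sin (\<alpha> / 2) *
      Im (cis (- ((real m - 3) * \<alpha> / 2)) * reduced_half m (half_coeffs m p) \<alpha>))"
proof -
  define q where "q = half_coeffs m p"
  define V where "V = reduced_half m q \<alpha>"
  define Q where "Q = (\<Sum>i\<le>m. of_real (q i) * cis (real i * \<alpha>))"
  define c where "c = cis (real m * \<alpha> / 2)"
  have q0: "(\<Sum>i\<le>m. q i) = 0" unfolding q_def by (rule sum_half_coeffs[OF pal sum0])
  have "(\<Sum>i\<le>m. of_real (p i) * cis (real i * \<alpha>)) =
    (\<Sum>i\<le>m. of_real (q i) * cis (real i * \<alpha>) + of_real (q (m - i)) * cis (real i * \<alpha>))"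
    by (intro sum.cong refl) (simp add: palindromic_eq_half_coeffs[where p = p and m = m, OF pal] q_def algebra_simps)
  also have "\<dots> = Q + (\<Sum>i\<le>m. of_real (q (m - i)) * cis (real i * \<alpha>))" by (simp add: sum.distrib Q_def)
  also have "(\<Sum>i\<le>m. of_real (q (m - i)) * cis (real i * \<alpha>)) = (\<Sum>i\<le>m. of_real (q i) * cis (real (m - i) * \<alpha>))"
    by (rule sum.reindex_bij_witness[of _ "\<lambda>i. m - i" "\<lambda>i. m - i"]) auto
  also have "\<dots> = c * c * cnj Q"
  proof -
    have "cis (real (m - i) * \<alpha>) = c * c * cnj (cis (real i * \<alpha>))" if "i \<le> m" for i
      using that by (simp add: c_def cis_mult cis_cnj of_nat_diff algebra_simps)
    thus ?thesis unfolding Q_def cnj_sum sum_distrib_left by (intro sum.cong refl) (simp add: mult_ac)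
  qed
  also have "Q + c * c * cnj Q = c * of_real (2 * Re (cnj c * Q))"
  proof -
    have cc: "c * cnj c = 1" by (simp add: c_def cis_cnj cis_mult)
    have "c * of_real (2 * Re (cnj c * Q)) = c * (cnj c * Q + cnj (cnj c * Q))"
      by (simp only: complex_add_cnj)
    also have "\<dots> = (c * cnj c) * Q + c * c * cnj Q" by (simp add: algebra_simps)
    finally show ?thesis by (simp add: cc)
  qed
  also have "cnj c * Q = of_real (2 * sin (\<alpha> / 2)) * (\<i> * (cis (- ((real m - 3) * \<alpha> / 2)) * V))"
  proof -
    have "cis \<alpha> - 1 = cis (\<alpha> / 2) * (cis (\<alpha> / 2) - cis (- (\<alpha> / 2)))"
      by (simp add: right_diff_distrib cis_mult)
    also have "cis (\<alpha> / 2) - cis (- (\<alpha> / 2)) = of_real (2 * sin (\<alpha> / 2)) * \<i>" by (simp add: complex_eq_iff)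
    finally have e: "cis \<alpha> - 1 = cis (\<alpha> / 2) * (of_real (2 * sin (\<alpha> / 2)) * \<i>)" .
    have "cnj c * Q = (cnj c * cis (\<alpha> / 2) * cis \<alpha>) * (of_real (2 * sin (\<alpha> / 2)) * \<i> * V)"
      unfolding Q_def half_sum_eq_reduced_half[OF q0] V_def[symmetric] e by (simp add: mult_ac)
    also have "cnj c * cis (\<alpha> / 2) * cis \<alpha> = cis (- ((real m - 3) * \<alpha> / 2))"
      by (simp add: c_def cis_cnj cis_mult) (simp add: algebra_simps add_divide_distrib diff_divide_distrib)
    finally show ?thesis by (simp add: mult_ac)
  qed
  also have "2 * Re (of_real (2 * sin (\<alpha> / 2)) * (\<i> * (cis (- ((real m - 3) * \<alpha> / 2)) * V))) =
    - 4 * sin (\<alpha> / 2) * Im (cis (- ((real m - 3) * \<alpha> / 2)) * V)"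
  proof -
    have "2 * Re (of_real (2 * u) * (\<i> * x)) = - 4 * u * Im x" for u x by simp
    thus ?thesis .
  qed
  finally show ?thesis by (simp only: V_def q_def c_def)
qed

text \<open>The phase \<Phi> is continuous because V avoids the negative axis. At both ends Y = 1
  and V is a positive real number, so \<Phi> runs from 0 to (m - 3) pi and takes each value j pi
  with 0 < j < m - 3 in between.\<close>

lemma zeros_on_circle:
  assumes pal: "\<And>i. i \<le> m \<Longrightarrow> p (m - i) = p i" and sum0: "(\<Sum>i\<le>m. p i) = 0" and m: "m \<ge> 4"
    and pos: "\<And>\<alpha>. Re (reduced_half m (half_coeffs m p) \<alpha>) > 0"
  obtains S where "finite S" "card S = m - 4" "S \<subseteq> {0<..<2 * pi}"
    "\<And>\<alpha>. \<alpha> \<in> S \<Longrightarrow> (\<Sum>i\<le>m. of_real (p i) * cis (real i * \<alpha>)) = 0"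
proof -
  define V where "V = reduced_half m (half_coeffs m p)"
  have Vpos: "Re (V \<alpha>) > 0" for \<alpha> using pos by (simp add: V_def)
  have Vnr: "V \<alpha> \<notin> \<real>\<^sub>\<le>\<^sub>0" for \<alpha> using Vpos[of \<alpha>] by (auto simp: complex_nonpos_Reals_iff)
  have contV: "continuous_on UNIV V"
    unfolding V_def reduced_half_def by (intro continuous_intros)
  define \<Phi> where "\<Phi> = (\<lambda>\<alpha>. (real m - 3) * \<alpha> / 2 - Arg (V \<alpha>))"
  have cont: "continuous_on S \<Phi>" for S
    unfolding \<Phi>_def
    by (intro continuous_intros continuous_on_subset[OF contV]) (use Vnr in auto)
  have V_real: "V \<alpha> \<in> \<real>" if "sin \<alpha> = 0" "cos \<alpha> = 1" for \<alpha>
  proof -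
    have "cis \<alpha> = 1" using that by (simp add: complex_eq_iff)
    hence "cis (real l * \<alpha>) = 1" for l :: nat by (simp only: Complex.DeMoivre[symmetric] power_one)
    moreover have "cis ((real l - 1) * \<alpha>) = cis (real l * \<alpha>) * cis (- \<alpha>)" for l by (simp add: cis_mult algebra_simps)
    moreover have "cis (- \<alpha>) = 1" using that by (simp add: complex_eq_iff)
    ultimately show ?thesis unfolding V_def reduced_half_def by (auto intro!: sum_in_Reals Reals_mult)
  qed
  have Arg0: "Arg (V \<alpha>) = 0" if "sin \<alpha> = 0" "cos \<alpha> = 1" for \<alpha>
    using V_real[OF that] Vpos[of \<alpha>] by (auto simp: Arg_eq_0 elim!: Reals_cases)
  have ends: "\<Phi> 0 = 0" "\<Phi> (2 * pi) = (real m - 3) * pi"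
    unfolding \<Phi>_def using Arg0[of 0] Arg0[of "2 * pi"] by auto
  have "\<exists>\<alpha>. 0 < \<alpha> \<and> \<alpha> < 2 * pi \<and> \<Phi> \<alpha> = real j * pi" if "j \<in> {1..m - 4}" for j
  proof -
    have j: "0 < real j * pi" "real j * pi < (real m - 3) * pi"
      using that m by (auto intro!: mult_strict_right_mono)
    have "\<exists>\<alpha>\<ge>0. \<alpha> \<le> 2 * pi \<and> \<Phi> \<alpha> = real j * pi"
      by (rule IVT'[OF _ _ _ cont]) (use j ends in auto)
    then obtain \<alpha> where \<alpha>: "0 \<le> \<alpha>" "\<alpha> \<le> 2 * pi" "\<Phi> \<alpha> = real j * pi" by blast
    have "\<alpha> \<noteq> 0" "\<alpha> \<noteq> 2 * pi" using \<alpha>(3) j ends by auto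
    with \<alpha> show ?thesis by (intro exI[of _ \<alpha>]) auto
  qed
  then obtain \<alpha> where \<alpha>: "\<And>j. j \<in> {1..m - 4} \<Longrightarrow> 0 < \<alpha> j \<and> \<alpha> j < 2 * pi \<and> \<Phi> (\<alpha> j) = real j * pi" by metis
  show thesis
  proof (rule that[of "\<alpha> ` {1..m - 4}"])
    have "inj_on \<alpha> {1..m - 4}"
    proof (rule inj_onI)
      fix i j assume "i \<in> {1..m - 4}" "j \<in> {1..m - 4}" "\<alpha> i = \<alpha> j"
      hence "real i * pi = real j * pi" using \<alpha> by metis
      thus "i = j" by simp
    qed
    thus "card (\<alpha> ` {1..m - 4}) = m - 4" by (simp add: card_image)
    show "\<alpha> ` {1..m - 4} \<subseteq> {0<..<2 * pi}" using \<alpha> by auto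
    fix \<beta> assume "\<beta> \<in> \<alpha> ` {1..m - 4}"
    then obtain j where j: "\<beta> = \<alpha> j" "j \<in> {1..m - 4}" by auto
    have "cis (- ((real m - 3) * \<beta> / 2)) * V \<beta> = of_real (cmod (V \<beta>)) * cis (- \<Phi> \<beta>)"
    proof -
      have "V \<beta> = of_real (cmod (V \<beta>)) * cis (Arg (V \<beta>))" using rcis_cmod_Arg[of "V \<beta>"] by (simp add: rcis_def)
      hence "cis (- ((real m - 3) * \<beta> / 2)) * V \<beta> =
          of_real (cmod (V \<beta>)) * (cis (- ((real m - 3) * \<beta> / 2)) * cis (Arg (V \<beta>)))"
        by (metis mult.left_commute)
      also have "cis (- ((real m - 3) * \<beta> / 2)) * cis (Arg (V \<beta>)) = cis (- \<Phi> \<beta>)"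
        by (simp add: cis_mult \<Phi>_def)
      finally show ?thesis .
    qed
    also have "\<Phi> \<beta> = real j * pi" using \<alpha>[OF j(2)] j(1) by simp
    finally have im: "Im (cis (- ((real m - 3) * \<beta> / 2)) * V \<beta>) = 0" by simp
    show "(\<Sum>i\<le>m. of_real (p i) * cis (real i * \<beta>)) = 0"
      using self_inversive_on_circle[where p = p and m = m and \<alpha> = \<beta>, OF pal sum0]
      unfolding V_def[symmetric] im by simp
  qed simp
qed

section \<open>Comparison with the sine series\<close>

definition sin_coeff2 :: "nat \<Rightarrow> real" where
  "sin_coeff2 i = (- 1) ^ i * (2 * pi) ^ (2 * i + 1) / fact (2 * i + 1)"

text \<open>Rounded values of \<open>sin_coeff2\<close>. The entry at \<open>0\<close> is irrelevant because it enters with weight \<open>0\<close>.\<close>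

definition approx_coeff :: "nat \<Rightarrow> real" where
  "approx_coeff i = (if i < 9 then [0, -2067/50, 408/5, -767/10, 2103/50, -151/10, 191/50, -18/25, 1/10] ! i else 0)"

section \<open>Numerical bounds for the sine coefficients\<close>

lemma two_pi_power_bounds:
  "(6.28318 :: real) ^ n \<le> (2 * pi) ^ n" "(2 * pi) ^ n \<le> 6.2832 ^ n"
proof -
  have "6.28318 \<le> 2 * pi" "2 * pi \<le> 6.2832" using pi_approx by simp_all
  thus "(6.28318 :: real) ^ n \<le> (2 * pi) ^ n" "(2 * pi) ^ n \<le> 6.2832 ^ n"
    by (intro power_mono; simp)+
qed

lemma sin_coeff2_approx:
  assumes "(b - e) * fact (2 * i + 1) \<le> 6.28318 ^ (2 * i + 1)" "6.2832 ^ (2 * i + 1) \<le> (b + e) * fact (2 * i + 1)"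
  shows "\<bar>sin_coeff2 i - (- 1) ^ i * b\<bar> \<le> e"
proof -
  have "(b - e) * fact (2 * i + 1) \<le> (2 * pi) ^ (2 * i + 1)" "(2 * pi) ^ (2 * i + 1) \<le> (b + e) * fact (2 * i + 1)"
    using assms two_pi_power_bounds[of "2 * i + 1"] by linarith+
  hence "b - e \<le> (2 * pi) ^ (2 * i + 1) / fact (2 * i + 1)" "(2 * pi) ^ (2 * i + 1) / fact (2 * i + 1) \<le> b + e"
    by (simp_all only: le_divide_eq divide_le_eq fact_gt_zero if_True)
  hence "\<bar>(2 * pi) ^ (2 * i + 1) / fact (2 * i + 1) - b\<bar> \<le> e" by linarith
  moreover have "sin_coeff2 i - (- 1) ^ i * b = (- 1) ^ i * ((2 * pi) ^ (2 * i + 1) / fact (2 * i + 1) - b)"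
    by (simp add: sin_coeff2_def right_diff_distrib)
  ultimately show ?thesis by (simp only: abs_mult power_abs abs_minus_cancel abs_one power_one mult_1)
qed

lemma approx_coeff_error:
  "\<bar>sin_coeff2 1 - approx_coeff 1\<bar> \<le> 1/500"
  "\<bar>sin_coeff2 2 - approx_coeff 2\<bar> \<le> 63/10000"
  "\<bar>sin_coeff2 3 - approx_coeff 3\<bar> \<le> 9/1250"
  "\<bar>sin_coeff2 4 - approx_coeff 4\<bar> \<le> 17/10000"
  "\<bar>sin_coeff2 5 - approx_coeff 5\<bar> \<le> 11/2000"
  "\<bar>sin_coeff2 6 - approx_coeff 6\<bar> \<le> 1/10000"
  "\<bar>sin_coeff2 7 - approx_coeff 7\<bar> \<le> 19/10000"
  "\<bar>sin_coeff2 8 - approx_coeff 8\<bar> \<le> 43/10000"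
  using sin_coeff2_approx[of "2067/50" "1/500" 1]
    sin_coeff2_approx[of "408/5" "63/10000" 2]
    sin_coeff2_approx[of "767/10" "9/1250" 3]
    sin_coeff2_approx[of "2103/50" "17/10000" 4]
    sin_coeff2_approx[of "151/10" "11/2000" 5]
    sin_coeff2_approx[of "191/50" "1/10000" 6]
    sin_coeff2_approx[of "18/25" "19/10000" 7]
    sin_coeff2_approx[of "1/10" "43/10000" 8]
  by (simp_all add: approx_coeff_def fact_numeral power_divide)

text \<open>With N = n + 9 consecutive terms have the ratio (2 pi)^2 / (2 N (2 N + 3)), at most 40 /
  378 < 1/8; the first term is just below 11/100.\<close>

lemma sin_coeff2_tail: "real (n + 9) * \<bar>sin_coeff2 (n + 9)\<bar> \<le> 11 / 100 * (1 / 8) ^ n"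
proof (induction n)
  case 0
  show ?case using two_pi_power_bounds[of 19]
    by (simp add: sin_coeff2_def fact_numeral abs_mult power_divide field_simps)
next
  case (Suc n)
  define N where "N = real n + 9"
  have N: "N \<ge> 9" by (simp add: N_def)
  have e: "\<bar>sin_coeff2 i\<bar> = (2 * pi) ^ (2 * i + 1) / fact (2 * i + 1)" for i
    by (simp add: sin_coeff2_def abs_mult)
  have "\<bar>sin_coeff2 (Suc (n + 9))\<bar> = \<bar>sin_coeff2 (n + 9)\<bar> * ((2 * pi)\<^sup>2 / ((2 * N + 3) * (2 * N + 2)))"
  proof -
    define x J where "x = 2 * pi" and "J = 2 * (n + 9) + 1"
    have J: "2 * Suc (n + 9) + 1 = Suc (Suc J)" by (simp add: J_def)
    have F: "fact (Suc (Suc J)) = (2 * N + 3) * ((2 * N + 2) * (fact J :: real))"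
      by (simp only: fact_Suc) (simp add: N_def J_def algebra_simps)
    show ?thesis unfolding e J J_def[symmetric] x_def[symmetric] F by (simp add: power2_eq_square mult_ac)
  qed
  hence "real (Suc n + 9) * \<bar>sin_coeff2 (Suc n + 9)\<bar> = (N * \<bar>sin_coeff2 (n + 9)\<bar>) * ((N + 1) * (2 * pi)\<^sup>2 / (N * ((2 * N + 3) * (2 * N + 2))))"
    using N by (simp add: N_def)
  also have "(N + 1) * (2 * pi)\<^sup>2 / (N * ((2 * N + 3) * (2 * N + 2))) \<le> 1 / 8"
  proof -
    have "(2 * pi)\<^sup>2 \<le> 40" using two_pi_power_bounds(2)[of 2] by (simp add: power_divide)
    moreover have "320 \<le> 2 * N * (2 * N + 3)" using mult_mono[of 18 "2 * N" 21 "2 * N + 3"] N by simp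
    ultimately have "8 * (2 * pi)\<^sup>2 \<le> 2 * N * (2 * N + 3)" by linarith
    moreover have "N * ((2 * N + 3) * (2 * N + 2)) = (N + 1) * (2 * N * (2 * N + 3))" by (simp add: algebra_simps)
    ultimately show ?thesis using N by (simp only: mult_divide_mult_cancel_left_if) (simp add: divide_le_eq)
  qed
  hence "(N * \<bar>sin_coeff2 (n + 9)\<bar>) * ((N + 1) * (2 * pi)\<^sup>2 / (N * ((2 * N + 3) * (2 * N + 2)))) \<le> (N * \<bar>sin_coeff2 (n + 9)\<bar>) * (1 / 8)"
    using N by (intro mult_left_mono) auto
  also have "\<dots> \<le> (11 / 100 * (1 / 8) ^ n) * (1 / 8)" using Suc by (intro mult_right_mono) (simp_all add: N_def)
  finally show ?case by simp
qed

lemma sum_lessThan_add: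
  fixes f :: "nat \<Rightarrow> 'a :: comm_monoid_add"
  shows "(\<Sum>i<k + m. f i) = (\<Sum>i<k. f i) + (\<Sum>n<m. f (n + k))"
  by (induction m) (simp_all add: add_ac)

text \<open>The weight i is the length of the inner sum in \<open>reduced_half\<close>. Indices
  below 9 contribute at most 297/2500 = 0.1188, the tail at most 11/100 times 8/7, about
  0.126.\<close>

lemma approx_coeff_total_error:
  "(\<Sum>i\<le>m. real i * \<bar>sin_coeff2 i - approx_coeff i\<bar>) \<le> 1 / 4"
proof -
  have tail: "real (n + 9) * \<bar>sin_coeff2 (n + 9) - approx_coeff (n + 9)\<bar> \<le> 11 / 100 * (1 / 8) ^ n" for n
    using sin_coeff2_tail[of n] by (simp add: approx_coeff_def)
  have "(\<Sum>i\<le>m. real i * \<bar>sin_coeff2 i - approx_coeff i\<bar>) \<le> (\<Sum>i<9 + m. real i * \<bar>sin_coeff2 i - approx_coeff i\<bar>)"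
    by (intro sum_mono2) auto
  also have "\<dots> = (\<Sum>i<9. real i * \<bar>sin_coeff2 i - approx_coeff i\<bar>) + (\<Sum>n<m. real (n + 9) * \<bar>sin_coeff2 (n + 9) - approx_coeff (n + 9)\<bar>)"
    by (rule sum_lessThan_add)
  also have "(\<Sum>n<m. real (n + 9) * \<bar>sin_coeff2 (n + 9) - approx_coeff (n + 9)\<bar>) \<le> (\<Sum>n<m. 11 / 100 * (1 / 8) ^ n)"
    by (intro sum_mono tail)
  also have "\<dots> = 11 / 100 * ((1 - (1 / 8) ^ m) / (1 - 1 / 8))" 
    unfolding sum_distrib_left[symmetric] sum_gp_strict by simp
  also have "\<dots> \<le> 11 / 100 * (8 / 7)" by simp
  also have "(\<Sum>i<9. real i * \<bar>sin_coeff2 i - approx_coeff i\<bar>) \<le> 297 / 2500"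
    using approx_coeff_error by (simp add: eval_nat_numeral)
  finally show ?thesis by simp
qed

lemma approx_trig_poly_lower_bound:
  assumes "8 \<le> m"
  shows "4 / 5 \<le> (\<Sum>i\<le>m. approx_coeff i * (\<Sum>l<i. cos ((real l - 1) * \<alpha>)))"
proof -
  define c where "c = cos \<alpha>"
  have c: "\<bar>c\<bar> \<le> 1" by (simp add: c_def)
  have step: "cos (real (Suc (Suc n)) * \<alpha>) = 2 * c * cos (real (Suc n) * \<alpha>) - cos (real n * \<alpha>)" for n
  proof -
    define A where "A = real (Suc n) * \<alpha>"
    have e: "real (Suc (Suc n)) * \<alpha> = A + \<alpha>" "real n * \<alpha> = A - \<alpha>" by (simp_all add: A_def algebra_simps)
    show ?thesis unfolding e A_def[symmetric] c_def by (simp add: cos_add cos_diff)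
  qed
  have cos_n: "cos (2 * \<alpha>) = 2 * c\<^sup>2 - 1" "cos (3 * \<alpha>) = 4 * c ^ 3 - 3 * c"
     "cos (4 * \<alpha>) = 8 * c ^ 4 - 8 * c\<^sup>2 + 1" "cos (5 * \<alpha>) = 16 * c ^ 5 - 20 * c ^ 3 + 5 * c"
     "cos (6 * \<alpha>) = 32 * c ^ 6 - 48 * c ^ 4 + 18 * c\<^sup>2 - 1"
  proof -
    show 2: "cos (2 * \<alpha>) = 2 * c\<^sup>2 - 1" using step[of 0] by (simp add: c_def power2_eq_square)
    have 1: "cos \<alpha> = c" by (simp add: c_def)
    have s3: "cos (3 * \<alpha>) = 2 * c * cos (2 * \<alpha>) - c" using step[of 1] 1 by simp
    show 3: "cos (3 * \<alpha>) = 4 * c ^ 3 - 3 * c" unfolding s3 2 by (simp add: eval_nat_numeral algebra_simps)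
    have s4: "cos (4 * \<alpha>) = 2 * c * cos (3 * \<alpha>) - cos (2 * \<alpha>)" using step[of 2] by simp
    show 4: "cos (4 * \<alpha>) = 8 * c ^ 4 - 8 * c\<^sup>2 + 1" unfolding s4 2 3 by (simp add: eval_nat_numeral algebra_simps)
    have s5: "cos (5 * \<alpha>) = 2 * c * cos (4 * \<alpha>) - cos (3 * \<alpha>)" using step[of 3] by simp
    show 5: "cos (5 * \<alpha>) = 16 * c ^ 5 - 20 * c ^ 3 + 5 * c" unfolding s5 3 4 by (simp add: eval_nat_numeral algebra_simps)
    have s6: "cos (6 * \<alpha>) = 2 * c * cos (5 * \<alpha>) - cos (4 * \<alpha>)" using step[of 4] by simp
    show "cos (6 * \<alpha>) = 32 * c ^ 6 - 48 * c ^ 4 + 18 * c\<^sup>2 - 1" unfolding s6 4 5 by (simp add: eval_nat_numeral algebra_simps)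
  qed
  have "(\<Sum>i\<le>m. approx_coeff i * (\<Sum>l<i. cos ((real l - 1) * \<alpha>))) = (\<Sum>i\<le>8. approx_coeff i * (\<Sum>l<i. cos ((real l - 1) * \<alpha>)))"
    using assms by (intro sum.mono_neutral_right) (auto simp: approx_coeff_def)
  also have "\<dots> = 1753/50 - 2641/50 * cos \<alpha> + 754/25 * cos (2 * \<alpha>) - 119/10 * cos (3 * \<alpha>) + 16/5 * cos (4 * \<alpha>)
      - 31/50 * cos (5 * \<alpha>) + 1/10 * cos (6 * \<alpha>)"
    by (simp add: approx_coeff_def eval_nat_numeral lessThan_Suc field_simps)
  also have "\<dots> = 8 - 1011/50 * c + 913/25 * c\<^sup>2 - 176/5 * c ^ 3 + 104/5 * c ^ 4 - 248/25 * c ^ 5 + 16/5 * c ^ 6"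
    unfolding cos_n c_def[symmetric] by (simp add: field_simps)
  \<comment> \<open>As a polynomial in c = cos \<alpha> the coefficients alternate in sign, so for c
    <= 0 every term is nonnegative and the constant 8 suffices.\<close>
  also have "\<dots> \<ge> 4 / 5"
  proof (cases "c \<ge> 0")
    case False
    hence "c \<le> 0" "c ^ 3 \<le> 0" "c ^ 5 \<le> 0" by (auto simp: power_le_zero_eq)
    moreover have "c\<^sup>2 \<ge> 0" "c ^ 4 \<ge> 0" "c ^ 6 \<ge> 0" by auto
    ultimately show ?thesis by linarith
  next
    case True
    have sq: "A + B * c + C * c\<^sup>2 \<ge> 0" if "A > 0" "B\<^sup>2 \<le> 4 * A * C" for A B C :: real
    proof -
      have "4 * A * (A + B * c + C * c\<^sup>2) = (2 * A + B * c)\<^sup>2 + (4 * A * C - B\<^sup>2) * c\<^sup>2"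
        by (simp add: power2_eq_square algebra_simps)
      also have "\<dots> \<ge> 0" using that(2) by simp
      finally show ?thesis using that(1) by (simp add: zero_le_mult_iff)
    qed
    \<comment> \<open>After setting 4/5 aside, the polynomial is q1 + c^2 q2 + c^4 q3 with
      quadratics q1, q2, q3, according to 8 = 0.8 + 7.2, 36.52 = 14.3 + 22.22 and 20.8 = 14 + 6.8.
      The first two have negative discriminants; the third is positive on [0, 1], but only by 0.08
      at c = 1.\<close>
    have 1: "7.2 + (- 20.22) * c + 14.3 * c\<^sup>2 \<ge> 0" by (rule sq) (simp_all add: power2_eq_square)
    have 2: "22.22 + (- 35.2) * c + 14 * c\<^sup>2 \<ge> 0" by (rule sq) (simp_all add: power2_eq_square)
    have 3: "6.8 - 9.92 * c + 3.2 * c\<^sup>2 \<ge> 0"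
    proof -
      have "(1 - c) * (6.72 - 3.2 * c) \<ge> 0" using c True by (intro mult_nonneg_nonneg) auto
      moreover have "6.8 - 9.92 * c + 3.2 * c\<^sup>2 = (1 - c) * (6.72 - 3.2 * c) + 0.08"
        by (simp add: power2_eq_square field_simps)
      ultimately show ?thesis by simp
    qed
    have "c\<^sup>2 * (22.22 + (- 35.2) * c + 14 * c\<^sup>2) \<ge> 0" "c ^ 4 * (6.8 - 9.92 * c + 3.2 * c\<^sup>2) \<ge> 0"
      using 2 3 by (auto intro!: mult_nonneg_nonneg)
    with 1 show ?thesis by (simp add: eval_nat_numeral algebra_simps)
  qed
  finally show ?thesis .
qed

text \<open>The rounded trigonometric polynomial is at least 4/5; rounding costs at most 1/4 and the
  deviation of q from the sine coefficients at most 1/2, since an inner sum of i cosines is at most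
  i.\<close>

lemma Re_reduced_half_pos:
  assumes "8 \<le> m" "(\<Sum>i\<le>m. real i * \<bar>q i - sin_coeff2 i\<bar>) \<le> 1 / 2"
  shows "Re (reduced_half m q \<alpha>) > 0"
proof -
  let ?T = "\<lambda>i. \<Sum>l<i. cos ((real l - 1) * \<alpha>)"
  have T: "\<bar>?T i\<bar> \<le> real i" for i
    using order.trans[OF sum_abs sum_bounded_above[of "{..<i}" "\<lambda>l. \<bar>cos ((real l - 1) * \<alpha>)\<bar>" 1]] by simp
  have "(\<Sum>i\<le>m. approx_coeff i * ?T i) - (\<Sum>i\<le>m. q i * ?T i) = (\<Sum>i\<le>m. (approx_coeff i - q i) * ?T i)"
    by (simp add: sum_subtractf algebra_simps)
  also have "\<dots> \<le> (\<Sum>i\<le>m. real i * \<bar>q i - sin_coeff2 i\<bar> + real i * \<bar>sin_coeff2 i - approx_coeff i\<bar>)"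
  proof (rule sum_mono)
    fix i
    have "(approx_coeff i - q i) * ?T i \<le> \<bar>approx_coeff i - q i\<bar> * \<bar>?T i\<bar>"
      by (metis abs_ge_self abs_mult)
    also have "\<dots> \<le> (\<bar>q i - sin_coeff2 i\<bar> + \<bar>sin_coeff2 i - approx_coeff i\<bar>) * real i"
      by (intro mult_mono T) auto
    finally show "(approx_coeff i - q i) * ?T i \<le> real i * \<bar>q i - sin_coeff2 i\<bar> + real i * \<bar>sin_coeff2 i - approx_coeff i\<bar>"
      by (simp add: algebra_simps)
  qed
  also have "\<dots> \<le> 1 / 2 + 1 / 4"
    unfolding sum.distrib by (intro add_mono assms approx_coeff_total_error)
  finally have "(\<Sum>i\<le>m. approx_coeff i * ?T i) - (\<Sum>i\<le>m. q i * ?T i) \<le> 3 / 4" by simp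
  moreover have "Re (reduced_half m q \<alpha>) = (\<Sum>i\<le>m. q i * ?T i)"
    by (simp add: reduced_half_def)
  ultimately show ?thesis using approx_trig_poly_lower_bound[OF assms(1), of \<alpha>] by linarith
qed

section \<open>Distance of the half polynomial from the sine series\<close>

lemma sum_even_exp_terms_le:
  fixes x :: real
  assumes "x \<ge> 0"
  shows "(\<Sum>i\<le>m. x ^ (2 * i) / fact (2 * i)) \<le> exp x"
proof -
  have s: "(\<lambda>n. x ^ n / fact n) sums exp x" using exp_converges[of x] by (simp add: field_simps)
  have "(\<Sum>i\<le>m. x ^ (2 * i) / fact (2 * i)) = (\<Sum>n\<in>(*) 2 ` {..m}. x ^ n / fact n)"
    by (subst sum.reindex) (auto simp: inj_on_def)
  also have "\<dots> \<le> suminf (\<lambda>n. x ^ n / fact n)"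
    using assms s by (intro sum_le_suminf) (auto simp: sums_iff)
  finally show ?thesis using s by (simp add: sums_iff)
qed

text \<open>The factor 3^(2i+1) replaces 2 pi by 6 pi in the sine coefficient, and i / (2i + 1) <=
  1/2 absorbs the weight.\<close>

lemma weighted_sin_coeff2_le:
  "real i * \<bar>sin_coeff2 i\<bar> * 3 ^ (2 * i + 1) \<le> 3 * pi * ((6 * pi) ^ (2 * i) / fact (2 * i))"
proof -
  define x where "x = 6 * pi"
  have "\<bar>sin_coeff2 i\<bar> * 3 ^ (2 * i + 1) = x ^ (2 * i + 1) / fact (2 * i + 1)"
  proof -
    have "\<bar>sin_coeff2 i\<bar> = (2 * pi) ^ (2 * i + 1) / fact (2 * i + 1)" by (simp add: sin_coeff2_def abs_mult)
    moreover have "x ^ (2 * i + 1) = (2 * pi) ^ (2 * i + 1) * 3 ^ (2 * i + 1)"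
      unfolding power_mult_distrib[symmetric] x_def by simp
    ultimately show ?thesis by simp
  qed
  also have "\<dots> = (x / real (2 * i + 1)) * (x ^ (2 * i) / fact (2 * i))" by (simp add: mult_ac)
  finally have "real i * \<bar>sin_coeff2 i\<bar> * 3 ^ (2 * i + 1) = (real i / real (2 * i + 1)) * (x * (x ^ (2 * i) / fact (2 * i)))"
    by (simp add: mult.assoc)
  also have "\<dots> \<le> (1 / 2) * (x * (x ^ (2 * i) / fact (2 * i)))"
    by (intro mult_right_mono) (auto simp: x_def field_simps)
  finally show ?thesis by (simp add: x_def mult_ac)
qed

text \<open>The cubic bound for central L-values loses against (3/2)^h: from h = 40 on, one step
  increases the cubic by a factor of at most 3/2.\<close>

lemma central_factor_growth:
  assumes "h \<ge> (40::nat)"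
  shows "(1 + 4 * (real h + 2) ^ 3) * (27 * 2 ^ h) \<le> 16 * 3 ^ h"
  using assms
proof (induction h rule: dec_induct)
  case base
  show ?case by simp
next
  case (step n)
  define H where "H = real n + 2"
  have H: "H \<ge> 42" using step by (simp add: H_def)
  have sq: "H * H \<ge> 42 * H" using H by (intro mult_right_mono) auto
  have "H * (H * H) \<ge> 42 * (H * H)" using H by (intro mult_right_mono) auto
  moreover have "3 * (1 + 4 * H ^ 3) - 2 * (1 + 4 * (H + 1) ^ 3) = 4 * (H * (H * H)) - 24 * (H * H) - 24 * H - 7"
    by (simp add: power3_eq_cube algebra_simps)
  ultimately have "2 * (1 + 4 * (H + 1) ^ 3) \<le> 3 * (1 + 4 * H ^ 3)"
    using sq H by linarith
  hence "(2 * (1 + 4 * (H + 1) ^ 3)) * (27 * 2 ^ n) \<le> (3 * (1 + 4 * H ^ 3)) * (27 * 2 ^ n)"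
    by (rule mult_right_mono) simp
  also have "\<dots> = 3 * ((1 + 4 * H ^ 3) * (27 * 2 ^ n))" by (simp only: mult.assoc)
  also have "\<dots> \<le> 3 * (16 * 3 ^ n)" using step.IH unfolding H_def by (rule mult_left_mono) simp
  finally have "(2 * (1 + 4 * (H + 1) ^ 3)) * (27 * 2 ^ n) \<le> 3 * (16 * 3 ^ n)" .
  moreover have "real (Suc n) + 2 = H + 1" by (simp add: H_def)
  moreover have "(1 + 4 * (H + 1) ^ 3) * (27 * 2 ^ Suc n) = (2 * (1 + 4 * (H + 1) ^ 3)) * (27 * 2 ^ n)" by simp
  moreover have "16 * 3 ^ Suc n = 3 * (16 * 3 ^ n :: real)" by simp
  ultimately show ?case by (simp only:)
qed

lemma exp_6pi_bound: "3 * pi * exp (6 * pi) \<le> 2 ^ 35"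
proof -
  have p: "6 * pi \<le> 19" "pi \<le> 4" using pi_approx by auto
  have "exp (6 * pi) \<le> exp (19 :: real)" using p by simp
  also have "\<dots> = exp 1 ^ 19" using exp_of_nat_mult[of 19 "1::real"] by simp
  also have "\<dots> \<le> (272 / 100) ^ 19" using e_less_272 by (intro power_mono) auto
  also have "\<dots> \<le> 2 ^ 31" by (simp add: power_divide)
  finally have "3 * pi * exp (6 * pi) \<le> (3 * 4) * 2 ^ 31" using p by (intro mult_mono) auto
  thus ?thesis by simp
qed

text \<open>One bound, (16 / 2^h) 3^(2i+1) times the sine coefficient, covers all i. For small i the
  L-value deviates from 1 by a multiple of 2^(2i) / 2^h; near the middle the gap between the bases 2
  and 3 pays for the cubic loss; beyond it, where the half polynomial is cut off, already 3^(2i+1)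
  >= 2^h.\<close>

lemma half_coeffs_error:
  fixes L :: "nat \<Rightarrow> real"
  assumes h: "h \<ge> 40"
    and L1: "\<And>N. N \<ge> h + 3 \<Longrightarrow> \<bar>L N - 1\<bar> \<le> 4 / 2 ^ (N - h - 1)"
    and L2: "\<And>N. h \<le> N \<Longrightarrow> N \<le> h + 2 \<Longrightarrow> \<bar>L N\<bar> \<le> 4 * (real h + 2) ^ 3"
  defines "p \<equiv> \<lambda>i. sin_coeff2 i * L (2 * h - 2 - 2 * i)"
  shows "(\<Sum>i\<le>h - 2. real i * \<bar>half_coeffs (h - 2) p i - sin_coeff2 i\<bar>) \<le> 1 / 2"
proof -
  have b: "\<bar>half_coeffs (h - 2) p i - sin_coeff2 i\<bar> \<le> 16 / 2 ^ h * (\<bar>sin_coeff2 i\<bar> * 3 ^ (2 * i + 1))" for i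
  proof -
    define N where "N = 2 * h - 2 - 2 * i"
    consider "2 * i + 5 \<le> h" | "h \<le> 2 * i + 4" "2 * i + 2 \<le> h" | "h < 2 * i + 2" by linarith
    thus ?thesis
    proof cases
      case 1
      have N: "N \<ge> h + 3" "N - h - 1 + (2 * i + 3) = h" using 1 by (auto simp: N_def)
      have "half_coeffs (h - 2) p i = sin_coeff2 i * L N" using 1 by (simp add: half_coeffs_def p_def N_def)
      hence "half_coeffs (h - 2) p i - sin_coeff2 i = sin_coeff2 i * (L N - 1)" by (simp add: algebra_simps)
      hence "\<bar>half_coeffs (h - 2) p i - sin_coeff2 i\<bar> = \<bar>sin_coeff2 i\<bar> * \<bar>L N - 1\<bar>" by (simp only: abs_mult)
      also have "\<dots> \<le> \<bar>sin_coeff2 i\<bar> * (4 / 2 ^ (N - h - 1))" using L1[OF N(1)] by (rule mult_left_mono) simp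
      also have "4 / 2 ^ (N - h - 1) = (16 / 2 ^ h :: real) * 2 ^ (2 * i + 1)"
      proof -
        have "(2 :: real) ^ h = 2 ^ (N - h - 1) * 2 ^ (2 * i + 3)" unfolding power_add[symmetric] N(2) ..
        thus ?thesis by (simp add: power_add power3_eq_cube)
      qed
      also have "\<bar>sin_coeff2 i\<bar> * ((16 / 2 ^ h) * 2 ^ (2 * i + 1)) \<le> \<bar>sin_coeff2 i\<bar> * ((16 / 2 ^ h) * 3 ^ (2 * i + 1))"
        by (intro mult_left_mono power_mono) auto
      finally show ?thesis by (simp add: mult_ac)
    next
      case 2
      have N: "h \<le> N" "N \<le> h + 2" using 2 h by (auto simp: N_def)
      have "\<bar>half_coeffs (h - 2) p i\<bar> \<le> \<bar>p i\<bar>" by (simp add: half_coeffs_def)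
      also have "\<dots> = \<bar>sin_coeff2 i\<bar> * \<bar>L N\<bar>" by (simp add: p_def N_def abs_mult)
      also have "\<dots> \<le> \<bar>sin_coeff2 i\<bar> * (4 * (real h + 2) ^ 3)" using L2[OF N] by (rule mult_left_mono) simp
      finally have "\<bar>half_coeffs (h - 2) p i - sin_coeff2 i\<bar> \<le> \<bar>sin_coeff2 i\<bar> * (1 + 4 * (real h + 2) ^ 3)"
        by (simp add: algebra_simps)
      also have "1 + 4 * (real h + 2) ^ 3 \<le> 16 / 2 ^ h * 3 ^ (2 * i + 1)"
      proof -
        have "(3::real) ^ h \<le> 3 ^ (2 * i + 4)" using 2 by (intro power_increasing) auto
        also have "\<dots> = 27 * 3 ^ (2 * i + 1)" by (simp add: power_add)
        finally have "(1 + 4 * (real h + 2) ^ 3) * (27 * 2 ^ h) \<le> 16 * (27 * 3 ^ (2 * i + 1))"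
          using central_factor_growth[OF h] by linarith
        thus ?thesis by (simp add: field_simps)
      qed
      hence "\<bar>sin_coeff2 i\<bar> * (1 + 4 * (real h + 2) ^ 3) \<le> \<bar>sin_coeff2 i\<bar> * (16 / 2 ^ h * 3 ^ (2 * i + 1))"
        by (rule mult_left_mono) simp
      finally show ?thesis by (simp add: mult_ac)
    next
      case 3
      hence "\<not> 2 * i < h - 2" "2 * i \<noteq> h - 2" using h by linarith+
      hence "half_coeffs (h - 2) p i = 0" by (simp add: half_coeffs_def)
      hence "\<bar>half_coeffs (h - 2) p i - sin_coeff2 i\<bar> = \<bar>sin_coeff2 i\<bar> * 1" by simp
      also have "(1::real) \<le> 16 / 2 ^ h * 3 ^ (2 * i + 1)"
      proof -
        have "(2::real) ^ h \<le> 3 ^ h" by (intro power_mono) auto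
        also have "\<dots> \<le> 3 ^ (2 * i + 1)" using 3 by (intro power_increasing) auto
        finally have "(2::real) ^ h \<le> 3 ^ (2 * i + 1)" .
        moreover have "(0::real) \<le> 3 ^ (2 * i + 1)" by simp
        ultimately have "(2::real) ^ h \<le> 16 * 3 ^ (2 * i + 1)" by linarith
        thus ?thesis by (simp add: field_simps)
      qed
      hence "\<bar>sin_coeff2 i\<bar> * 1 \<le> \<bar>sin_coeff2 i\<bar> * (16 / 2 ^ h * 3 ^ (2 * i + 1))" by (rule mult_left_mono) simp
      finally show ?thesis by (simp add: mult_ac)
    qed
  qed
  have "(\<Sum>i\<le>h - 2. real i * \<bar>half_coeffs (h - 2) p i - sin_coeff2 i\<bar>) \<le>
      (\<Sum>i\<le>h - 2. 16 / 2 ^ h * (3 * pi * ((6 * pi) ^ (2 * i) / fact (2 * i))))"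
  proof (rule sum_mono)
    fix i
    have "real i * \<bar>half_coeffs (h - 2) p i - sin_coeff2 i\<bar> \<le> real i * (16 / 2 ^ h * (\<bar>sin_coeff2 i\<bar> * 3 ^ (2 * i + 1)))"
      using b by (rule mult_left_mono) simp
    also have "\<dots> = 16 / 2 ^ h * (real i * \<bar>sin_coeff2 i\<bar> * 3 ^ (2 * i + 1))" by (simp add: mult_ac)
    also have "\<dots> \<le> 16 / 2 ^ h * (3 * pi * ((6 * pi) ^ (2 * i) / fact (2 * i)))"
      by (intro mult_left_mono weighted_sin_coeff2_le) auto
    finally show "real i * \<bar>half_coeffs (h - 2) p i - sin_coeff2 i\<bar> \<le> 16 / 2 ^ h * (3 * pi * ((6 * pi) ^ (2 * i) / fact (2 * i)))" .
  qed
  also have "\<dots> = 16 / 2 ^ h * (3 * pi * (\<Sum>i\<le>h - 2. (6 * pi) ^ (2 * i) / fact (2 * i)))"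
    by (simp only: sum_distrib_left)
  also have "\<dots> \<le> 16 / 2 ^ h * (3 * pi * exp (6 * pi))"
    by (intro mult_left_mono sum_even_exp_terms_le) auto
  also have "\<dots> \<le> 16 / 2 ^ h * 2 ^ 35"
    by (intro mult_left_mono exp_6pi_bound) auto
  \<comment> \<open>16 times 2^35 / 2^40 is exactly 1/2: the threshold h >= 40 is calibrated
    here.\<close>
  also have "\<dots> \<le> 16 / 2 ^ 40 * 2 ^ 35"
    using h by (intro mult_right_mono divide_left_mono power_increasing) auto
  finally show ?thesis by simp
qed

lemma circle_zeros:
  fixes L :: "nat \<Rightarrow> real"
  assumes h: "h \<ge> 40"
    and L1: "\<And>N. N \<ge> h + 3 \<Longrightarrow> \<bar>L N - 1\<bar> \<le> 4 / 2 ^ (N - h - 1)"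
    and L2: "\<And>N. h \<le> N \<Longrightarrow> N \<le> h + 2 \<Longrightarrow> \<bar>L N\<bar> \<le> 4 * (real h + 2) ^ 3"
    and p: "\<And>i. p i = sin_coeff2 i * L (2 * h - 2 - 2 * i)"
    and pal: "\<And>i. i \<le> h - 2 \<Longrightarrow> p (h - 2 - i) = p i"
    and sum0: "(\<Sum>i\<le>h - 2. p i) = 0"
  obtains S where "finite S" "card S = h - 6" "S \<subseteq> {0<..<2 * pi}"
    "\<And>\<alpha>. \<alpha> \<in> S \<Longrightarrow> (\<Sum>i\<le>h - 2. of_real (p i) * cis (real i * \<alpha>)) = 0"
proof -
  have "p = (\<lambda>i. sin_coeff2 i * L (2 * h - 2 - 2 * i))" using p by auto
  hence "(\<Sum>i\<le>h - 2. real i * \<bar>half_coeffs (h - 2) p i - sin_coeff2 i\<bar>) \<le> 1 / 2"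
    using half_coeffs_error[OF h L1 L2] by simp
  hence pos: "Re (reduced_half (h - 2) (half_coeffs (h - 2) p) \<alpha>) > 0" for \<alpha>
    using h by (intro Re_reduced_half_pos) auto
  have "h - 2 - 4 = h - 6" "4 \<le> h - 2" using h by auto
  with zeros_on_circle[where p = p and m = "h - 2", OF pal sum0 _ pos] that show thesis by metis
qed

section \<open>Counting zeros\<close>

lemma order_ge_2I:
  fixes p :: "complex poly"
  assumes "degree p > 0" "poly p z = 0" "poly (pderiv p) z = 0"
  shows "order z p \<ge> 2"
proof -
  have p0: "p \<noteq> 0" "pderiv p \<noteq> 0" using assms(1) by (auto simp: pderiv_eq_0_iff)
  have "order z (pderiv p) \<noteq> 0" using assms p0 by (auto simp: order_root)
  thus ?thesis using order_pderiv[OF p0(1) assms(2)] by simp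
qed

lemma poly_odd_sum:
  fixes c :: "nat \<Rightarrow> complex"
  shows "poly (\<Sum>i\<le>m. monom (c i) (2 * i + 1)) z = z * (\<Sum>i\<le>m. c i * (z\<^sup>2) ^ i)"
proof -
  have e: "c i * z ^ (2 * i + 1) = z * (c i * (z\<^sup>2) ^ i)" for i
  proof -
    have "z ^ (2 * i + 1) = z * (z\<^sup>2) ^ i" using power_mult[of z 2 i] by simp
    thus ?thesis by simp
  qed
  show ?thesis by (simp only: poly_sum poly_monom e sum_distrib_left)
qed

lemma poly_pderiv_odd_sum:
  fixes c :: "nat \<Rightarrow> complex"
  shows "poly (pderiv (\<Sum>i\<le>m. monom (c i) (2 * i + 1))) z = (\<Sum>i\<le>m. of_nat (2 * i + 1) * c i * (z\<^sup>2) ^ i)"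
proof -
  have "pderiv (\<Sum>i\<le>m. monom (c i) (2 * i + 1)) = (\<Sum>i\<le>m. pderiv (monom (c i) (2 * i + 1)))"
    using higher_pderiv_sum[of 1] by simp
  also have "\<dots> = (\<Sum>i\<le>m. monom (of_nat (2 * i + 1) * c i) (2 * i))"
    by (simp only: pderiv_monom add_diff_cancel_right')
  finally show ?thesis by (simp only: poly_sum poly_monom power_mult)
qed

lemma degree_odd_sum:
  fixes c :: "nat \<Rightarrow> complex"
  assumes "c m \<noteq> 0"
  shows "degree (\<Sum>i\<le>m. monom (c i) (2 * i + 1)) = 2 * m + 1"
proof (rule antisym)
  show "degree (\<Sum>i\<le>m. monom (c i) (2 * i + 1)) \<le> 2 * m + 1"
    by (intro degree_sum_le) (auto intro: order.trans[OF degree_monom_le])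
  have "coeff (\<Sum>i\<le>m. monom (c i) (2 * i + 1)) (2 * m + 1) = (\<Sum>i\<le>m. if i = m then c i else 0)"
    by (simp add: coeff_sum coeff_monom)
  also have "\<dots> = c m" by (simp add: sum.delta)
  finally show "2 * m + 1 \<le> degree (\<Sum>i\<le>m. monom (c i) (2 * i + 1))"
    using assms by (intro le_degree) simp
qed

text \<open>P(1/y) = P(y) / y^m for a palindrome; this carries the zero Y = 4 over to Y =
  1/4.\<close>

lemma palindromic_sum_inverse_point:
  fixes p :: "nat \<Rightarrow> real"
  assumes pal: "\<And>i. i \<le> m \<Longrightarrow> p (m - i) = p i" and y: "y \<noteq> 0" and "(\<Sum>i\<le>m. p i * y ^ i) = 0"
  shows "(\<Sum>i\<le>m. p i * (1 / y) ^ i) = 0"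
proof -
  have "(\<Sum>i\<le>m. p i * (1 / y) ^ i) = (\<Sum>i\<le>m. p (m - i) * (1 / y) ^ (m - i))"
    by (rule sum.reindex_bij_witness[of _ "\<lambda>i. m - i" "\<lambda>i. m - i"]) auto
  also have "\<dots> = (\<Sum>i\<le>m. p i * y ^ i / y ^ m)"
    using y pal by (intro sum.cong refl) (simp add: power_diff power_divide field_simps)
  also have "\<dots> = 0" using assms(3) by (simp add: sum_divide_distrib[symmetric])
  finally show ?thesis .
qed

text \<open>Reflecting i to m - i shows that twice the sum of i p(i) is m times the sum of p(i).
  Hence the derivative of X P(X^2) vanishes at X = 1 and X = -1 along with the polynomial: these
  zeros are at least double.\<close>

lemma palindromic_derivative_zero:
  fixes p :: "nat \<Rightarrow> real"
  assumes pal: "\<And>i. i \<le> m \<Longrightarrow> p (m - i) = p i" and "(\<Sum>i\<le>m. p i) = 0"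
  shows "(\<Sum>i\<le>m. real (2 * i + 1) * p i) = 0"
proof -
  have "(\<Sum>i\<le>m. real i * p i) = (\<Sum>i\<le>m. real (m - i) * p (m - i))"
    by (rule sum.reindex_bij_witness[of _ "\<lambda>i. m - i" "\<lambda>i. m - i"]) auto
  also have "\<dots> = (\<Sum>i\<le>m. real m * p i - real i * p i)"
    using pal by (intro sum.cong refl) (simp add: of_nat_diff algebra_simps)
  also have "\<dots> = real m * (\<Sum>i\<le>m. p i) - (\<Sum>i\<le>m. real i * p i)"
    by (simp add: sum_subtractf sum_distrib_left)
  finally have "(\<Sum>i\<le>m. real i * p i) = 0" using assms(2) by simp
  moreover have "(\<Sum>i\<le>m. real (2 * i + 1) * p i) = 2 * (\<Sum>i\<le>m. real i * p i) + (\<Sum>i\<le>m. p i)"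
    by (simp add: sum_distrib_left sum.distrib[symmetric] algebra_simps)
  ultimately show ?thesis using assms(2) by simp
qed

text \<open>The zeros exhibited below already account for the full degree, so all their multiplicities are exact.\<close>

lemma period_poly_zeros:
  fixes p :: "nat \<Rightarrow> real" and K :: complex
  assumes pal: "\<And>i. i \<le> m \<Longrightarrow> p (m - i) = p i"
    and sum1: "(\<Sum>i\<le>m. p i) = 0" and sum4: "(\<Sum>i\<le>m. p i * 4 ^ i) = 0"
    and K: "K \<noteq> 0" and p0: "p 0 \<noteq> 0" and m: "m \<ge> 4"
    and S: "finite S" "card S = m - 4" "S \<subseteq> {0<..<2 * pi}"
      "\<And>\<alpha>. \<alpha> \<in> S \<Longrightarrow> (\<Sum>i\<le>m. of_real (p i) * cis (real i * \<alpha>)) = 0"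
    and r: "r = (\<Sum>i\<le>m. monom (K * of_real (p i)) (2 * i + 1))"
  shows "degree r = 2 * m + 1 \<and>
     size {#z \<in># proots r. cmod z \<noteq> 1#} = 5 \<and>
     {z. poly r z = 0 \<and> cmod z \<noteq> 1} = {0, 2, -2, 1/2, -1/2} \<and>
     (\<forall>z\<in>{0, 2, -2, 1/2, -1/2}. order z r = 1) \<and>
     order 1 r = 2 \<and> order (-1) r = 2"
proof -
  define P where "P = (\<lambda>y::complex. \<Sum>i\<le>m. of_real (p i) * y ^ i)"
  have ev: "poly r z = K * z * P (z\<^sup>2)" for z
    unfolding r poly_odd_sum P_def by (simp add: sum_distrib_left mult_ac)
  have pm: "p m \<noteq> 0" using pal[of 0] p0 by simp
  have deg: "degree r = 2 * m + 1" unfolding r using K pm by (intro degree_odd_sum) simp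
  have r0: "r \<noteq> 0" using deg by auto
  have P_real: "P (of_real y) = of_real (\<Sum>i\<le>m. p i * y ^ i)" for y by (simp add: P_def)
  have P1: "P 1 = 0" using P_real[of 1] sum1 by simp
  have P4: "P 4 = 0" using P_real[of 4] sum4 by simp
  have "P (of_real (1 / 4)) = 0"
    unfolding P_real using palindromic_sum_inverse_point[where p = p and m = m, OF pal _ sum4] by simp
  hence P14: "P (1 / 4) = 0" by simp
  have pd: "poly (pderiv r) z = 0" if "z\<^sup>2 = 1" for z
  proof -
    have "poly (pderiv r) z = (\<Sum>i\<le>m. K * of_real (real (2 * i + 1) * p i))"
      unfolding r poly_pderiv_odd_sum that by (intro sum.cong refl) simp
    also have "\<dots> = K * of_real (\<Sum>i\<le>m. real (2 * i + 1) * p i)" by (simp only: sum_distrib_left of_real_sum)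
    also have "(\<Sum>i\<le>m. real (2 * i + 1) * p i) = 0"
      by (rule palindromic_derivative_zero[where p = p and m = m, OF pal sum1])
    finally show ?thesis by simp
  qed
  \<comment> \<open>Every zero cis \<alpha> in Y has two square roots in X. As 0 < \<alpha>/2 < pi,
    one lies above and the other below the real axis, so the two families are disjoint.\<close>
  define Z where "Z = (\<lambda>\<alpha>. cis (\<alpha> / 2)) ` S \<union> (\<lambda>\<alpha>. - cis (\<alpha> / 2)) ` S"
  have Im_pos: "Im (cis (\<alpha> / 2)) > 0" if "\<alpha> \<in> S" for \<alpha>
    using that S(3) by (auto intro!: sin_gt_zero)
  have inj: "inj_on (\<lambda>\<alpha>. cis (\<alpha> / 2)) S"
  proof (rule inj_onI)
    fix \<alpha> \<beta> assume *: "\<alpha> \<in> S" "\<beta> \<in> S" "cis (\<alpha> / 2) = cis (\<beta> / 2)"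
    have "cos (\<alpha> / 2) = cos (\<beta> / 2)" using *(3) by (simp add: complex_eq_iff)
    moreover have "0 < \<alpha>" "\<alpha> < 2 * pi" "0 < \<beta>" "\<beta> < 2 * pi"
      using subsetD[OF S(3) *(1)] subsetD[OF S(3) *(2)] by auto
    ultimately have "\<alpha> / 2 = \<beta> / 2" by - (rule cos_inj_pi, auto)
    thus "\<alpha> = \<beta>" by simp
  qed
  have inj': "inj_on (\<lambda>\<alpha>. - cis (\<alpha> / 2)) S" using inj by (auto simp: inj_on_def)
  have finZ: "finite Z" using S(1) by (simp add: Z_def)
  have cardZ: "card Z = 2 * (m - 4)"
  proof -
    have "(\<lambda>\<alpha>. cis (\<alpha> / 2)) ` S \<inter> (\<lambda>\<alpha>. - cis (\<alpha> / 2)) ` S = {}"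
    proof (rule equals0I)
      fix z assume "z \<in> (\<lambda>\<alpha>. cis (\<alpha> / 2)) ` S \<inter> (\<lambda>\<alpha>. - cis (\<alpha> / 2)) ` S"
      then obtain \<alpha> \<beta> where "\<alpha> \<in> S" "\<beta> \<in> S" "z = cis (\<alpha> / 2)" "z = - cis (\<beta> / 2)" by blast
      hence "Im (cis (\<alpha> / 2)) = - Im (cis (\<beta> / 2))" by (metis uminus_complex.sel(2))
      with Im_pos[OF \<open>\<alpha> \<in> S\<close>] Im_pos[OF \<open>\<beta> \<in> S\<close>] show False by linarith
    qed
    thus ?thesis unfolding Z_def using S(1,2) card_image[OF inj] card_image[OF inj'] by (subst card_Un_disjoint) auto
  qed
  have Z: "poly r z = 0" "cmod z = 1" "Im z \<noteq> 0" if z: "z \<in> Z" for z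
  proof -
    from z obtain \<alpha> where \<alpha>: "\<alpha> \<in> S" "z = cis (\<alpha> / 2) \<or> z = - cis (\<alpha> / 2)" by (auto simp: Z_def)
    show "Im z \<noteq> 0" using \<alpha> Im_pos[OF \<alpha>(1)] by auto
    show "cmod z = 1" using \<alpha> by auto
    have "z\<^sup>2 = cis \<alpha>" using \<alpha>(2) by (auto simp: power2_eq_square cis_mult)
    hence "P (z\<^sup>2) = (\<Sum>i\<le>m. of_real (p i) * cis (real i * \<alpha>))" by (simp add: P_def Complex.DeMoivre)
    also have "\<dots> = 0" by (rule S(4)[OF \<alpha>(1)])
    finally show "poly r z = 0" by (simp add: ev)
  qed
  \<comment> \<open>Nine real zeros with multiplicity and 2 (m - 4) nonreal ones on the circle:
    exactly 2 m + 1 in all.\<close>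
  define M where "M = {#0, 2, -2, 1/2, -1/2, 1, 1, -1, -1#} + mset_set Z"
  have notin: "x \<notin> Z" if "Im x = 0" for x using Z(3)[of x] that by auto
  have ne: "- (1 / 2) \<noteq> (2 :: complex)" "- (1 / 2) \<noteq> (1 :: complex)"
    by (simp_all add: complex_eq_iff)
  have notinZ: "0 \<notin> Z" "2 \<notin> Z" "-2 \<notin> Z" "1/2 \<notin> Z" "-1/2 \<notin> Z" "1 \<notin> Z" "-1 \<notin> Z"
    by (rule notin; simp)+
  have cnt: "count M x \<le> count (proots r) x" for x
  proof (cases "x \<in> Z")
    case True
    hence "x \<notin> {0, 2, -2, 1/2, -1/2, 1, -1}" using notinZ by blast
    hence "count M x = 1" using True finZ ne by (auto simp: M_def)
    moreover have "order x r \<ge> 1" using Z(1)[OF True] r0 order_root[of r x] by auto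
    ultimately show ?thesis using r0 by simp
  next
    case False
    have roots: "order x r \<ge> 1" if "x \<in> {0, 2, -2, 1/2, -1/2}" for x
    proof -
      have "poly r 0 = 0" "poly r 2 = 0" "poly r (- 2) = 0" "poly r (1/2) = 0" "poly r (- 1/2) = 0"
        using P4 P14 by (simp_all add: ev power2_eq_square)
      hence "poly r x = 0" using that by blast
      thus ?thesis using r0 order_root[of r x] by auto
    qed
    have double: "order x r \<ge> 2" if "x \<in> {1, -1}" for x
      by (rule order_ge_2I) (use that P1 pd[of x] deg in \<open>auto simp: ev\<close>)
    consider "x \<in> {0, 2, -2, 1/2, -1/2}" | "x \<in> {1, -1}" | "x \<notin> {0, 2, -2, 1/2, -1/2, 1, -1}" by blast
    thus ?thesis
    proof cases
      case 1
      hence "count M x = 1" using False finZ ne by (auto simp: M_def)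
      with roots[OF 1] r0 show ?thesis by simp
    next
      case 2
      hence "count M x = 2" using False finZ ne by (auto simp: M_def)
      with double[OF 2] r0 show ?thesis by simp
    next
      case 3
      hence "count M x = 0" using False finZ ne by (auto simp: M_def)
      thus ?thesis by simp
    qed
  qed
  \<comment> \<open>A submultiset of the same size is the whole multiset, so the lower bounds for
    the multiplicities become equalities.\<close>
  hence sub: "M \<subseteq># proots r" by (simp add: subseteq_mset_def)
  have "size M = 2 * m + 1" using m cardZ by (simp add: M_def)
  hence "size (proots r) = size M" by (simp add: size_proots_complex deg)
  hence eq: "proots r = M" using sub by (metis mset_subset_size nless_le subset_mset.le_imp_less_or_eq)
  have ord: "order x r = count M x" for x using r0 by (simp add: eq[symmetric])
  have filt: "{#z \<in># M. cmod z \<noteq> 1#} = {#0, 2, -2, 1/2, -1/2#}"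
  proof -
    have e: "{z \<in> Z. cmod z \<noteq> 1} = {}" using Z(2) by auto
    have "{#z \<in># mset_set Z. cmod z \<noteq> 1#} = mset_set {z \<in> Z. cmod z \<noteq> 1}"
      by (rule filter_mset_mset_set[OF finZ])
    also have "\<dots> = {#}" by (simp only: e mset_set.empty)
    finally have "{#z \<in># mset_set Z. cmod z \<noteq> 1#} = {#}" .
    thus ?thesis by (simp add: M_def)
  qed
  have "{z. poly r z = 0 \<and> cmod z \<noteq> 1} = set_mset {#z \<in># proots r. cmod z \<noteq> 1#}"
    using r0 by auto
  also have "\<dots> = {0, 2, -2, 1/2, -1/2}" unfolding eq filt by simp
  finally have off: "{z. poly r z = 0 \<and> cmod z \<noteq> 1} = {0, 2, -2, 1/2, -1/2}" .
  have "order 0 r = 1" "order 2 r = 1" "order (- 2) r = 1" "order (1/2) r = 1" "order (- 1/2) r = 1"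
    unfolding ord using notinZ finZ ne by (auto simp: M_def)
  hence "\<forall>z\<in>{0, 2, -2, 1/2, -1/2}. order z r = 1" by blast
  moreover have "order 1 r = 2" "order (-1) r = 2" unfolding ord using notinZ finZ ne by (auto simp: M_def)
  moreover have "size {#z \<in># proots r. cmod z \<noteq> 1#} = 5" unfolding eq filt by simp
  ultimately show ?thesis using deg off by blast
qed

section \<open>Period polynomials of eigenforms\<close>

locale hecke_expansion = cusp_expansion +
  fixes h :: nat and ev :: "nat \<Rightarrow> complex"
  assumes k_even: "k = 2 * h" and h_ge: "h \<ge> 40"
    and nonzero: "\<exists>z. Im z > 0 \<and> f z \<noteq> 0"
    and hecke: "\<And>n z. n > 0 \<Longrightarrow> Im z > 0 \<Longrightarrow> hecke_op k n f z = ev n * f z"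
begin

lemma coeff_eq:
  assumes n: "n > 0"
  shows "a n = ev n * a 1"
  by (rule hecke_eigenvalue_coeff[OF n _ hecke[OF n]]) (use h_ge k_even in simp)

lemma a1_nonzero: "a 1 \<noteq> 0"
proof
  assume "a 1 = 0"
  hence "a n = 0" for n using coeff_eq[of n] a0 by (cases "n = 0") auto
  hence "f z = 0" if "Im z > 0" for z using sums_f[OF that] by (simp add: sums_iff)
  with nonzero show False by auto
qed

lemma h_pos: "h > 0"
  using h_ge by simp

lemma ev_real:
  assumes n: "n > 0"
  shows "ev n \<in> \<real>"
proof -
  obtain z where z: "Im z > 0" "f z \<noteq> 0" using nonzero by blast
  show ?thesis by (rule hecke_eigenvalue_real[OF n k_even h_pos z hecke[OF n]])
qed

lemma ev_bound:
  assumes n: "n > 0"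
  shows "cmod (ev n) \<le> real n ^ (h + 1)"
proof -
  obtain z where z: "Im z > 0" "f z \<noteq> 0" using nonzero by blast
  show ?thesis by (rule hecke_eigenvalue_bound[OF n k_even h_pos z hecke[OF n]])
qed

sublocale bounded_cusp_expansion k f a h "cmod (a 1)"
proof
  show "k = 2 * h" by (rule k_even)
  fix n :: nat assume "n \<ge> 1"
  hence "cmod (a n) = cmod (ev n) * cmod (a 1)" using coeff_eq[of n] by (simp add: norm_mult)
  also have "\<dots> \<le> real n ^ (h + 1) * cmod (a 1)" using ev_bound[of n] \<open>n \<ge> 1\<close> by (intro mult_right_mono) auto
  finally show "cmod (a n) \<le> cmod (a 1) * real n ^ (h + 1)" by (simp add: mult.commute)
qed

text \<open>As f is not normalised, its coefficients are real only after division by a(1), where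
  they become the eigenvalues; on the imaginary axis the exponentials are real too.\<close>

lemma f_axis_normalized_real: "f_axis t / a 1 \<in> \<real>"
proof -
  have "(\<lambda>n. a n * of_real (exp (- (2 * pi * real n * exp t))) / a 1) sums (f_axis t / a 1)"
    by (intro sums_divide f_axis_sums)
  hence "(\<lambda>n. Im (a n * of_real (exp (- (2 * pi * real n * exp t))) / a 1)) sums Im (f_axis t / a 1)"
    by (rule sums_Im)
  moreover have "Im (a n * of_real (exp (- (2 * pi * real n * exp t))) / a 1) = 0" for n
  proof (cases "n = 0")
    case False
    hence "a n * of_real (exp (- (2 * pi * real n * exp t))) / a 1 = ev n * of_real (exp (- (2 * pi * real n * exp t)))"
      using coeff_eq[of n] a1_nonzero by simp
    moreover have "\<dots> \<in> \<real>" using ev_real[of n] False by (intro Reals_mult) auto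
    ultimately show ?thesis by (simp add: complex_is_Real_iff)
  qed (simp add: a0)
  ultimately have "Im (f_axis t / a 1) = 0" by (simp add: sums_iff)
  thus ?thesis by (simp add: complex_is_Real_iff)
qed

lemma Lam_normalized_real: "Lam (of_nat N) / a 1 \<in> \<real>"
proof -
  define g where "g = (\<lambda>t. Re (f_axis t / a 1) * exp (real N * t))"
  have "of_real (g t) = f_axis t * exp (of_nat N * of_real t) / a 1" for t
  proof -
    have "of_real (Re (f_axis t / a 1)) = f_axis t / a 1" using f_axis_normalized_real by (rule of_real_Re)
    moreover have "of_real (exp (real N * t)) = exp (of_nat N * complex_of_real t)" by (simp flip: exp_of_real)
    ultimately show ?thesis by (simp only: g_def of_real_mult) simp
  qed
  hence "Lam (of_nat N) / a 1 = (\<integral>t. complex_of_real (g t) \<partial>lborel)"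
    unfolding Lam_def by simp
  also have "\<dots> = of_real (\<integral>t. g t \<partial>lborel)" by (rule integral_complex_of_real)
  finally show ?thesis by simp
qed

text \<open>The normalised L-value L(N) / a(1). The real part provides the real type and loses
  nothing for N > 0, by \<open>Lentire_eq_ell\<close>.\<close>

definition ell :: "nat \<Rightarrow> real" where "ell N = Re (Lentire (of_nat N) / a 1)"

lemma Lentire_nat: "Lentire (of_nat (Suc n)) = Lam (of_nat (Suc n)) * of_real ((2 * pi) ^ Suc n / fact n)"
  using L_function_nat[of n]
  by (simp only: L_function_eq of_real_divide of_real_power of_real_fact times_divide_eq_right)

lemma Lentire_eq_ell: "N > 0 \<Longrightarrow> Lentire (of_nat N) = a 1 * of_real (ell N)"
proof -
  assume "N > 0"
  then obtain n where N: "N = Suc n" by (cases N) auto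
  have "Lentire (of_nat N) / a 1 = Lam (of_nat N) / a 1 * of_real ((2 * pi) ^ Suc n / fact n)"
    unfolding N Lentire_nat by simp
  hence "Lentire (of_nat N) / a 1 \<in> \<real>" using Lam_normalized_real by (metis Reals_mult Reals_of_real)
  hence "of_real (ell N) = Lentire (of_nat N) / a 1" unfolding ell_def by (rule of_real_Re)
  thus ?thesis using a1_nonzero by simp
qed

lemma ell_near_1: "N \<ge> h + 3 \<Longrightarrow> \<bar>ell N - 1\<bar> \<le> 4 / 2 ^ (N - h - 1)"
proof -
  assume N: "N \<ge> h + 3"
  have "Lentire (of_nat N) - a 1 = a 1 * of_real (ell N - 1)"
    using Lentire_eq_ell[of N] N by (simp add: algebra_simps)
  hence "cmod (Lentire (of_nat N) - a 1) = cmod (a 1) * \<bar>ell N - 1\<bar>" by (simp only: norm_mult norm_of_real)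
  hence "cmod (a 1) * \<bar>ell N - 1\<bar> \<le> cmod (a 1) * (4 / 2 ^ (N - h - 1))"
    using Lentire_near_first_coeff[OF N] by (simp only: times_divide_eq_right mult.commute)
  moreover have "cmod (a 1) > 0" using a1_nonzero by simp
  ultimately show ?thesis by (simp only: mult_le_cancel_left_pos)
qed

text \<open>With n = N - 1 >= h - 1 the quotient (h + 2)! / n! has at most three factors, each at
  most h + 2. The powers of 2 pi cancel once the exponent N is raised to h + 3.\<close>

lemma ell_central_bound:
  assumes "h \<le> N" "N \<le> h + 2"
  shows "\<bar>ell N\<bar> \<le> 4 * (real h + 2) ^ 3"
proof -
  obtain n where n: "N = Suc n" using assms h_ge by (cases N) auto
  obtain h' where h': "h = Suc h'" using h_ge by (cases h) auto
  have c: "cmod (a 1) > 0" using a1_nonzero by simp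
  have fact: "fact (h + 2) \<le> (real h + 2) ^ 3 * fact n"
  proof -
    have "fact (h + 2) = (real h + 2) * ((real h + 1) * (real h * fact h'))"
      by (simp add: h' algebra_simps)
    also have "\<dots> \<le> (real h + 2) * ((real h + 2) * ((real h + 2) * fact n))"
      using assms n h' by (intro mult_mono mult_left_mono mult_nonneg_nonneg fact_mono) auto
    finally show ?thesis by (simp add: power3_eq_cube mult.assoc)
  qed
  have "cmod (a 1) * \<bar>ell N\<bar> = cmod (Lam (of_nat N)) * ((2 * pi) ^ N / fact n)"
    using Lentire_eq_ell[of N] Lentire_nat[of n] n by (metis abs_of_nonneg divide_nonneg_nonneg fact_ge_zero norm_mult norm_of_real pi_ge_zero zero_le_mult_iff zero_le_numeral zero_le_power zero_less_Suc)
  also have "\<dots> \<le> (4 * cmod (a 1) * fact (h + 2) / (2 * pi) ^ (h + 3)) * ((2 * pi) ^ (h + 3) / fact n)"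
    using assms pi_gt3 by (intro mult_mono Lam_central_bound divide_right_mono power_increasing) auto
  also have "\<dots> = 4 * cmod (a 1) * (fact (h + 2) / fact n)" by simp
  also have "\<dots> \<le> 4 * cmod (a 1) * (real h + 2) ^ 3"
    using fact by (intro mult_left_mono) (auto simp: divide_le_eq)
  also have "\<dots> = cmod (a 1) * (4 * (real h + 2) ^ 3)" by simp
  finally show ?thesis using c by simp
qed

section \<open>Coefficients of the period polynomial and their symmetry\<close>

definition pcoeff :: "nat \<Rightarrow> real" where
  "pcoeff i = sin_coeff2 i * ell (2 * h - 2 - 2 * i)"

text \<open>The completed L-function makes the symmetry visible: i -> h - 2 - i exchanges the two
  factorials and reflects the argument 2h - 2 - 2i about the centre h.\<close>

lemma pcoeff_eq_Lam:
  assumes "i \<le> h - 2"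
  shows "of_real (pcoeff i) * a 1 =
    of_real ((- 1) ^ i * (2 * pi) ^ (2 * h - 1) / (fact (2 * i + 1) * fact (2 * h - 3 - 2 * i))) * Lam (of_nat (2 * h - 2 - 2 * i))"
proof -
  define n where "n = 2 * h - 3 - 2 * i"
  have N: "2 * h - 2 - 2 * i = Suc n" "2 * h - 1 = (2 * i + 1) + Suc n" using assms h_ge by (auto simp: n_def)
  have "of_real (pcoeff i) * a 1 = of_real (sin_coeff2 i) * (a 1 * of_real (ell (Suc n)))"
    unfolding pcoeff_def N(1) of_real_mult by (simp only: mult_ac)
  also have "\<dots> = of_real (sin_coeff2 i) * (Lam (of_nat (Suc n)) * of_real ((2 * pi) ^ Suc n / fact n))"
    using Lentire_eq_ell[of "Suc n"] Lentire_nat[of n] by simp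
  also have "\<dots> = of_real (sin_coeff2 i * ((2 * pi) ^ Suc n / fact n)) * Lam (of_nat (Suc n))"
    by (simp only: of_real_mult mult_ac)
  also have "sin_coeff2 i * ((2 * pi) ^ Suc n / fact n) = (- 1) ^ i * (2 * pi) ^ (2 * h - 1) / (fact (2 * i + 1) * fact n)"
    unfolding sin_coeff2_def N(2) power_add[of "2 * pi" "2 * i + 1"] by (simp only: times_divide_times_eq mult.assoc)
  finally show ?thesis by (simp only: N(1) n_def)
qed

text \<open>For j = h - 2 - i the sign (-1)^h of the functional equation is (-1)^(i+j), exactly the
  quotient of the signs (-1)^i and (-1)^j of the two coefficients.\<close>

lemma pcoeff_palindromic:
  assumes i: "i \<le> h - 2"
  shows "pcoeff (h - 2 - i) = pcoeff i"
proof -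
  define j where "j = h - 2 - i"
  have j: "j \<le> h - 2" "2 * j + 1 = 2 * h - 3 - 2 * i" "2 * h - 3 - 2 * j = 2 * i + 1"
     "2 * h - 2 - 2 * j = 2 * i + 2" "2 * h - 2 - 2 * i = 2 * j + 2" "h = i + j + 2"
    using i h_ge by (auto simp: j_def)
  have "of_nat (2 * i + 2) = of_nat k - (of_nat (2 * j + 2) :: complex)"
    by (simp add: k_even j(6))
  hence "Lam (of_nat (2 * i + 2)) = \<i> ^ k * Lam (of_nat (2 * j + 2))"
    by (simp only: Lam_functional_equation)
  also have "\<i> ^ k = of_real ((- 1) ^ i * (- 1) ^ j)" by (simp add: k_even j(6) power_mult power_add)
  finally have L: "Lam (of_nat (2 * i + 2)) = of_real ((- 1) ^ i * (- 1) ^ j) * Lam (of_nat (2 * j + 2))" .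
  have sg: "(- 1) ^ j * ((- 1) ^ i * (- 1) ^ j) = ((- 1) ^ i :: real)" by (simp add: mult.left_commute flip: power_mult_distrib)
  have "of_real (pcoeff j) * a 1 =
      of_real ((- 1) ^ j * (2 * pi) ^ (2 * h - 1) / (fact (2 * j + 1) * fact (2 * i + 1))) * Lam (of_nat (2 * i + 2))"
    using pcoeff_eq_Lam[OF j(1)] by (simp only: j(3,4))
  also have "\<dots> = of_real (((- 1) ^ j * ((- 1) ^ i * (- 1) ^ j)) * (2 * pi) ^ (2 * h - 1) / (fact (2 * j + 1) * fact (2 * i + 1))) * Lam (of_nat (2 * j + 2))"
    unfolding L by (simp only: mult.assoc[symmetric] of_real_mult[symmetric]) (simp add: mult_ac)
  also have "\<dots> = of_real (pcoeff i) * a 1"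
    unfolding sg using pcoeff_eq_Lam[OF i] by (simp only: j(5) j(2)[symmetric] mult.commute[of "fact (2 * j + 1)"])
  finally show ?thesis using a1_nonzero by (simp add: j_def)
qed

lemma sum_odd_reflect:
  fixes g :: "nat \<Rightarrow> complex"
  assumes "\<And>j. j \<le> 2 * h - 2 \<Longrightarrow> even j \<Longrightarrow> g j = 0"
  shows "(\<Sum>j\<le>2 * h - 2. g j) = (\<Sum>i\<le>h - 2. g (2 * h - 3 - 2 * i))"
proof -
  have "(\<Sum>i\<le>h - 2. g (2 * h - 3 - 2 * i)) = (\<Sum>j | j \<le> 2 * h - 2 \<and> odd j. g j)"
  proof (rule sum.reindex_bij_witness[of _ "\<lambda>j. (2 * h - 3 - j) div 2" "\<lambda>i. 2 * h - 3 - 2 * i"])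
    fix j assume "j \<in> {j. j \<le> 2 * h - 2 \<and> odd j}"
    then obtain b where "j = 2 * b + 1" "b \<le> h - 2" by (auto elim!: oddE)
    hence j: "2 * h - 3 - j = 2 * (h - 2 - b)" "2 * h - 3 - 2 * (h - 2 - b) = j" using h_ge by auto
    show "2 * h - 3 - 2 * ((2 * h - 3 - j) div 2) = j" unfolding j(1) using j(2) by simp
    show "(2 * h - 3 - j) div 2 \<in> {..h - 2}" unfolding j(1) by simp
  next
    fix i assume "i \<in> {..h - 2}"
    hence "i \<le> h - 2" by simp
    hence i: "2 * h - 3 - (2 * h - 3 - 2 * i) = 2 * i" "2 * h - 3 - 2 * i = 2 * (h - 2 - i) + 1" using h_ge by auto
    show "(2 * h - 3 - (2 * h - 3 - 2 * i)) div 2 = i" unfolding i(1) by simp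
    have "odd (2 * h - 3 - 2 * i)" unfolding i(2) by simp
    thus "2 * h - 3 - 2 * i \<in> {j. j \<le> 2 * h - 2 \<and> odd j}" by auto
  qed simp
  also have "\<dots> = (\<Sum>j\<le>2 * h - 2. g j)"
    using assms by (intro sum.mono_neutral_left) auto
  finally show ?thesis by simp
qed

lemma i_power_reflect: "i \<le> h - 2 \<Longrightarrow> \<i> ^ (2 * h - 3 - 2 * i) = of_real ((- 1) ^ h * (- 1) ^ i) * \<i>"
proof -
  assume i: "i \<le> h - 2"
  hence e: "2 * h - 3 - 2 * i = 2 * (h - 2 - i) + 1" "h = (h - 2 - i) + i + 2" using h_ge by auto
  have "(- 1) ^ h = ((- 1) ^ (h - 2 - i) * (- 1) ^ i :: real)" by (subst e(2)) (simp add: power_add)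
  hence "(- 1) ^ h * (- 1) ^ i = ((- 1) ^ (h - 2 - i) :: real)" by (simp flip: power_mult_distrib)
  thus ?thesis unfolding e(1) by (simp add: power_add power_mult)
qed

text \<open>Binomial expansion of the vanishing integral: terms with even j cancel between the two
  powers, those with odd j yield Lam(j + 1), and j = 2h - 3 - 2i turns the result into a nonzero
  multiple of the stated sum.\<close>

lemma pcoeff_trivial_zero:
  assumes N: "N = 1 \<or> N = (2::nat)"
  shows "(\<Sum>i\<le>h - 2. pcoeff i * real N ^ (2 * i + 1)) = 0"
proof -
  define w where "w = 2 * h - 2"
  have w: "k = w + 2" "even w" using h_ge by (auto simp: w_def k_even)
  define c where "c = (\<lambda>j. of_nat (w choose j) * \<i> ^ j * ((- of_nat N) ^ (w - j) - of_nat N ^ (w - j)) :: complex)"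
  have expand: "f_axis t * of_real (exp t) * ((\<i> * of_real (exp t) - of_nat N) ^ w - (\<i> * of_real (exp t) + of_nat N) ^ w) =
      (\<Sum>j\<le>w. c j * (f_axis t * exp (of_nat (Suc j) * of_real t)))" for t
  proof -
    let ?x = "\<i> * of_real (exp t)"
    have "(?x - of_nat N) ^ w - (?x + of_nat N) ^ w =
       (\<Sum>j\<le>w. of_nat (w choose j) * ?x ^ j * (- of_nat N) ^ (w - j)) - (\<Sum>j\<le>w. of_nat (w choose j) * ?x ^ j * of_nat N ^ (w - j))"
      using binomial_ring[of ?x "- of_nat N" w] binomial_ring[of ?x "of_nat N" w] by simp
    also have "\<dots> = (\<Sum>j\<le>w. c j * of_real (exp t) ^ j)"
      unfolding sum_subtractf[symmetric] by (intro sum.cong refl) (simp add: c_def power_mult_distrib algebra_simps)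
    finally have "f_axis t * of_real (exp t) * ((?x - of_nat N) ^ w - (?x + of_nat N) ^ w) =
       (\<Sum>j\<le>w. c j * (f_axis t * of_real (exp t) ^ Suc j))"
      by (simp add: sum_distrib_left mult_ac)
    moreover have "of_real (exp t) ^ Suc j = exp (of_nat (Suc j) * complex_of_real t)" for j
      by (simp only: exp_of_nat_mult exp_of_real)
    ultimately show ?thesis by simp
  qed
  have "0 = (\<integral>t. (\<Sum>j\<le>w. c j * (f_axis t * exp (of_nat (Suc j) * of_real t))) \<partial>lborel)"
    using trivial_zero_integral[OF N w] unfolding expand by simp
  also have "\<dots> = (\<Sum>j\<le>w. \<integral>t. c j * (f_axis t * exp (of_nat (Suc j) * of_real t)) \<partial>lborel)"
    by (intro Bochner_Integration.integral_sum integrable_mult_right integrable_f_axis_exp)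
  also have "\<dots> = (\<Sum>j\<le>w. c j * Lam (of_nat (Suc j)))"
    by (simp only: integral_mult_right_zero Lam_def)
  also have "\<dots> = (\<Sum>i\<le>h - 2. c (2 * h - 3 - 2 * i) * Lam (of_nat (Suc (2 * h - 3 - 2 * i))))"
    unfolding w_def by (rule sum_odd_reflect) (use w in \<open>auto simp: c_def w_def\<close>)
  also have "\<dots> = (\<Sum>i\<le>h - 2. (- 2 * \<i> * of_real ((- 1) ^ h * fact w / (2 * pi) ^ (2 * h - 1)) * a 1) * of_real (pcoeff i * real N ^ (2 * i + 1)))"
  proof (intro sum.cong refl)
    fix i assume "i \<in> {..h - 2}"
    hence i: "i \<le> h - 2" by simp
    define j where "j = 2 * h - 3 - 2 * i"
    have j: "w - j = 2 * i + 1" "j \<le> w" "2 * h - 2 - 2 * i = Suc j" using i h_ge by (auto simp: j_def w_def)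
    have cj: "c j = - 2 * \<i> * of_real ((- 1) ^ h * fact w * ((- 1) ^ i / (fact (2 * i + 1) * fact j)) * real N ^ (2 * i + 1))"
    proof -
      have "(of_nat (w choose j) :: complex) = of_real (fact w / (fact j * fact (2 * i + 1)))"
        using binomial_fact[OF j(2), where 'a = complex] by (simp add: j(1))
      moreover have "\<i> ^ j = of_real ((- 1) ^ h * (- 1) ^ i) * \<i>" unfolding j_def by (rule i_power_reflect[OF i])
      moreover have "(- of_nat N) ^ (w - j) - of_nat N ^ (w - j) = (of_real (- 2 * real N ^ (2 * i + 1)) :: complex)"
        by (simp add: j(1))
      ultimately show ?thesis unfolding c_def by (simp add: mult_ac)
    qed
    have "c j * Lam (of_nat (Suc j)) = (- 2 * \<i> * of_real ((- 1) ^ h * fact w / (2 * pi) ^ (2 * h - 1))) *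
       (of_real ((- 1) ^ i * (2 * pi) ^ (2 * h - 1) / (fact (2 * i + 1) * fact j)) * Lam (of_nat (Suc j))) * of_real (real N ^ (2 * i + 1))"
      unfolding cj by (simp add: field_simps)
    also have "of_real ((- 1) ^ i * (2 * pi) ^ (2 * h - 1) / (fact (2 * i + 1) * fact j)) * Lam (of_nat (Suc j)) = of_real (pcoeff i) * a 1"
      using pcoeff_eq_Lam[OF i] by (simp only: j(3) j_def)
    finally show "c (2 * h - 3 - 2 * i) * Lam (of_nat (Suc (2 * h - 3 - 2 * i))) =
       (- 2 * \<i> * of_real ((- 1) ^ h * fact w / (2 * pi) ^ (2 * h - 1)) * a 1) * of_real (pcoeff i * real N ^ (2 * i + 1))"
      by (simp only: j_def of_real_mult mult_ac)
  qed
  also have "\<dots> = (- 2 * \<i> * of_real ((- 1) ^ h * fact w / (2 * pi) ^ (2 * h - 1)) * a 1) * of_real (\<Sum>i\<le>h - 2. pcoeff i * real N ^ (2 * i + 1))"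
    by (simp only: sum_distrib_left of_real_sum)
  finally have "complex_of_real (\<Sum>i\<le>h - 2. pcoeff i * real N ^ (2 * i + 1)) = 0"
    using a1_nonzero by simp
  thus ?thesis by (simp only: of_real_eq_0_iff)
qed

text \<open>The index n = 2h - 3 - 2i gives the exponent w - n = 2i + 1. There n! cancels against
  the binomial coefficient and leaves w! / (2i + 1)!, and (2 pi)^(-n-1) is (2 pi)^(2i+1) over the
  common power (2 pi)^(2h-1).\<close>

lemma odd_period_poly_eq:
  "odd_period_poly (2 * h - 2) a = (\<Sum>i\<le>h - 2. monom
     (of_real ((- 1) ^ h * fact (2 * h - 2) / (2 * pi) ^ (2 * h - 1)) * a 1 * of_real (pcoeff i)) (2 * i + 1))"
proof -
  define w where "w = 2 * h - 2"
  let ?c = "\<lambda>n. (-1) ^ ((n - 1) div 2) * of_nat (w choose n) * fact n * (2 * of_real pi) powi (- int n - 1) * L_function a (of_nat (n + 1))"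
  have "odd_period_poly w a = (\<Sum>i\<le>h - 2. monom (?c (2 * h - 3 - 2 * i)) (w - (2 * h - 3 - 2 * i)))"
    unfolding odd_period_poly_def using h_ge
    by (intro sum.reindex_bij_witness[of _ "\<lambda>i. 2 * h - 3 - 2 * i" "\<lambda>j. (2 * h - 3 - j) div 2"])
      (auto simp: w_def elim!: oddE)
  also have "\<dots> = (\<Sum>i\<le>h - 2. monom
     (of_real ((- 1) ^ h * fact w / (2 * pi) ^ (2 * h - 1)) * a 1 * of_real (pcoeff i)) (2 * i + 1))"
  proof (intro sum.cong refl)
    fix i assume "i \<in> {..h - 2}"
    hence i: "i \<le> h - 2" by simp
    define n where "n = 2 * h - 3 - 2 * i"
    have n: "w - n = 2 * i + 1" "n \<le> w" "2 * h - 2 - 2 * i = Suc n" "(n - 1) div 2 = h - 2 - i" "2 * h - 1 = 2 * i + 1 + Suc n"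
      using i h_ge by (auto simp: n_def w_def)
    have e: "h = (h - 2 - i) + i + 2" using i h_ge by simp
    have "(- 1) ^ h = ((- 1) ^ (h - 2 - i) * (- 1) ^ i :: complex)" by (subst e) (simp add: power_add)
    hence sg: "(- 1) ^ (h - 2 - i) = ((- 1) ^ h * (- 1) ^ i :: complex)" by (simp flip: power_mult_distrib add: mult.assoc)
    have bin: "of_nat (w choose n) * fact n = (fact w / fact (2 * i + 1) :: complex)"
      using binomial_fact[OF n(2), where 'a = complex] by (simp add: n(1))
    have pw: "(2 * of_real pi) powi (- int n - 1) = (1 / of_real ((2 * pi) ^ Suc n) :: complex)"
    proof -
      have e: "- int n - 1 = - int (Suc n)" by simp
      have "(2 * of_real pi) powi (- int (Suc n)) = inverse ((2 * of_real pi) ^ Suc n :: complex)"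
        by (simp only: power_int_minus power_int_of_nat)
      also have "\<dots> = 1 / of_real ((2 * pi) ^ Suc n)"
        by (simp only: inverse_eq_divide of_real_power of_real_mult of_real_numeral)
      finally show ?thesis by (simp only: e)
    qed
    have "?c n = (-1) ^ ((n - 1) div 2) * (of_nat (w choose n) * fact n) * (2 * of_real pi) powi (- int n - 1) * L_function a (of_nat (n + 1))"
      by (simp only: mult.assoc)
    also have "\<dots> = ((- 1) ^ h * (- 1) ^ i) * (fact w / fact (2 * i + 1)) * (1 / of_real ((2 * pi) ^ Suc n)) * (a 1 * of_real (ell (Suc n)))"
      unfolding n(4) sg bin pw using Lentire_eq_ell[of "Suc n"] by (simp only: L_function_eq Suc_eq_plus1[symmetric] zero_less_Suc simp_thms)
    also have "\<dots> = of_real ((- 1) ^ h * fact w / (2 * pi) ^ (2 * h - 1)) * a 1 * of_real (pcoeff i)"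
      unfolding pcoeff_def sin_coeff2_def n(3) n(5) power_add[of "2 * pi" "2 * i + 1"] by (simp add: mult_ac)
    finally show "monom (?c (2 * h - 3 - 2 * i)) (w - (2 * h - 3 - 2 * i)) =
       monom (of_real ((- 1) ^ h * fact w / (2 * pi) ^ (2 * h - 1)) * a 1 * of_real (pcoeff i)) (2 * i + 1)"
      using n(1) by (simp only: n_def)
  qed
  finally show ?thesis by (simp only: w_def)
qed

text \<open>L(w) lies far in the region of absolute convergence, so it is within a factor of a(1).
  By symmetry this is also the leading coefficient, which fixes the degree.\<close>

lemma pcoeff_0_nonzero: "pcoeff 0 \<noteq> 0"
proof -
  have "\<bar>ell (2 * h - 2) - 1\<bar> \<le> 4 / 2 ^ (2 * h - 2 - h - 1)"
    using h_ge by (intro ell_near_1) auto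
  also have "\<dots> \<le> 4 / 2 ^ 3" using h_ge by (intro divide_left_mono power_increasing) auto
  finally have "ell (2 * h - 2) \<noteq> 0" by auto
  thus ?thesis by (simp add: pcoeff_def sin_coeff2_def)
qed

end

theorem theorem2:
  fixes k w :: nat and f :: "complex \<Rightarrow> complex" and a :: "nat \<Rightarrow> complex"
    and r :: "complex poly"
  assumes "k \<ge> 80" and "even k" and "w = k - 2"
    and "hecke_eigenform k f"
    and "has_q_expansion f a" and "a 0 = 0"
    and "r = odd_period_poly w a"
  shows "degree r = w - 1 \<and>
     size {#z \<in># proots r. cmod z \<noteq> 1#} = 5 \<and>
     {z. poly r z = 0 \<and> cmod z \<noteq> 1} = {0, 2, -2, 1/2, -1/2} \<and>
     (\<forall>z\<in>{0, 2, -2, 1/2, -1/2}. order z r = 1) \<and>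
     order 1 r = 2 \<and> order (-1) r = 2"
proof -
  obtain h where k: "k = 2 * h" using assms(2) by (elim evenE)
  have h: "h \<ge> 40" and w: "w = 2 * h - 2" using assms(1,3) k by auto
  obtain ev where ev: "\<And>n z. n > 0 \<Longrightarrow> z \<in> upper_half_plane \<Longrightarrow> hecke_op k n f z = ev n * f z"
    using assms(4) unfolding hecke_eigenform_def by metis
  interpret hecke_expansion k f a h ev
  proof
    show "cusp_form k f" "\<exists>z. Im z > 0 \<and> f z \<noteq> 0"
      using assms(4) by (auto simp: hecke_eigenform_def upper_half_plane_def)
    show "hecke_op k n f z = ev n * f z" if "n > 0" "Im z > 0" for n z
      using ev that by (simp add: upper_half_plane_def)
  qed (fact assms k h)+
  obtain S where S: "finite S" "card S = h - 6" "S \<subseteq> {0<..<2 * pi}"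
    "\<And>\<alpha>. \<alpha> \<in> S \<Longrightarrow> (\<Sum>i\<le>h - 2. of_real (pcoeff i) * cis (real i * \<alpha>)) = 0"
  proof (rule circle_zeros[where L = ell and p = pcoeff])
    show "(\<Sum>i\<le>h - 2. pcoeff i) = 0" using pcoeff_trivial_zero[of 1] by simp
  qed (use h ell_near_1 ell_central_bound pcoeff_palindromic in \<open>auto simp: pcoeff_def\<close>)
  have r: "r = (\<Sum>i\<le>h - 2. monom
      (of_real ((- 1) ^ h * fact (2 * h - 2) / (2 * pi) ^ (2 * h - 1)) * a 1 * of_real (pcoeff i)) (2 * i + 1))"
    unfolding assms(7) w by (rule odd_period_poly_eq)
  have sum1: "(\<Sum>i\<le>h - 2. pcoeff i) = 0" using pcoeff_trivial_zero[of 1] by simp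
  \<comment> \<open>For N = 2 the power 2^(2i+1) is 2 times 4^i, so the zero X = 2 becomes Y =
    4.\<close>
  have sum4: "(\<Sum>i\<le>h - 2. pcoeff i * 4 ^ i) = 0"
    using pcoeff_trivial_zero[of 2] by (simp add: power_mult sum_distrib_left[symmetric] mult.left_commute)
  have deg: "2 * (h - 2) + 1 = w - 1" "4 \<le> h - 2" "h - 6 = h - 2 - 4" using h w by auto
  show ?thesis
    unfolding deg(1)[symmetric]
  proof (rule period_poly_zeros[OF pcoeff_palindromic sum1 sum4 _ pcoeff_0_nonzero deg(2) S(1) _ S(3,4) r])
    show "of_real ((- 1) ^ h * fact (2 * h - 2) / (2 * pi) ^ (2 * h - 1)) * a 1 \<noteq> 0"
      using a1_nonzero by simp
    show "card S = h - 2 - 4" by (rule trans[OF S(2) deg(3)])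
  qed
qed

end
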